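(* Let $r\ge1$ be an integer. Then for $\mathrm{Re}(s)>r$, $$\xi_{\mathbb Q,r}(s)=\frac r2\int_{\mathcal M_{\mathbb Q,r}[1]}\hat E\Big(\Lambda,\frac r2 s\Big)\,d\mu_1(\Lambda).$$
   Context: A lattice $\Lambda$ of rank $r$ (a full-rank lattice in Euclidean space $\mathbb R^r$, taken up to isometry) is called semi-stable if for every nonzero sublattice $\Lambda_1\subset\Lambda$ one has $(\mathrm{Vol}\,\Lambda_1)^{\mathrm{rank}\,\Lambda}\ge(\mathrm{Vol}\,\Lambda)^{\mathrm{rank}\,\Lambda_1}$, where $\mathrm{Vol}$ is the covolume. $\mathcal M_{\mathbb Q,r}$ is the moduli space of rank $r$ semi-stable lattices and $\mathcal M_{\mathbb Q,r}[T]$ the subspace of those of volume $T$, so $\mathcal M_{\mathbb Q,r}=\bigcup_{T>0}\mathcal M_{\mathbb Q,r}[T]$; scaling by $T^{1/r}$ identifies $\mathcal M_{\mathbb Q,r}[1]$ with $\mathcal M_{\mathbb Q,r}[T]$, hence $\mathcal M_{\mathbb Q,r}\simeq\mathcal M_{\mathbb Q,r}[1]\times\mathbb R_{>0}$. The measure $d\mu_1$ on $\mathcal M_{\mathbb Q,r}[1]$ is the invariant (Tamagawa) measure, induced from a Haar measure on $\mathrm{SL}_r(\mathbb R)$, and $d\mu=d\mu_1\cdot\frac{dT}{T}$ on $\mathcal M_{\mathbb Q,r}$. Put $h^0(\mathbb Q,\Lambda)=\log\big(\sum_{x\in\Lambda}\exp(-\pi|x|^2)\big)$ and $\deg(\Lambda)=-\log\mathrm{Vol}(\Lambda)$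 (the Arakelov degree). The rank $r$ non-abelian zeta function of $\mathbb Q$ is $$\xi_{\mathbb Q,r}(s)=\int_{\mathcal M_{\mathbb Q,r}}\big(e^{h^0(\mathbb Q,\Lambda)}-1\big)\,(e^{-s})^{\deg(\Lambda)}\,d\mu(\Lambda),\qquad \mathrm{Re}(s)>r.$$ The completed Epstein zeta function of $\Lambda$ is $\hat E(\Lambda;s)=\pi^{-s}\Gamma(s)\sum_{x\in\Lambda\setminus\{0\}}|x|^{-2s}$. *)

theory Defs
  imports "HOL-Analysis.Analysis"
begin

section \<open>Lattices in Euclidean space\<close>

definition zspan :: "'a::euclidean_space set \<Rightarrow> 'a set" where
  "zspan B = {\<Sum>b\<in>B. of_int (c b) *\<^sub>R b | c :: 'a \<Rightarrow> int. True}"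

text \<open>Lattices of arbitrary rank; the rank of \<open>L\<close> is \<open>dim L\<close>.\<close>

definition is_lattice :: "'a::euclidean_space set \<Rightarrow> bool" where
  "is_lattice L \<longleftrightarrow> (\<exists>B. independent B \<and> L = zspan B)"

definition full_lattice :: "'a::euclidean_space set \<Rightarrow> bool" where
  "full_lattice L \<longleftrightarrow> is_lattice L \<and> span L = UNIV"

text \<open>The determinant of the Gram matrix of a finite set of vectors, by the Leibniz formula:
  the index set of the matrix is \<open>B\<close> itself, so that all ranks are treated at once.\<close>

definition gram_det :: "'a::euclidean_space set \<Rightarrow> real" where
  "gram_det B = (\<Sum>p | p permutes B. of_int (sign p) * (\<Prod>b\<in>B. b \<bullet> p b))"

text \<open>The covolume is taken inside \<open>span L\<close>; it does not depend on the chosen \<open>\<int>\<close>-basis.\<close>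

definition covol :: "'a::euclidean_space set \<Rightarrow> real" where
  "covol L = sqrt (gram_det (SOME B. independent B \<and> L = zspan B))"

definition semistable :: "'a::euclidean_space set \<Rightarrow> bool" where
  "semistable L \<longleftrightarrow>
     (\<forall>L1. is_lattice L1 \<and> L1 \<subseteq> L \<and> L1 \<noteq> {0} \<longrightarrow> covol L1 ^ dim L \<ge> covol L ^ dim L1)"

definition h0 :: "'a::euclidean_space set \<Rightarrow> real" where
  "h0 L = ln (\<Sum>\<^sub>\<infinity>x\<in>L. exp (- pi * (norm x)\<^sup>2))"

definition arakelov_deg :: "'a::euclidean_space set \<Rightarrow> real" where
  "arakelov_deg L = - ln (covol L)"

definition epstein_hat :: "'a::euclidean_space set \<Rightarrow> complex \<Rightarrow> complex" where
  "epstein_hat L s =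
     of_real pi powr (- s) * Gamma s * (\<Sum>\<^sub>\<infinity>x\<in>L - {0}. of_real (norm x) powr (- 2 * s))"

section \<open>Moduli spaces of semi-stable lattices\<close>

definition isometry_rel :: "('a::euclidean_space set \<times> 'a set) set" where
  "isometry_rel = {(L, L'). full_lattice L \<and> (\<exists>f. orthogonal_transformation f \<and> L' = f ` L)}"

definition moduli :: "'a::euclidean_space set set set" where
  "moduli = {L. full_lattice L \<and> semistable L} // isometry_rel"

definition moduli_vol :: "real \<Rightarrow> 'a::euclidean_space set set set" where
  "moduli_vol T = {L. full_lattice L \<and> semistable L \<and> covol L = T} // isometry_rel"

text \<open>The functions \<open>h0\<close>, \<open>arakelov_deg\<close> and \<open>epstein_hat\<close> are invariant under isometries and
  are evaluated on an isometry class through a representative.\<close>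

definition rep :: "'a set set \<Rightarrow> 'a set" where
  "rep C = (SOME L. L \<in> C)"

text \<open>\<open>scale_class T\<close> multiplies covolumes by \<open>T\<close>.\<close>

definition scale_class :: "real \<Rightarrow> 'a::euclidean_space set set \<Rightarrow> 'a set set" where
  "scale_class T C = (\<lambda>L. (\<lambda>x. root DIM('a) T *\<^sub>R x) ` L) ` C"

section \<open>Haar measures on the special linear group and the induced measures\<close>

definition SL_real :: "(real^'n^'n) set" where
  "SL_real = {A. det A = 1}"

definition SL_int :: "(real^'n^'n) set" where
  "SL_int = {A \<in> SL_real. \<forall>i j. A $ i $ j \<in> \<int>}"

text \<open>No regularity condition is needed, the group being second countable and locally compact.\<close>

definition haar_measure_SL :: "(real^'n^'n) measure \<Rightarrow> bool" where
  "haar_measure_SL H \<longleftrightarrow>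
     sets H = sets (restrict_space borel SL_real) \<and>
     (\<forall>g\<in>SL_real. \<forall>A\<in>sets H. emeasure H ((\<lambda>h. g ** h) ` A) = emeasure H A) \<and>
     (\<forall>K. compact K \<and> K \<subseteq> SL_real \<longrightarrow> emeasure H K < \<infinity>) \<and>
     emeasure H SL_real \<noteq> 0"

definition fundamental_domain :: "(real^'n^'n) set \<Rightarrow> bool" where
  "fundamental_domain F \<longleftrightarrow>
     F \<in> sets borel \<and> F \<subseteq> SL_real \<and> (\<forall>g\<in>SL_real. \<exists>!\<gamma>. \<gamma> \<in> SL_int \<and> \<gamma> ** g \<in> F)"

text \<open>The lattice spanned by the rows of \<open>g\<close>. It is unchanged under left multiplication of \<open>g\<close> by
  \<open>SL_int\<close>, and right multiplication of \<open>g\<close> by an orthogonal matrix is an isometry; thus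
  \<open>g \<mapsto> row_lattice g\<close> induces a surjection from \<open>SL(r,\<int>)\SL(r,\<real>)/SO(r)\<close> onto the isometry
  classes of lattices of covolume 1 (for even \<open>r\<close> it identifies mirror images).\<close>

definition row_lattice :: "real^'n^'n \<Rightarrow> (real^'n) set" where
  "row_lattice g = {v v* g | v. \<forall>i. v $ i \<in> \<int>}"

text \<open>The image of a measure under a map into \<open>\<Omega>\<close>, where \<open>\<Omega>\<close> carries the quotient
  \<open>\<sigma>\<close>-algebra.\<close>

definition push_measure :: "'a measure \<Rightarrow> 'b set \<Rightarrow> ('a \<Rightarrow> 'b) \<Rightarrow> 'b measure" where
  "push_measure M \<Omega> f = distr M (sigma \<Omega> {A. A \<subseteq> \<Omega> \<and> f -` A \<inter> space M \<in> sets M}) f"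

text \<open>The invariant measure on \<open>SL(r,\<int>)\SL(r,\<real>)\<close> induced from \<open>H\<close> is the restriction of \<open>H\<close>
  to a fundamental domain, whose choice is immaterial since \<open>H\<close> is left invariant.\<close>

definition mu1 :: "(real^'n^'n) measure \<Rightarrow> (real^'n) set set measure" where
  "mu1 H =
     push_measure
       (restrict_space H {g \<in> (SOME F. fundamental_domain F). semistable (row_lattice g)})
       (moduli_vol 1)
       (\<lambda>g. isometry_rel `` {row_lattice g})"

definition mult_haar :: "real measure" where
  "mult_haar = density (restrict_space lborel {0<..}) (\<lambda>T. ennreal (1 / T))"

definition mu :: "(real^'n^'n) measure \<Rightarrow> (real^'n) set set measure" where
  "mu H = push_measure (mu1 H \<Otimes>\<^sub>M mult_haar) moduli (\<lambda>(C, T). scale_class T C)"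

section \<open>The non-abelian zeta function\<close>

text \<open>\<open>(e\<^sup>-\<^sup>s)\<^sup>d\<close> for real \<open>d\<close> means \<open>e\<^sup>-\<^sup>s\<^sup>d\<close>, without passing to a branch of the logarithm.\<close>

definition zeta_integrand :: "complex \<Rightarrow> 'a::euclidean_space set \<Rightarrow> complex" where
  "zeta_integrand s L = of_real (exp (h0 L) - 1) * exp (- s * of_real (arakelov_deg L))"

definition xi_Q :: "(real^'n^'n) measure \<Rightarrow> complex \<Rightarrow> complex" where
  "xi_Q H s = (\<integral>C. zeta_integrand s (rep C) \<partial>mu H)"

end

(* Unfolding a lattice of covolume T as T^(1/n) times a semi-stable lattice of covolume 1 turns the
   zeta integral into an integral over pairs (C, T), and for fixed C the integral over T is the Mellin
   transform of the theta series of C, that is, n/2 times the completed Epstein zeta function.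
   Semi-stability forces all nonzero vectors of a lattice of covolume 1 to have norm at least 1.  Hence
   sphere packing bounds the Epstein zeta functions uniformly, and, by Mahler compactness, the moduli
   space has finite measure; so Fubini's theorem applies.  For compactness, the lattice is shown to
   contain n independent vectors of bounded norm; they form an integer matrix M with M g bounded, and
   modulo SL(n, Z) there are only finitely many integer matrices of bounded nonzero determinant. *)
theory Submission
  imports Defs
begin

section \<open>Gram determinants and covolumes\<close>

text \<open>The factor n/2 is a Jacobian: for u = pi |x|^2 T^(2/n) one has dT/T = (n/2) du/u, while
  exp(-s deg) is T^s on lattices of covolume T. Three choice operators shape the argument: a basis
  in \<open>covol\<close>, a lattice in \<open>rep\<close>, a fundamental domain in
  \<open>mu1\<close>. So Gram determinants must be shown independent of the basis, integrands
  invariant under isometries, and a Borel fundamental domain must be constructed before anything can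
  be said about \<open>mu1\<close>. Measurability is settled on matrices: in the quotient
  sigma-algebra a function on the moduli space is measurable once its pullback is, and joint
  measurability in (C, T) comes from monotonicity of theta series in T. Finite mass is obtained
  without Siegel sets. Short independent vectors may generate only a sublattice of finite index, so
  the integer matrix M need not be unimodular; its bounded determinant bounds that index, and
  finitely many classes of M modulo SL(n, Z) absorb it.\<close>

lemma leibniz_reindex:
  fixes \<beta> :: "'i \<Rightarrow> 'b" and F :: "'b \<Rightarrow> 'b \<Rightarrow> real"
  assumes "finite I" and \<beta>: "bij_betw \<beta> I B"
  shows "(\<Sum>p | p permutes B. of_int (sign p) * (\<Prod>b\<in>B. F b (p b)))
    = (\<Sum>p | p permutes I. of_int (sign p) * (\<Prod>i\<in>I. F (\<beta> i) (\<beta> (p i))))"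
proof -
  have inj: "inj_on \<beta> I" and im: "\<beta> ` I = B"
    using \<beta> by (auto simp: bij_betw_def)
  have "bij_betw (map_permutation I \<beta>) {p. p permutes I} {p. p permutes B}"
  proof (subst bij_betw_cong)
    show "bij_betw (\<lambda>\<pi> x. if x \<in> B then \<beta> (\<pi> (inv_into I \<beta> x)) else x)
             {\<pi>. \<pi> permutes I} {\<pi>. \<pi> permutes B}"
      by (rule bij_betw_permutations[OF \<beta>])
  qed (auto simp: map_permutation_def restrict_id_def im fun_eq_iff)
  then have "(\<Sum>p | p permutes B. of_int (sign p) * (\<Prod>b\<in>B. F b (p b))) = (\<Sum>p | p permutes I.
      of_int (sign (map_permutation I \<beta> p)) * (\<Prod>b\<in>B. F b (map_permutation I \<beta> p b)))"
    by (rule sum.reindex_bij_betw[symmetric])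
  also have "\<dots> = (\<Sum>p | p permutes I. of_int (sign p) * (\<Prod>i\<in>I. F (\<beta> i) (\<beta> (p i))))"
  proof (rule sum.cong[OF refl])
    fix p assume "p \<in> {p. p permutes I}"
    then have p: "p permutes I" by simp
    have "(\<Prod>b\<in>B. F b (map_permutation I \<beta> p b)) = (\<Prod>i\<in>I. F (\<beta> i) (map_permutation I \<beta> p (\<beta> i)))"
      by (rule prod.reindex_bij_betw[OF \<beta>, symmetric])
    also have "\<dots> = (\<Prod>i\<in>I. F (\<beta> i) (\<beta> (p i)))"
      by (rule prod.cong) (auto simp: map_permutation_def restrict_id_def inv_into_f_f[OF inj])
    finally show "of_int (sign (map_permutation I \<beta> p)) * (\<Prod>b\<in>B. F b (map_permutation I \<beta> p b))
        = real_of_int (sign p) * (\<Prod>i\<in>I. F (\<beta> i) (\<beta> (p i)))"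
      using sign_map_permutation[OF inj p \<open>finite I\<close>] by simp
  qed
  finally show ?thesis .
qed

lemma gram_det_reindex:
  fixes \<beta> :: "'i \<Rightarrow> 'a::euclidean_space"
  assumes "finite I" "bij_betw \<beta> I B"
  shows "gram_det B = (\<Sum>p | p permutes I. of_int (sign p) * (\<Prod>i\<in>I. \<beta> i \<bullet> \<beta> (p i)))"
  unfolding gram_det_def by (rule leibniz_reindex[OF assms])

lemma gram_det_similarity:
  fixes f :: "'a::euclidean_space \<Rightarrow> 'a"
  assumes "finite B" "inj_on f B"
    and f: "\<And>x y. x \<in> B \<Longrightarrow> y \<in> B \<Longrightarrow> f x \<bullet> f y = t * (x \<bullet> y)"
  shows "gram_det (f ` B) = t ^ card B * gram_det B"
proof -
  have "gram_det (f ` B) = (\<Sum>p | p permutes B. of_int (sign p) * (\<Prod>i\<in>B. f i \<bullet> f (p i)))"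
    by (rule gram_det_reindex) (use assms in \<open>auto simp: bij_betw_def\<close>)
  also have "\<dots> = (\<Sum>p | p permutes B. t ^ card B * (of_int (sign p) * (\<Prod>i\<in>B. i \<bullet> p i)))"
  proof (rule sum.cong[OF refl])
    fix p assume "p \<in> {p. p permutes B}"
    then have "\<And>i. i \<in> B \<Longrightarrow> p i \<in> B" by (auto simp: permutes_in_image)
    then have "(\<Prod>i\<in>B. f i \<bullet> f (p i)) = (\<Prod>i\<in>B. t * (i \<bullet> p i))"
      by (intro prod.cong) (auto simp: f)
    then show "of_int (sign p) * (\<Prod>i\<in>B. f i \<bullet> f (p i))
        = t ^ card B * (of_int (sign p) * (\<Prod>i\<in>B. i \<bullet> p i))"
      by (simp add: prod.distrib)
  qed
  also have "\<dots> = t ^ card B * gram_det B"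
    by (simp add: gram_det_def sum_distrib_left)
  finally show ?thesis .
qed

text \<open>A permutation that moves some e in \<open>E\<close> contributes the factor
  \<open>e \<bullet> p e\<close> = 0, so only permutations of \<open>B\<close> survive: the Gram
  matrix is block diagonal with an identity block.\<close>

lemma gram_det_Un_orthonormal:
  fixes B E :: "'a::euclidean_space set"
  assumes fin: "finite B" "finite E" and "B \<inter> E = {}"
    and orth: "\<And>e x. e \<in> E \<Longrightarrow> x \<in> B \<union> E \<Longrightarrow> x \<noteq> e \<Longrightarrow> e \<bullet> x = 0"
    and unit: "\<And>e. e \<in> E \<Longrightarrow> e \<bullet> e = 1"
  shows "gram_det (B \<union> E) = gram_det B"
proof -
  let ?f = "\<lambda>C p. of_int (sign p) * (\<Prod>b\<in>C. b \<bullet> p b) :: real"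
  have "gram_det (B \<union> E) = (\<Sum>p | p permutes B. ?f (B \<union> E) p)"
    unfolding gram_det_def
  proof (rule sum.mono_neutral_right)
    show "finite {p. p permutes B \<union> E}" using fin by (simp add: finite_permutations)
    show "{p. p permutes B} \<subseteq> {p. p permutes B \<union> E}"
      by (auto intro: permutes_subset)
    show "\<forall>p\<in>{p. p permutes B \<union> E} - {p. p permutes B}. ?f (B \<union> E) p = 0"
    proof
      fix p assume p: "p \<in> {p. p permutes B \<union> E} - {p. p permutes B}"
      have "\<exists>e\<in>E. p e \<noteq> e"
      proof (rule ccontr)
        assume "\<not> ?thesis"
        then have "p permutes B"
          using p permutes_superset[of p "B \<union> E" B] by auto
        then show False using p by simp
      qed
      then obtain e where e: "e \<in> E" "p e \<noteq> e" by blast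
      have "p e \<in> B \<union> E"
        by (subst permutes_in_image) (use p e in auto)
      then have "e \<bullet> p e = 0" using orth e by blast
      then have "(\<Prod>b\<in>B\<union>E. b \<bullet> p b) = 0"
        using e fin by (intro prod_zero) auto
      then show "?f (B \<union> E) p = 0" by simp
    qed
  qed
  also have "\<dots> = (\<Sum>p | p permutes B. ?f B p)"
  proof (rule sum.cong[OF refl])
    fix p assume "p \<in> {p. p permutes B}"
    then have "\<And>e. e \<in> E \<Longrightarrow> p e = e"
      using \<open>B \<inter> E = {}\<close> by (auto intro: permutes_not_in)
    then have "(\<Prod>e\<in>E. e \<bullet> p e) = 1" by (simp add: unit)
    then show "?f (B \<union> E) p = ?f B p"
      using assms by (simp add: prod.union_disjoint)
  qed
  finally show ?thesis by (simp add: gram_det_def)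
qed

lemma zspan_Un:
  fixes B E :: "'a::euclidean_space set"
  assumes "finite B" "finite E" "B \<inter> E = {}"
  shows "zspan (B \<union> E) = {x + y | x y. x \<in> zspan B \<and> y \<in> zspan E}"
proof (intro equalityI subsetI)
  fix z assume "z \<in> zspan (B \<union> E)"
  then obtain c where "z = (\<Sum>b\<in>B\<union>E. of_int (c b) *\<^sub>R b)" by (auto simp: zspan_def)
  then have "z = (\<Sum>b\<in>B. of_int (c b) *\<^sub>R b) + (\<Sum>b\<in>E. of_int (c b) *\<^sub>R b)"
    using assms by (simp add: sum.union_disjoint)
  then show "z \<in> {x + y | x y. x \<in> zspan B \<and> y \<in> zspan E}" by (auto simp: zspan_def)
next
  fix z assume "z \<in> {x + y | x y. x \<in> zspan B \<and> y \<in> zspan E}"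
  then obtain c d where "z = (\<Sum>b\<in>B. of_int (c b) *\<^sub>R b) + (\<Sum>b\<in>E. of_int (d b) *\<^sub>R b)"
    by (auto simp: zspan_def)
  also have "\<dots> = (\<Sum>b\<in>B. of_int (if b \<in> B then c b else d b) *\<^sub>R b)
      + (\<Sum>b\<in>E. of_int (if b \<in> B then c b else d b) *\<^sub>R b)"
    using assms by (intro arg_cong2[of _ _ _ _ "(+)"] sum.cong) auto
  also have "\<dots> = (\<Sum>b\<in>B\<union>E. of_int (if b \<in> B then c b else d b) *\<^sub>R b)"
    using assms by (simp add: sum.union_disjoint)
  finally show "z \<in> zspan (B \<union> E)" unfolding zspan_def by (intro CollectI exI[of _ "\<lambda>b. if b \<in> B then c b else d b"] conjI TrueI)
qed

lemma zspan_superset: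
  fixes B :: "'a::euclidean_space set"
  assumes "finite B"
  shows "B \<subseteq> zspan B"
proof
  fix b assume b: "b \<in> B"
  have "b = (\<Sum>x\<in>B. of_int (if x = b then 1 else 0) *\<^sub>R x)"
    using b assms by (simp add: if_distrib[of "\<lambda>u. of_int u *\<^sub>R _"] sum.delta cong: if_cong)
  then show "b \<in> zspan B" unfolding zspan_def
    by (intro CollectI exI[of _ "\<lambda>x. if x = b then 1 else 0"] conjI TrueI)
qed

lemma span_zspan:
  fixes B :: "'a::euclidean_space set"
  assumes "finite B"
  shows "span (zspan B) = span B"
proof (rule span_eq[THEN iffD2], intro conjI)
  show "zspan B \<subseteq> span B"
    by (auto simp: zspan_def intro!: span_sum span_scale intro: span_base)
  show "B \<subseteq> span (zspan B)"
    using zspan_superset[OF assms] span_superset by blast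
qed

lemma zspan_eq_row_lattice:
  fixes \<beta> :: "'n::finite \<Rightarrow> real^'n"
  assumes \<beta>: "bij_betw \<beta> UNIV B"
  shows "zspan B = row_lattice (\<chi> i. \<beta> i)"
proof -
  have *: "v v* (\<chi> i. \<beta> i) = (\<Sum>i\<in>UNIV. v $ i *\<^sub>R \<beta> i)" for v
    by (simp add: vec_eq_iff vector_matrix_mult_def mult.commute)
  have inj: "inj \<beta>" and im: "range \<beta> = B" using \<beta> by (auto simp: bij_betw_def)
  show ?thesis
  proof (intro equalityI subsetI)
    fix x assume "x \<in> zspan B"
    then obtain c where "x = (\<Sum>b\<in>B. of_int (c b) *\<^sub>R b)" by (auto simp: zspan_def)
    also have "\<dots> = (\<Sum>i\<in>UNIV. of_int (c (\<beta> i)) *\<^sub>R \<beta> i)"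
      by (rule sum.reindex_bij_betw[OF \<beta>, symmetric])
    also have "\<dots> = (\<chi> i. of_int (c (\<beta> i))) v* (\<chi> i. \<beta> i)" by (simp add: *)
    finally show "x \<in> row_lattice (\<chi> i. \<beta> i)"
      unfolding row_lattice_def by (auto intro!: exI[of _ "\<chi> i. of_int (c (\<beta> i))"])
  next
    fix x assume "x \<in> row_lattice (\<chi> i. \<beta> i)"
    then obtain v where v: "x = (\<Sum>i\<in>UNIV. v $ i *\<^sub>R \<beta> i)" "\<And>i. v $ i \<in> \<int>"
      by (auto simp: row_lattice_def *)
    then have "x = (\<Sum>i\<in>UNIV. of_int \<lfloor>v $ inv \<beta> (\<beta> i)\<rfloor> *\<^sub>R \<beta> i)"
      by (simp add: inv_f_f[OF inj])
    also have "\<dots> = (\<Sum>b\<in>B. of_int \<lfloor>v $ inv \<beta> b\<rfloor> *\<^sub>R b)"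
      by (rule sum.reindex_bij_betw[OF \<beta>])
    finally show "x \<in> zspan B"
      unfolding zspan_def by (intro CollectI exI[of _ "\<lambda>b. \<lfloor>v $ inv \<beta> b\<rfloor>"] conjI TrueI)
  qed
qed

text \<open>With the vectors as rows of A, their Gram matrix is
  \<open>A ** transpose A\<close>.\<close>

lemma gram_det_eq_det:
  fixes \<beta> :: "'n::finite \<Rightarrow> real^'n"
  assumes \<beta>: "bij_betw \<beta> UNIV B"
  shows "gram_det B = (det (\<chi> i. \<beta> i))\<^sup>2"
proof -
  let ?A = "(\<chi> i. \<beta> i) :: real^'n^'n"
  have "gram_det B = (\<Sum>p | p permutes UNIV. of_int (sign p) * (\<Prod>i\<in>UNIV. \<beta> i \<bullet> \<beta> (p i)))"
    by (rule gram_det_reindex[OF _ \<beta>]) simp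
  also have "\<dots> = det (?A ** transpose ?A)"
    by (simp add: det_def matrix_matrix_mult_def transpose_def inner_vec_def)
  also have "\<dots> = (det ?A)\<^sup>2" by (simp add: det_mul power2_eq_square)
  finally show ?thesis .
qed

section \<open>Integral transition matrices between row lattices\<close>

lemma det_in_Ints:
  fixes A :: "real^'n^'n"
  assumes "\<And>i j. A $ i $ j \<in> \<int>"
  shows "det A \<in> \<int>"
  unfolding det_def by (rule Ints_sum, rule Ints_mult[OF Ints_of_int Ints_prod[OF assms]])

lemma row_lattice_rows:
  fixes A :: "real^'n^'n"
  shows "A $ i \<in> row_lattice A"
proof -
  have "A $ i = axis i 1 v* A"
    by (simp add: vec_eq_iff vector_matrix_mult_def axis_def if_distrib[of "\<lambda>u. u * _"] cong: if_cong)
  moreover have "\<forall>j. (axis i 1 :: real^'n) $ j \<in> \<int>" by (simp add: axis_def)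
  ultimately show ?thesis unfolding row_lattice_def by blast
qed

lemma rows_in_row_latticeE:
  fixes A A' :: "real^'n^'n"
  assumes "\<And>i. A $ i \<in> row_lattice A'"
  obtains C :: "real^'n^'n" where "A = C ** A'" "\<And>i j. C $ i $ j \<in> \<int>"
proof -
  have "\<forall>i. \<exists>v. A $ i = v v* A' \<and> (\<forall>j. v $ j \<in> \<int>)"
    using assms by (auto simp: row_lattice_def)
  then obtain v where v: "\<And>i. A $ i = v i v* A'" "\<And>i j. v i $ j \<in> \<int>" by metis
  have "A = (\<chi> i. v i) ** A'"
    by (simp add: vec_eq_iff v(1) matrix_matrix_mult_def vector_matrix_mult_def mult.commute)
  with v(2) show thesis by (intro that) auto
qed

text \<open>Each matrix is an integral multiple of the other, and the two transition determinants
  are integers with product 1, hence units.\<close>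

lemma row_lattice_eq_imp_abs_det_eq:
  fixes A A' :: "real^'n^'n"
  assumes eq: "row_lattice A = row_lattice A'" and "det A \<noteq> 0"
  shows "\<bar>det A\<bar> = \<bar>det A'\<bar>"
proof -
  obtain C where C: "A = C ** A'" "\<And>i j. C $ i $ j \<in> \<int>"
    by (rule rows_in_row_latticeE[of A A']) (use eq row_lattice_rows in auto)
  obtain C' where C': "A' = C' ** A" "\<And>i j. C' $ i $ j \<in> \<int>"
    by (rule rows_in_row_latticeE[of A' A]) (use eq row_lattice_rows in auto)
  have "det A = det C * det A'" "det A' = det C' * det A"
    using C(1) C'(1) det_mul by metis+
  then have 1: "det C * det C' = 1" using \<open>det A \<noteq> 0\<close> by simp
  obtain m m' where m: "det C = of_int m" "det C' = of_int m'"
    using det_in_Ints C(2) C'(2) by (metis Ints_cases)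
  have "m * m' = 1" using 1 m by (metis of_int_eq_1_iff of_int_mult)
  then have "\<bar>m\<bar> = 1" using abs_zmult_eq_1[of m m'] by simp
  then have "\<bar>det C\<bar> = 1" using m by (metis of_int_1 of_int_abs)
  with \<open>det A = det C * det A'\<close> show ?thesis by (simp add: abs_mult)
qed

lemma basis_det_nonzero:
  fixes \<beta> :: "'n::finite \<Rightarrow> real^'n"
  assumes \<beta>: "bij_betw \<beta> UNIV B" and "independent B"
  shows "det (\<chi> i. \<beta> i) \<noteq> 0"
proof -
  have "rows (\<chi> i. \<beta> i) = B" using \<beta> by (auto simp: rows_def row_def bij_betw_def vec_eq_iff vec_lambda_eta)
  moreover have "card B = CARD('n)" using bij_betw_same_card[OF \<beta>] by simp
  ultimately have "span (rows (\<chi> i. \<beta> i)) = UNIV"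
    using \<open>independent B\<close> card_ge_dim_independent[of B UNIV] by auto
  then have "\<exists>C. C ** (\<chi> i. \<beta> i) = mat 1"
    by (simp add: matrix_left_invertible_span_rows)
  then show ?thesis by (metis invertible_left_inverse invertible_det_nz)
qed


section \<open>Reduction of lower rank to full rank\<close>

lemma orthonormal_complement:
  fixes V :: "'a::euclidean_space set"
  assumes "subspace V"
  obtains E where "finite E" "card E + dim V = DIM('a)"
    "\<And>e. e \<in> E \<Longrightarrow> e \<bullet> e = 1" "\<And>e e'. e \<in> E \<Longrightarrow> e' \<in> E \<Longrightarrow> e' \<noteq> e \<Longrightarrow> e \<bullet> e' = 0"
    "\<And>e v. e \<in> E \<Longrightarrow> v \<in> V \<Longrightarrow> e \<bullet> v = 0" "span (V \<union> E) = UNIV"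
proof -
  define W where "W = {y. \<forall>x\<in>V. orthogonal x y}"
  have "subspace W"
    unfolding W_def subspace_def by (auto simp: orthogonal_clauses)
  then obtain E where E: "E \<subseteq> W" "pairwise orthogonal E" "\<And>x. x \<in> E \<Longrightarrow> norm x = 1"
      "independent E" "card E = dim W" "span E = W"
    by (metis orthonormal_basis_subspace)
  have "x \<in> span (V \<union> E)" for x
  proof -
    obtain y z where yz: "y \<in> span V" "\<And>w. w \<in> span V \<Longrightarrow> orthogonal z w" "x = y + z"
      using orthogonal_subspace_decomp_exists[of V x] by blast
    have "z \<in> span E" using yz(2) E(6) by (auto simp: W_def orthogonal_commute span_base)
    then show ?thesis using yz(1,3) span_mono[of V "V \<union> E"] span_mono[of E "V \<union> E"]
      by (auto intro!: span_add)
  qed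
  moreover have "dim W + dim V = DIM('a)"
    using dim_subspace_orthogonal_to_vectors[OF \<open>subspace V\<close> subspace_UNIV] by (simp add: W_def)
  moreover have "e \<bullet> v = 0" if "e \<in> E" "v \<in> V" for e v
    using that E(1) by (auto simp: W_def orthogonal_def inner_commute)
  moreover have "e \<bullet> e' = 0" if "e \<in> E" "e' \<in> E" "e' \<noteq> e" for e e'
    using that E(2) by (auto simp: pairwise_def orthogonal_def)
  moreover have "e \<bullet> e = 1" if "e \<in> E" for e
    using E(3)[OF that] by (simp add: norm_eq_1)
  ultimately show thesis using E(4,5) by (intro that[of E]) (auto simp: independent_imp_finite)
qed

text \<open>A lattice of lower rank has no square basis matrix, so its basis is padded to one of the
  whole space, which changes neither the Gram determinant nor, up to a fixed summand, the lattice.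
  \<open>E\<close> is a parameter so that two bases with the same span can receive the same
  padding.\<close>

lemma orthonormal_padding:
  fixes B :: "(real^'n) set"
  assumes "independent B" "subspace V" "V = span B"
    and E: "finite E" "card E + dim V = CARD('n)"
    "\<And>e. e \<in> E \<Longrightarrow> e \<bullet> e = 1" "\<And>e e'. e \<in> E \<Longrightarrow> e' \<in> E \<Longrightarrow> e' \<noteq> e \<Longrightarrow> e \<bullet> e' = 0"
    "\<And>e v. e \<in> E \<Longrightarrow> v \<in> V \<Longrightarrow> e \<bullet> v = 0" "span (V \<union> E) = UNIV"
  obtains \<beta> :: "'n \<Rightarrow> real^'n" where "bij_betw \<beta> UNIV (B \<union> E)" "independent (B \<union> E)"
    "gram_det B = gram_det (B \<union> E)" "zspan (B \<union> E) = {x + y | x y. x \<in> zspan B \<and> y \<in> zspan E}"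
proof -
  have finB: "finite B" using assms(1) by (rule independent_imp_finite)
  have BV: "B \<subseteq> V" using assms(3) by (simp add: span_superset)
  have disj: "B \<inter> E = {}"
  proof -
    have "e \<notin> E" if "e \<in> B" for e
      using E(3)[of e] E(5)[of e e] BV that by auto
    then show ?thesis by blast
  qed
  have card: "card (B \<union> E) = CARD('n)"
    using card_Un_disjoint[OF finB E(1) disj] E(2) assms(1,3)
    by (simp add: dim_span dim_eq_card_independent)
  have "V \<union> E \<subseteq> span (B \<union> E)"
    using assms(3) span_mono[of B "B \<union> E"] span_superset[of "B \<union> E"] by blast
  then have "span (V \<union> E) \<subseteq> span (B \<union> E)" by (rule span_minimal) simp
  then have "UNIV \<subseteq> span (B \<union> E)" using E(6) by simp
  then have ind: "independent (B \<union> E)"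
    by (intro card_le_dim_spanning[of _ UNIV]) (use finB E(1) card in auto)
  have gram: "gram_det B = gram_det (B \<union> E)"
    by (rule gram_det_Un_orthonormal[symmetric]) (use finB E(1,3,4,5) BV disj in blast)+
  obtain \<beta> :: "'n \<Rightarrow> real^'n" where "bij_betw \<beta> UNIV (B \<union> E)"
    using finite_same_card_bij[of "UNIV :: 'n set" "B \<union> E"] finB E(1) card by auto
  then show thesis
    using that[OF _ ind gram zspan_Un[OF finB E(1) disj]] by blast
qed

text \<open>Both bases are completed by the same orthonormal basis of the orthogonal complement, which
  reduces the claim to bases of the whole space.\<close>

lemma gram_det_zspan_cong:
  fixes B B' :: "(real^'n) set"
  assumes ind: "independent B" "independent B'" and eq: "zspan B = zspan B'"
  shows "gram_det B = gram_det B'"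
proof -
  have span: "span B = span B'"
    using span_zspan[of B] span_zspan[of B'] eq ind by (simp add: independent_imp_finite)
  obtain E where E: "finite E" "card E + dim (span B) = CARD('n)"
    "\<And>e. e \<in> E \<Longrightarrow> e \<bullet> e = 1" "\<And>e e'. e \<in> E \<Longrightarrow> e' \<in> E \<Longrightarrow> e' \<noteq> e \<Longrightarrow> e \<bullet> e' = 0"
    "\<And>e v. e \<in> E \<Longrightarrow> v \<in> span B \<Longrightarrow> e \<bullet> v = 0" "span (span B \<union> E) = (UNIV :: (real^'n) set)"
    using orthonormal_complement[of "span B"] by auto
  obtain \<beta> :: "'n \<Rightarrow> real^'n" where \<beta>: "bij_betw \<beta> UNIV (B \<union> E)" "independent (B \<union> E)"
    "gram_det B = gram_det (B \<union> E)" "zspan (B \<union> E) = {x + y | x y. x \<in> zspan B \<and> y \<in> zspan E}"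
    by (rule orthonormal_padding[OF ind(1) subspace_span refl E]) auto
  obtain \<beta>' :: "'n \<Rightarrow> real^'n" where \<beta>': "bij_betw \<beta>' UNIV (B' \<union> E)" "independent (B' \<union> E)"
    "gram_det B' = gram_det (B' \<union> E)" "zspan (B' \<union> E) = {x + y | x y. x \<in> zspan B' \<and> y \<in> zspan E}"
    by (rule orthonormal_padding[OF ind(2) subspace_span span E]) auto
  have "row_lattice (\<chi> i. \<beta> i) = row_lattice (\<chi> i. \<beta>' i)"
    using \<beta>(4) \<beta>'(4) eq zspan_eq_row_lattice[OF \<beta>(1)] zspan_eq_row_lattice[OF \<beta>'(1)] by simp
  then have "\<bar>det (\<chi> i. \<beta> i)\<bar> = \<bar>det (\<chi> i. \<beta>' i)\<bar>"
    using basis_det_nonzero[OF \<beta>(1,2)] by (rule row_lattice_eq_imp_abs_det_eq)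
  then show ?thesis
    using gram_det_eq_det[OF \<beta>(1)] gram_det_eq_det[OF \<beta>'(1)] \<beta>(3) \<beta>'(3)
    by (metis power2_abs)
qed

text \<open>Removes the choice operator from \<open>covol\<close>: the chosen basis generates the
  same lattice as \<open>B\<close>, so the Gram determinants agree.\<close>

lemma covol_zspan:
  fixes B :: "(real^'n) set"
  assumes "independent B"
  shows "covol (zspan B) = sqrt (gram_det B)"
proof -
  define B' where "B' = (SOME B'. independent B' \<and> zspan B = zspan B')"
  have "independent B' \<and> zspan B = zspan B'"
    unfolding B'_def by (rule someI[of _ B]) (simp add: assms)
  then have "gram_det B' = gram_det B"
    using gram_det_zspan_cong[OF assms, of B'] by simp
  then show ?thesis
    by (simp add: covol_def B'_def)
qed

lemma dim_zspan: "independent B \<Longrightarrow> dim (zspan B) = card (B :: (real^'n) set)"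
  by (metis dim_eq_card_independent dim_span independent_imp_finite span_zspan)

section \<open>Similarities\<close>

text \<open>One notion for the two kinds of maps acting on lattices here: isometries (t = 1) and the
  homotheties of \<open>scale_class\<close>. The condition is put on inner products because Gram
  determinants are built from them.\<close>

definition similarity :: "real \<Rightarrow> ('a::euclidean_space \<Rightarrow> 'a) \<Rightarrow> bool" where
  "similarity t f \<longleftrightarrow> t > 0 \<and> linear f \<and> (\<forall>x y. f x \<bullet> f y = t\<^sup>2 * (x \<bullet> y))"

lemma similarity_norm: "similarity t f \<Longrightarrow> norm (f x) = t * norm x"
  by (simp add: similarity_def norm_eq_sqrt_inner real_sqrt_mult)

lemma similarity_scaleR: "t > 0 \<Longrightarrow> similarity t ((*\<^sub>R) t)"
  by (auto simp: similarity_def power2_eq_square linear_iff algebra_simps)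

lemma similarity_orthogonal: "orthogonal_transformation f \<Longrightarrow> similarity 1 f"
  by (simp add: similarity_def orthogonal_transformation_def)

lemma similarity_bij:
  assumes "similarity t f"
  shows "bij f"
proof -
  have "inj f"
  proof (rule injI)
    fix x y assume "f x = f y"
    then have "f (x - y) = 0" using assms by (simp add: similarity_def linear_diff)
    then show "x = y" using similarity_norm[OF assms, of "x - y"] assms by (simp add: similarity_def)
  qed
  then show ?thesis
    using assms by (simp add: similarity_def linear_injective_imp_surjective bij_def)
qed

lemma similarity_inv:
  assumes "similarity t f"
  shows "similarity (1 / t) (inv f)"
proof -
  have f: "t > 0" "linear f" "\<And>x y. f x \<bullet> f y = t\<^sup>2 * (x \<bullet> y)"
    using assms by (auto simp: similarity_def)
  have "linear (inv f)"
    using similarity_bij[OF assms] f(2) by (simp add: bij_def inj_linear_imp_inv_linear)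
  moreover have "inv f x \<bullet> inv f y = (1 / t)\<^sup>2 * (x \<bullet> y)" for x y
  proof -
    have "x = f (inv f x)" "y = f (inv f y)"
      using similarity_bij[OF assms] by (simp_all add: bij_is_surj surj_f_inv_f)
    then have "x \<bullet> y = t\<^sup>2 * (inv f x \<bullet> inv f y)"
      using f(3)[of "inv f x" "inv f y"] by simp
    then show ?thesis using f(1) by (simp add: field_simps power2_eq_square)
  qed
  ultimately show ?thesis using f(1) by (simp add: similarity_def)
qed

lemma zspan_linear_image:
  fixes f :: "'a::euclidean_space \<Rightarrow> 'a"
  assumes "linear f" "inj f"
  shows "zspan (f ` B) = f ` zspan B"
proof -
  have eq: "(\<Sum>b\<in>f ` B. of_int (c b) *\<^sub>R b) = f (\<Sum>b\<in>B. of_int (c (f b)) *\<^sub>R b)" for c :: "'a \<Rightarrow> int"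
    using assms by (simp add: sum.reindex[OF inj_on_subset[OF assms(2)]] linear_sum linear_scale)
  show ?thesis
  proof (intro equalityI subsetI)
    fix x assume "x \<in> zspan (f ` B)"
    then obtain c where "x = (\<Sum>b\<in>f ` B. of_int (c b) *\<^sub>R b)" by (auto simp: zspan_def)
    then have "x = f (\<Sum>b\<in>B. of_int (c (f b)) *\<^sub>R b)" using eq[of c] by simp
    then show "x \<in> f ` zspan B"
      by (auto simp: zspan_def intro!: image_eqI exI[of _ "\<lambda>b. c (f b)"])
  next
    fix x assume "x \<in> f ` zspan B"
    then obtain c where x: "x = f (\<Sum>b\<in>B. of_int (c b) *\<^sub>R b)" by (auto simp: zspan_def)
    have "x = (\<Sum>b\<in>f ` B. of_int (c (inv f b)) *\<^sub>R b)"
      using eq[of "\<lambda>b. c (inv f b)"] x by (simp add: inv_f_f[OF assms(2)])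
    then show "x \<in> zspan (f ` B)"
      by (auto simp: zspan_def intro!: exI[of _ "\<lambda>b. c (inv f b)"])
  qed
qed

text \<open>Every Gram entry is multiplied by t^2, hence the Gram determinant by t^(2 rank) and its
  square root by t^rank.\<close>

lemma lattice_similarity:
  fixes L :: "(real^'n) set"
  assumes L: "is_lattice L" and f: "similarity t f"
  shows "is_lattice (f ` L)" "dim (f ` L) = dim L" "covol (f ` L) = t ^ dim L * covol L"
proof -
  have lin: "linear f" and inj: "inj f" and t: "t > 0"
    using f similarity_bij[OF f] by (auto simp: similarity_def bij_def)
  obtain B where B: "independent B" "L = zspan B" using L by (auto simp: is_lattice_def)
  have fB: "independent (f ` B)" "f ` L = zspan (f ` B)"
    using B lin inj linear_independent_injective_image[OF lin B(1)]
    by (auto simp: zspan_linear_image inj_on_subset)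
  then show "is_lattice (f ` L)" by (auto simp: is_lattice_def)
  have card: "card (f ` B) = card B" using inj by (simp add: card_image inj_on_subset)
  then show "dim (f ` L) = dim L" using B fB by (simp add: dim_zspan)
  have "gram_det (f ` B) = (t\<^sup>2) ^ card B * gram_det B"
    using f B(1) inj
    by (intro gram_det_similarity)
      (auto simp: independent_imp_finite similarity_def intro: inj_on_subset)
  moreover have "(t\<^sup>2) ^ card B = (t ^ card B)\<^sup>2" by (simp add: power_mult[symmetric] mult.commute)
  ultimately show "covol (f ` L) = t ^ dim L * covol L"
    using B fB t by (simp add: covol_zspan dim_zspan real_sqrt_mult)
qed

lemma full_lattice_similarity:
  fixes L :: "(real^'n) set"
  assumes L: "full_lattice L" and f: "similarity t f"
  shows "full_lattice (f ` L)" "covol (f ` L) = t ^ CARD('n) * covol L"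
proof -
  have lat: "is_lattice L" and sp: "span L = UNIV" using L by (auto simp: full_lattice_def)
  have dim: "dim L = CARD('n)" using sp dim_eq_full[of L] by simp
  have "span (f ` L) = UNIV"
    using f similarity_bij[OF f] sp linear_span_image[of f L] by (simp add: bij_def similarity_def)
  then show "full_lattice (f ` L)" using lattice_similarity(1)[OF lat f] by (simp add: full_lattice_def)
  show "covol (f ` L) = t ^ CARD('n) * covol L"
    using lattice_similarity(3)[OF lat f] dim by simp
qed

text \<open>Sublattices of the image pull back along the inverse similarity, and both sides of the
  defining inequality scale by the same power \<open>t ^ (dim L * dim M')\<close>.\<close>

lemma semistable_similarity:
  fixes L :: "(real^'n) set"
  assumes L: "is_lattice L" "semistable L" and f: "similarity t f"
  shows "semistable (f ` L)"
  unfolding semistable_def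
proof (intro allI impI, elim conjE)
  fix M assume M: "is_lattice M" "M \<subseteq> f ` L" "M \<noteq> {0}"
  have t: "t > 0" and lin: "linear f" and bij: "bij f"
    using f similarity_bij[OF f] by (auto simp: similarity_def)
  define M' where "M' = inv f ` M"
  have fM': "M = f ` M'" using bij by (simp add: M'_def image_image bij_is_surj surj_f_inv_f)
  have M': "is_lattice M'" unfolding M'_def by (rule lattice_similarity[OF M(1) similarity_inv[OF f]])
  have "M' \<subseteq> L" using M(2) fM' bij by (metis bij_def inj_image_subset_iff)
  moreover have "M' \<noteq> {0}" using M(3) fM' lin by (auto simp: linear_0)
  ultimately have "covol M' ^ dim L \<ge> covol L ^ dim M'"
    using L(2) M' by (auto simp: semistable_def)
  then have "(t ^ (dim L * dim M')) * covol L ^ dim M' \<le> (t ^ (dim L * dim M')) * covol M' ^ dim L"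
    using t by (intro mult_left_mono) auto
  then show "covol (f ` L) ^ dim M \<le> covol M ^ dim (f ` L)"
    unfolding fM' lattice_similarity[OF M' f] lattice_similarity[OF L(1) f]
    by (simp add: power_mult_distrib power_mult[symmetric] mult.commute)
qed

text \<open>Semi-stability is applied to the rank one sublattice generated by x, whose covolume is
  \<open>norm x\<close>; it gives 1 \<le> |x|^n.\<close>

lemma semistable_min_norm:
  fixes L :: "(real^'n) set"
  assumes L: "full_lattice L" "semistable L" "covol L = 1" and x: "x \<in> L" "x \<noteq> 0"
  shows "norm x \<ge> 1"
proof -
  have lat: "is_lattice L" and sp: "span L = UNIV" using L by (auto simp: full_lattice_def)
  have dim: "dim L = CARD('n)" using sp dim_eq_full[of L] by simp
  have ind: "independent {x}" using x(2) by simp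
  obtain B where B: "independent B" "L = zspan B" using lat by (auto simp: is_lattice_def)
  obtain c where c: "x = (\<Sum>b\<in>B. of_int (c b) *\<^sub>R b)" using x(1) B by (auto simp: zspan_def)
  have "zspan {x} \<subseteq> L"
  proof
    fix y assume "y \<in> zspan {x}"
    then obtain m :: int where "y = of_int m *\<^sub>R x" by (auto simp: zspan_def)
    then have "y = (\<Sum>b\<in>B. of_int (m * c b) *\<^sub>R b)" by (simp add: c scaleR_sum_right)
    then show "y \<in> L" unfolding B(2) zspan_def by (intro CollectI exI conjI TrueI)
  qed
  moreover have "zspan {x} \<noteq> {0}" using zspan_superset[of "{x}"] x(2) by auto
  moreover have "is_lattice (zspan {x})" using ind unfolding is_lattice_def by blast
  ultimately have "covol L ^ dim (zspan {x}) \<le> covol (zspan {x}) ^ dim L"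
    using L(2) by (auto simp: semistable_def)
  then have "1 \<le> covol (zspan {x}) ^ CARD('n)" using L(3) dim by simp
  moreover have "covol (zspan {x}) = norm x"
    using covol_zspan[OF ind] by (simp add: gram_det_def norm_eq_sqrt_inner)
  ultimately have "1 \<le> norm x ^ CARD('n)" by simp
  then show ?thesis using power_less_one_iff[of "norm x" "CARD('n)"] by (simp add: not_less[symmetric])
qed

section \<open>Full lattices as row lattices of invertible matrices\<close>

lemma rows_basis:
  fixes g :: "real^'n^'n"
  assumes "det g \<noteq> 0"
  shows "bij_betw (($) g) UNIV (range (($) g))" "independent (range (($) g))" "span (range (($) g)) = UNIV"
proof -
  have "inj (($) g)"
  proof (rule injI, rule ccontr)
    fix i j assume "g $ i = g $ j" "i \<noteq> j"
    then have "det g = 0" by (intro det_identical_rows[of i j]) (auto simp: row_def)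
    then show False using assms by simp
  qed
  then show bij: "bij_betw (($) g) UNIV (range (($) g))" by (simp add: bij_betw_def)
  have "rows g = range (($) g)" by (auto simp: rows_def row_def)
  moreover have "\<exists>C. C ** g = mat 1"
    using assms by (simp add: invertible_det_nz flip: invertible_left_inverse)
  ultimately show sp: "span (range (($) g)) = UNIV" by (simp add: matrix_left_invertible_span_rows)
  show "independent (range (($) g))"
    using bij_betw_same_card[OF bij] sp by (intro card_le_dim_spanning[of _ UNIV]) auto
qed

lemma full_lattice_row_lattice:
  fixes g :: "real^'n^'n"
  assumes "det g \<noteq> 0"
  shows "full_lattice (row_lattice g)" "covol (row_lattice g) = \<bar>det g\<bar>"
proof -
  have eq: "row_lattice g = zspan (range (($) g))"
    using zspan_eq_row_lattice[OF rows_basis(1)[OF assms]] by simp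
  show "full_lattice (row_lattice g)"
    using rows_basis[OF assms] by (auto simp: full_lattice_def is_lattice_def span_zspan eq)
  show "covol (row_lattice g) = \<bar>det g\<bar>"
    using gram_det_eq_det[OF rows_basis(1)[OF assms]] covol_zspan[OF rows_basis(2)[OF assms]]
    by (simp add: eq)
qed

lemma full_latticeE:
  fixes L :: "(real^'n) set"
  assumes L: "full_lattice L"
  obtains g where "det g \<noteq> 0" "L = row_lattice g"
proof -
  obtain B where B: "independent B" "L = zspan B" using L by (auto simp: full_lattice_def is_lattice_def)
  have "card B = CARD('n)"
    using L B(2) dim_zspan[OF B(1)] dim_eq_full[of L] by (simp add: full_lattice_def)
  then obtain \<beta> :: "'n \<Rightarrow> real^'n" where "bij_betw \<beta> UNIV B"
    using finite_same_card_bij[of "UNIV :: 'n set" B] B(1) independent_imp_finite by auto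
  then show thesis
    using that B basis_det_nonzero zspan_eq_row_lattice by blast
qed

section \<open>Sphere packing\<close>

text \<open>Balls of radius 1/2 about the points are disjoint and lie in the ball of radius R + 1/2;
  the bound is the ratio of the volumes.\<close>

lemma separated_card_le:
  fixes X :: "'a::euclidean_space set"
  assumes X: "finite X" "X \<subseteq> cball 0 R" and "R \<ge> 0"
    and sep: "\<And>x y. x \<in> X \<Longrightarrow> y \<in> X \<Longrightarrow> x \<noteq> y \<Longrightarrow> dist x y \<ge> 1"
  shows "real (card X) \<le> (2 * R + 1) ^ DIM('a)"
proof -
  let ?V = "unit_ball_vol (real DIM('a))"
  have disj: "disjoint_family_on (\<lambda>x. ball x (1/2)) X"
    unfolding disjoint_family_on_def
  proof (intro ballI impI)
    fix x y assume xy: "x \<in> X" "y \<in> X" "x \<noteq> y"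
    show "ball x (1/2) \<inter> ball y (1/2) = {}"
      using sep[OF xy] disjoint_ballI[of "1/2" "1/2" x y] by simp
  qed
  have "real (card X) * (?V * (1/2) ^ DIM('a)) = (\<Sum>x\<in>X. measure lborel (ball x (1/2)))"
    by (simp add: content_ball)
  also have "\<dots> = measure lborel (\<Union>x\<in>X. ball x (1/2))"
    by (intro measure_finite_Union[symmetric] X(1) disj) (auto simp: emeasure_ball)
  also have "\<dots> \<le> measure lborel (ball 0 (R + 1/2) :: 'a set)"
  proof (rule measure_mono_fmeasurable)
    show "(\<Union>x\<in>X. ball x (1/2)) \<subseteq> ball 0 (R + 1/2)"
    proof (safe, unfold mem_ball)
      fix x y assume "x \<in> X" and y: "dist x y < 1/2"
      then have "norm x \<le> R" using X(2) by auto
      moreover have "norm y \<le> norm x + dist x y" by (metis dist_commute dist_norm norm_triangle_sub)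
      ultimately show "dist 0 y < R + 1/2" using y by simp
    qed
    show "(\<Union>x\<in>X. ball x (1/2)) \<in> sets lborel" by (simp add: open_UN)
    show "ball 0 (R + 1/2) \<in> fmeasurable (lborel :: 'a measure)"
      using \<open>R \<ge> 0\<close> by (intro fmeasurableI) (simp_all add: emeasure_ball)
  qed
  also have "\<dots> = ?V * (R + 1/2) ^ DIM('a)"
    using \<open>R \<ge> 0\<close> by (simp add: content_ball)
  finally have "?V * (real (card X) * (1/2) ^ DIM('a)) \<le> ?V * (R + 1/2) ^ DIM('a)"
    by (simp add: mult_ac)
  then have "real (card X) * (1/2) ^ DIM('a) \<le> (R + 1/2) ^ DIM('a)"
    by (subst (asm) mult_le_cancel_left_pos) simp_all
  then have "real (card X) \<le> (R + 1/2) ^ DIM('a) * 2 ^ DIM('a)"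
    by (simp add: field_simps power_divide)
  also have "\<dots> = (2 * R + 1) ^ DIM('a)"
    by (simp add: power_mult_distrib[symmetric] algebra_simps)
  finally show ?thesis .
qed

text \<open>Dyadic shells: points with 2^j \<le> |x| \<le> 2^(j+1) number at most (5 * 2^j)^n by
  packing, where 5 comes from 2 * (2 * 2^j) + 1 \<le> 5 * 2^j, and each contributes at most 2^(-jp).
  This leaves a geometric series of ratio 2^(n-p) < 1. The bound does not depend on X, which later
  makes the estimate uniform over the moduli space.\<close>

lemma separated_sum_powr_le:
  fixes X :: "'a::euclidean_space set"
  assumes X: "finite X" and p: "p > real DIM('a)"
    and sep: "\<And>x y. x \<in> X \<Longrightarrow> y \<in> X \<Longrightarrow> x \<noteq> y \<Longrightarrow> dist x y \<ge> 1"
    and ge1: "\<And>x. x \<in> X \<Longrightarrow> norm x \<ge> 1"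
  shows "(\<Sum>x\<in>X. norm x powr (- p)) \<le> 5 ^ DIM('a) / (1 - 2 powr (real DIM('a) - p))"
proof -
  define q where "q = (2::real) powr (real DIM('a) - p)"
  have q: "0 < q" "q < 1"
    using p powr_less_one[of 2 "real DIM('a) - p"] by (simp_all add: q_def)
  \<comment> \<open>The index of the dyadic shell of x. On \<open>X\<close> the norm is at least 1,
    so the logarithm is nonnegative and \<open>nat\<close> loses nothing.\<close>
  define k where "k x = nat \<lfloor>log 2 (norm x)\<rfloor>" for x :: 'a
  have k: "2 ^ k x \<le> norm x" "norm x \<le> 2 * 2 ^ k x" if "x \<in> X" for x
  proof -
    have n: "norm x \<ge> 1" using ge1[OF that] .
    then have n0: "norm x > 0" by linarith
    from n have "log 2 (norm x) \<ge> 0" by (subst zero_le_log_cancel_iff) auto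
    then have kk: "real (k x) \<le> log 2 (norm x)" "log 2 (norm x) \<le> real (k x) + 1"
      unfolding k_def by linarith+
    have "2 powr real (k x) \<le> norm x" using kk(1) le_log_iff[OF _ n0, of 2] by simp
    then show "2 ^ k x \<le> norm x" by (simp add: powr_realpow)
    have "norm x \<le> 2 powr (real (k x) + 1)" using kk(2) log_le_iff[OF _ n0, of 2] by simp
    then show "norm x \<le> 2 * 2 ^ k x" by (simp add: powr_realpow powr_add)
  qed
  define K where "K = Suc (Max (k ` X))"
  have "(\<Sum>x\<in>X. norm x powr (- p)) \<le> (\<Sum>x\<in>X. (2 ^ k x) powr (- p))"
  proof (rule sum_mono)
    fix x assume "x \<in> X"
    then show "norm x powr (- p) \<le> (2 ^ k x) powr (- p)"
      using k(1)[of x] p by (intro powr_mono2') auto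
  qed
  also have "\<dots> = (\<Sum>j<K. \<Sum>x\<in>{x\<in>X. k x = j}. (2 ^ k x) powr (- p))"
  proof (rule sum.group[symmetric])
    show "k ` X \<subseteq> {..<K}" using X by (auto simp: K_def less_Suc_eq_le)
  qed (use X in auto)
  also have "\<dots> = (\<Sum>j<K. real (card {x\<in>X. k x = j}) * (2 ^ j) powr (- p))"
    by (intro sum.cong refl) simp
  also have "\<dots> \<le> (\<Sum>j<K. (5 * 2 ^ j) ^ DIM('a) * (2 ^ j) powr (- p))"
  proof (intro sum_mono mult_right_mono)
    fix j
    have "real (card {x\<in>X. k x = j}) \<le> (2 * (2 * 2 ^ j) + 1) ^ DIM('a)"
      using k(2) sep X by (intro separated_card_le) auto
    also have "\<dots> \<le> (5 * 2 ^ j) ^ DIM('a)" by (intro power_mono) auto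
    finally show "real (card {x\<in>X. k x = j}) \<le> (5 * 2 ^ j) ^ DIM('a)" .
  qed simp
  also have "\<dots> = (\<Sum>j<K. 5 ^ DIM('a) * q ^ j)"
  proof (rule sum.cong[OF refl])
    fix j :: nat
    have "(2 ^ j) ^ DIM('a) * (2 ^ j) powr (- p) = (2::real) powr (real j * real DIM('a)) * 2 powr (real j * (- p))"
      by (simp add: powr_powr flip: powr_realpow)
    also have "\<dots> = 2 powr ((real DIM('a) - p) * real j)"
      by (simp add: algebra_simps flip: powr_add)
    also have "\<dots> = q ^ j" by (simp add: q_def powr_powr[symmetric] powr_realpow)
    finally show "(5 * 2 ^ j) ^ DIM('a) * (2 ^ j) powr (- p) = 5 ^ DIM('a) * q ^ j"
      by (simp add: power_mult_distrib)
  qed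
  also have "\<dots> = 5 ^ DIM('a) * (\<Sum>j<K. q ^ j)" by (simp add: sum_distrib_left)
  also have "\<dots> \<le> 5 ^ DIM('a) * (1 / (1 - q))"
  proof (intro mult_left_mono)
    have "(\<Sum>j<K. q ^ j) \<le> (\<Sum>j. q ^ j)"
      using q by (intro sum_le_suminf summable_geometric) auto
    then show "(\<Sum>j<K. q ^ j) \<le> 1 / (1 - q)" using q by (simp add: suminf_geometric)
  qed simp
  finally show ?thesis by (simp add: q_def)
qed

text \<open>Isolates what the Mellin transform uses of a semi-stable lattice of covolume 1: unit
  separation gives convergence, the origin accounts for the term 1 subtracted from the theta series,
  and countability makes the counting measure sigma-finite for Fubini.\<close>

definition sep_set :: "'a::euclidean_space set \<Rightarrow> bool" where
  "sep_set L \<longleftrightarrow> countable L \<and> 0 \<in> L \<and> (\<forall>x\<in>L. \<forall>y\<in>L. x \<noteq> y \<longrightarrow> dist x y \<ge> 1)"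

lemma sep_set_norm_ge_1: "sep_set L \<Longrightarrow> x \<in> L - {0} \<Longrightarrow> norm x \<ge> 1"
  unfolding sep_set_def by (metis DiffE dist_0_norm dist_commute insertI1)

lemma sep_set_powr:
  fixes L :: "'a::euclidean_space set"
  assumes L: "sep_set L" and p: "p > real DIM('a)"
  shows "(\<lambda>x. norm x powr (- p)) summable_on (L - {0})"
    "(\<Sum>\<^sub>\<infinity>x\<in>L - {0}. norm x powr (- p)) \<le> 5 ^ DIM('a) / (1 - 2 powr (real DIM('a) - p))"
proof -
  have *: "(\<Sum>x\<in>X. norm x powr (- p)) \<le> 5 ^ DIM('a) / (1 - 2 powr (real DIM('a) - p))"
    if "finite X" "X \<subseteq> L - {0}" for X
    using that L sep_set_norm_ge_1[OF L]
    by (intro separated_sum_powr_le p) (auto simp: sep_set_def subset_eq)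
  show summ: "(\<lambda>x. norm x powr (- p)) summable_on (L - {0})"
    by (rule nonneg_bdd_above_summable_on) (use * in \<open>auto intro!: bdd_aboveI2\<close>)
  show "(\<Sum>\<^sub>\<infinity>x\<in>L - {0}. norm x powr (- p)) \<le> 5 ^ DIM('a) / (1 - 2 powr (real DIM('a) - p))"
    by (rule infsum_le_finite_sums[OF summ]) (use * in auto)
qed


section \<open>Mellin transforms of theta series\<close>

lemma sigma_finite_mult_haar: "sigma_finite_measure mult_haar"
proof -
  have "sigma_finite_measure (restrict_space lborel {0::real<..})"
    by (rule sigma_finite_measure_restrict_space[OF lborel.sigma_finite_measure_axioms]) simp
  then show ?thesis
    unfolding mult_haar_def
    by (subst sigma_finite_measure.sigma_finite_iff_density_finite) (auto intro!: measurable_restrict_space1)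
qed

lemma space_mult_haar [simp]: "space mult_haar = {0<..}"
  by (simp add: mult_haar_def space_restrict_space)

lemma measurable_mult_haarI: "f \<in> borel_measurable borel \<Longrightarrow> f \<in> borel_measurable mult_haar"
  unfolding mult_haar_def by (simp add: measurable_restrict_space1)

lemma mult_haar_mellin:
  fixes f :: "real \<Rightarrow> complex"
  assumes [measurable]: "f \<in> borel_measurable borel"
  shows "integrable mult_haar f \<longleftrightarrow> set_integrable lborel {0<..} (\<lambda>T. f T / of_real T)"
    "integral\<^sup>L mult_haar f = set_lebesgue_integral lborel {0<..} (\<lambda>T. f T / of_real T)"
proof -
  let ?R = "restrict_space lborel {0::real<..}"
  have f: "f \<in> borel_measurable ?R" "(\<lambda>T. 1 / T) \<in> borel_measurable ?R"
    by (auto intro!: measurable_restrict_space1)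
  have AE: "AE T in ?R. 0 \<le> 1 / T" by (intro AE_I2) (simp add: space_restrict_space)
  show "integrable mult_haar f \<longleftrightarrow> set_integrable lborel {0<..} (\<lambda>T. f T / of_real T)"
    unfolding mult_haar_def
    by (subst integrable_density[OF f AE], subst integrable_restrict_space)
      (auto simp: set_integrable_def scaleR_conv_of_real divide_inverse mult_ac)
  show "integral\<^sup>L mult_haar f = set_lebesgue_integral lborel {0<..} (\<lambda>T. f T / of_real T)"
    unfolding mult_haar_def
    by (subst integral_density[OF f AE], subst integral_restrict_space)
      (auto simp: set_lebesgue_integral_def scaleR_conv_of_real divide_inverse mult_ac)
qed

text \<open>The substitution \<open>u = a T\<^sup>c\<close> in the Gamma integral.\<close>

lemma mellin_exp_powr:
  fixes a c :: real and s :: complex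
  assumes a: "a > 0" and c: "c > 0" and s: "Re s > 0"
  defines "f \<equiv> (\<lambda>T. exp (s * of_real (ln T)) * of_real (exp (- (a * T powr c))))"
  shows "integrable mult_haar f"
    "integral\<^sup>L mult_haar f = of_real (1 / c) * of_real a powr (- (s / of_real c)) * Gamma (s / of_real c)"
proof -
  \<comment> \<open>The exponent after the substitution: u^z = a^z T^(c z) = a^z T^s.\<close>
  define z where "z = s / of_real c"
  have z: "Re z > 0" using s c by (simp add: z_def)
  define F where "F = (\<lambda>u. complex_of_real u powr (z - 1) / of_real (exp u))"
  define g where "g = (\<lambda>T. a * T powr c)"
  define h where "h = (\<lambda>T. a * (c * T powr (c - 1)))"
  \<comment> \<open>Together with du/u = c dT/T, the identity u^z = a^z T^s makes the substituted
    Gamma integrand exactly \<open>K\<close> times the Mellin integrand.\<close>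
  define K where "K = of_real c * of_real a powr z"
  have K: "K \<noteq> 0" using a c by (simp add: K_def)
  have [measurable]: "f \<in> borel_measurable borel" unfolding f_def by measurable
  have der: "(g has_field_derivative h T) (at T within {0<..})" if "T \<in> {0<..}" for T
    using that unfolding g_def h_def
    by (auto intro!: derivative_eq_intros DERIV_powr[THEN has_field_derivative_at_within])
  have inj: "inj_on g {0<..}"
  proof (rule inj_onI)
    fix x y assume xy: "x \<in> {0<..}" "y \<in> {0<..}" "g x = g y"
    then have "(x powr c) powr (1 / c) = (y powr c) powr (1 / c)" using a by (simp add: g_def)
    then show "x = y" using xy c by (simp add: powr_powr)
  qed
  have im: "g ` {0<..} = {0<..}"
  proof (intro equalityI subsetI)
    fix u :: real assume u: "u \<in> {0<..}"
    then have "u = g ((u / a) powr (1 / c))" using a c by (simp add: g_def powr_powr)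
    moreover have "(u / a) powr (1 / c) \<in> {0<..}" using u a by simp
    ultimately show "u \<in> g ` {0<..}" by blast
  qed (use a in \<open>auto simp: g_def\<close>)
  have eq: "\<bar>h T\<bar> *\<^sub>R F (g T) = K * (f T / of_real T)" if "T \<in> {0<..}" for T
  proof -
    have T: "T > 0" using that by simp
    have "complex_of_real (g T) powr (z - 1) = of_real a powr (z - 1) * of_real (T powr c) powr (z - 1)"
      using a T unfolding g_def of_real_mult by (subst powr_times_real) auto
    also have "complex_of_real (T powr c) powr (z - 1) = of_real T powr (of_real c * (z - 1))"
      using T by (simp add: powr_def[of "complex_of_real _"] ln_powr Ln_of_real mult_ac)
    finally have 1: "complex_of_real (g T) powr (z - 1) =
        of_real a powr (z - 1) * of_real T powr (of_real c * (z - 1))" .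
    have 2: "complex_of_real (h T) = of_real a * of_real c * of_real T powr (of_real c - 1)"
      using T by (simp add: h_def powr_of_real[symmetric])
    have 3: "complex_of_real a * of_real a powr (z - 1) = of_real a powr z"
      using a by (simp add: powr_diff)
    have 4: "complex_of_real T powr (of_real c - 1) * of_real T powr (of_real c * (z - 1))
        = exp (s * of_real (ln T)) / of_real T"
    proof -
      have "complex_of_real T powr (of_real c - 1) * of_real T powr (of_real c * (z - 1))
          = of_real T powr (s - 1)"
        using c by (simp add: powr_add[symmetric] z_def algebra_simps)
      also have "\<dots> = of_real T powr s / of_real T" using T by (simp add: powr_diff)
      also have "complex_of_real T powr s = exp (s * of_real (ln T))"
        using T by (simp add: powr_def Ln_of_real)
      finally show ?thesis .
    qed
    have "\<bar>h T\<bar> = h T" using a c by (simp add: h_def)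
    then have "\<bar>h T\<bar> *\<^sub>R F (g T) =
       (complex_of_real a * of_real a powr (z - 1)) * of_real c *
       (complex_of_real T powr (of_real c - 1) * of_real T powr (of_real c * (z - 1))) / of_real (exp (g T))"
      by (simp add: F_def scaleR_conv_of_real 1 2 mult_ac)
    also have "\<dots> = K * (f T / of_real T)"
      unfolding 3 4 by (simp add: K_def f_def g_def exp_minus field_simps)
    finally show ?thesis .
  qed
  have "F absolutely_integrable_on g ` {0<..} \<and> integral (g ` {0<..}) F = Gamma z"
    unfolding im F_def
    using absolutely_integrable_Gamma_integral'[OF z] Gamma_integral_complex'[OF z]
    by (auto dest: integral_unique)
  then have "(\<lambda>T. \<bar>h T\<bar> *\<^sub>R F (g T)) absolutely_integrable_on {0<..} \<and>
      integral {0<..} (\<lambda>T. \<bar>h T\<bar> *\<^sub>R F (g T)) = Gamma z"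
    by (subst has_absolute_integral_change_of_variables_real[OF _ der inj]) auto
  moreover have "integral {0<..} (\<lambda>T. \<bar>h T\<bar> *\<^sub>R F (g T)) = integral {0<..} (\<lambda>T. K * (f T / of_real T))"
    by (rule Henstock_Kurzweil_Integration.integral_cong) (rule eq)
  moreover have "(\<lambda>T. \<bar>h T\<bar> *\<^sub>R F (g T)) absolutely_integrable_on {0<..} \<longleftrightarrow>
      (\<lambda>T. K * (f T / of_real T)) absolutely_integrable_on {0<..}"
    by (rule set_integrable_cong) (simp_all only: eq)
  ultimately have abs: "(\<lambda>T. K * (f T / of_real T)) absolutely_integrable_on {0<..}"
    and int: "integral {0<..} (\<lambda>T. K * (f T / of_real T)) = Gamma z"
    by simp_all
  \<comment> \<open>The Gamma integral lives on the completed measure, \<open>mult_haar\<close> on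
    \<open>lborel\<close>; for the Borel integrand the two notions agree.\<close>
  have "set_integrable lborel {0<..} (\<lambda>T. K * (f T / of_real T))"
    using abs unfolding set_integrable_def
    by (subst (asm) integrable_completion) auto
  then have "set_integrable lborel {0<..} (\<lambda>T. f T / of_real T)"
    by (subst (asm) set_integrable_mult_right_iff) (use K in auto)
  then show "integrable mult_haar f" by (simp add: mult_haar_mellin)
  have "Gamma z = (LINT T:{0<..}|lebesgue. K * (f T / of_real T))"
    using set_lebesgue_integral_eq_integral(2)[OF abs] int by simp
  also have "\<dots> = (LINT T:{0<..}|lborel. K * (f T / of_real T))"
    unfolding set_lebesgue_integral_def by (subst integral_completion) auto
  also have "\<dots> = K * integral\<^sup>L mult_haar f"
    unfolding mult_haar_mellin(2)[OF \<open>f \<in> borel_measurable borel\<close>]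
    by (rule set_integral_mult_right)
  finally have "integral\<^sup>L mult_haar f = Gamma z / K" using K by (simp add: field_simps)
  then show "integral\<^sup>L mult_haar f = of_real (1 / c) * of_real a powr (- (s / of_real c)) * Gamma (s / of_real c)"
    using c by (simp add: K_def z_def powr_minus field_simps)
qed

text \<open>Turns sums over a lattice into Bochner integrals over a counting measure, so that
  exchanging a sum with an integral becomes an instance of Fubini.\<close>

lemma count_space_summable:
  fixes f :: "'b \<Rightarrow> complex"
  assumes "(\<lambda>x. norm (f x)) summable_on A"
  shows "integrable (count_space A) f" "integral\<^sup>L (count_space A) f = infsum f A"
proof -
  have *: "Infinite_Set_Sum.abs_summable_on f A"
    using assms abs_summable_equivalent[of f A] by simp
  then show "integrable (count_space A) f" by (simp add: Infinite_Set_Sum.abs_summable_on_def)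
  show "integral\<^sup>L (count_space A) f = infsum f A"
    using infsetsum_infsum[OF *] by (simp add: infsetsum_def)
qed

text \<open>\<open>theta L T\<close> is the theta series of the lattice \<open>T\<^bsup>1/n\<^esup> L\<close>.\<close>

definition theta :: "'a::euclidean_space set \<Rightarrow> real \<Rightarrow> real" where
  "theta L T = (\<Sum>\<^sub>\<infinity>x\<in>L. exp (- pi * T powr (2 / real DIM('a)) * (norm x)\<^sup>2))"

text \<open>From (1 + u/m)^m \<le> exp u one gets exp(-u) \<le> (m/u)^m. With m the dimension and u
  = pi t |x|^2 this dominates the Gaussian by a multiple of |x|^(-2m), which is summable because 2m
  > m.\<close>

lemma gauss_summable:
  fixes L :: "'a::euclidean_space set"
  assumes L: "sep_set L" and t: "t > 0"
  shows "(\<lambda>x. exp (- pi * t * (norm x)\<^sup>2)) summable_on L - {0}"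
proof -
  let ?m = "DIM('a)"
  define C where "C = (real ?m / (pi * t)) ^ ?m"
  have bound: "exp (- pi * t * (norm x)\<^sup>2) \<le> C * norm x powr (- (2 * real ?m))" if "x \<in> L - {0}" for x
  proof -
    define u where "u = pi * t * (norm x)\<^sup>2"
    have u: "u > 0" using t that by (simp add: u_def)
    have "(u / real ?m) ^ ?m \<le> (1 + u / real ?m) ^ ?m" using u by (intro power_mono) auto
    also have "\<dots> \<le> exp u" using u by (intro exp_ge_one_plus_x_over_n_power_n) auto
    finally have "exp (- u) \<le> (real ?m / u) ^ ?m"
      using u by (simp add: exp_minus power_divide field_simps)
    also have "\<dots> = C * inverse (((norm x)\<^sup>2) ^ ?m)"
      by (simp add: C_def u_def power_divide power_mult_distrib field_simps)
    also have "((norm x)\<^sup>2) ^ ?m = norm x powr (2 * real ?m)"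
      using that powr_realpow[of "norm x" "2 * ?m"] by (simp add: power_mult)
    finally show ?thesis by (simp add: u_def powr_minus)
  qed
  have "(\<lambda>x. C * norm x powr (- (2 * real ?m))) summable_on L - {0}"
    by (intro summable_on_cmult_right sep_set_powr(1) L) simp
  then show ?thesis
    by (rule summable_on_comparison_test) (use bound in auto)
qed

lemma theta_minus_1:
  assumes L: "sep_set L" and T: "T > 0"
  shows "theta L T - 1 = (\<Sum>\<^sub>\<infinity>x\<in>L - {0}. exp (- pi * T powr (2 / real DIM('a)) * (norm (x::'a::euclidean_space))\<^sup>2))"
proof -
  let ?g = "\<lambda>x::'a. exp (- pi * T powr (2 / real DIM('a)) * (norm x)\<^sup>2)"
  have "infsum ?g (insert 0 (L - {0})) = ?g 0 + infsum ?g (L - {0})"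
    by (rule infsum_insert) (use gauss_summable[OF L, of "T powr (2 / real DIM('a))"] T in auto)
  moreover have "insert 0 (L - {0}) = L" using L by (auto simp: sep_set_def)
  ultimately show ?thesis by (simp add: theta_def)
qed


lemma powr_pi_mult_square: "r > 0 \<Longrightarrow> complex_of_real (pi * r\<^sup>2) powr (- z) = of_real pi powr (- z) * of_real r powr (- 2 * z)"
proof -
  assume r: "r > 0"
  have "complex_of_real (pi * (r * r)) powr (- z) = of_real pi powr (- z) * (of_real r powr (- z) * of_real r powr (- z))"
    using r unfolding of_real_mult by (subst powr_times_real; simp)+
  also have "complex_of_real r powr (- z) * of_real r powr (- z) = of_real r powr (- 2 * z)"
    by (simp flip: powr_add)
  finally show ?thesis by (simp add: power2_eq_square)
qed

text \<open>The series over nonzero x is integrated term by term. Each term is a Gamma integral with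
  a = pi |x|^2 and c = 2/n, so s/c = (n/2) s and 1/c = n/2. The exchange is legitimate because the
  integrals of the moduli are constant multiples of |x|^(-n \<sigma>) with n \<sigma> > n.\<close>

lemma
  fixes L :: "'a::euclidean_space set" and s :: complex
  assumes L: "sep_set L" and s: "Re s > 1"
  defines "n \<equiv> real DIM('a)"
  defines "f \<equiv> (\<lambda>T. of_real (theta L T - 1) * exp (s * of_real (ln T)))"
  shows mellin_theta_integrable: "integrable mult_haar f"
    and mellin_theta: "integral\<^sup>L mult_haar f = of_real (n / 2) * epstein_hat L (of_real (n / 2) * s)"
proof -
  interpret M: sigma_finite_measure mult_haar by (rule sigma_finite_mult_haar)
  let ?A = "L - {0}"
  have cA: "countable ?A" using L by (simp add: sep_set_def)
  interpret A: sigma_finite_measure "count_space ?A"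
    by (rule sigma_finite_measure_count_space_countable[OF cA])
  interpret P: pair_sigma_finite "count_space ?A" mult_haar ..
  have n: "n > 0" by (simp add: n_def)
  define F where "F = (\<lambda>s (x::'a) T. exp (s * of_real (ln T)) * of_real (exp (- (pi * (norm x)\<^sup>2 * T powr (2 / n)))) :: complex)"
  have int: "integrable mult_haar (F s x)"
      "integral\<^sup>L mult_haar (F s x) = of_real (n / 2) * of_real pi powr (- (of_real (n / 2) * s)) *
        Gamma (of_real (n / 2) * s) * of_real (norm x) powr (- 2 * (of_real (n / 2) * s))"
    if x: "x \<in> ?A" and s: "Re s > 0" for x s
  proof -
    have "pi * (norm x)\<^sup>2 > 0" "2 / n > 0" using x n by auto
    note * = mellin_exp_powr[OF this s, folded F_def]
    then show "integrable mult_haar (F s x)" by (simp add: F_def)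
    show "integral\<^sup>L mult_haar (F s x) = of_real (n / 2) * of_real pi powr (- (of_real (n / 2) * s)) *
        Gamma (of_real (n / 2) * s) * of_real (norm x) powr (- 2 * (of_real (n / 2) * s))"
    proof -
      have "s / complex_of_real (2 / n) = of_real (n / 2) * s" using n by (simp add: field_simps)
      then show ?thesis
        using *(2) x n powr_pi_mult_square[of "norm x" "of_real (n / 2) * s"] by (simp add: F_def mult_ac)
    qed
  qed
  have meas: "case_prod (F s) \<in> borel_measurable (count_space ?A \<Otimes>\<^sub>M mult_haar)" for s
    by (rule measurable_pair_measure_countable1[OF cA]) (simp add: F_def measurable_mult_haarI)
  define \<sigma> where "\<sigma> = Re s"
  have \<sigma>: "\<sigma> > 1" using s by (simp add: \<sigma>_def)
  define K where "K = n / 2 * pi powr (- (n / 2 * \<sigma>)) * Gamma (n / 2 * \<sigma>)"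
  \<comment> \<open>The modulus of a term is the same term at the real exponent
    \<open>\<sigma>\<close>, so the exact formula \<open>int\<close> also evaluates the integral of
    the modulus.\<close>
  have normF: "(\<integral>T. norm (F s x T) \<partial>mult_haar) = K * norm x powr (- (n * \<sigma>))" if x: "x \<in> ?A" for x
  proof -
    have "complex_of_real (\<integral>T. norm (F s x T) \<partial>mult_haar) = integral\<^sup>L mult_haar (F (of_real \<sigma>) x)"
      unfolding integral_complex_of_real[symmetric]
      by (intro Bochner_Integration.integral_cong)
        (auto simp: F_def norm_mult norm_exp_eq_Re \<sigma>_def exp_of_real[symmetric] of_real_exp)
    also have "\<dots> = of_real (K * norm x powr (- (n * \<sigma>)))"
    proof -
      have G: "Gamma (complex_of_real (n / 2) * of_real \<sigma>) = of_real (Gamma (n / 2 * \<sigma>))"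
        by (simp only: Gamma_complex_of_real flip: of_real_mult)
      have pi: "complex_of_real pi powr (- (of_real (n / 2) * of_real \<sigma>)) = of_real (pi powr (- (n / 2 * \<sigma>)))"
        by (simp only: powr_of_real pi_ge_zero flip: of_real_mult of_real_minus)
      have "- 2 * (complex_of_real (n / 2) * of_real \<sigma>) = of_real (- (n * \<sigma>))" by simp
      then have nx: "complex_of_real (norm x) powr (- 2 * (of_real (n / 2) * of_real \<sigma>))
          = of_real (norm x powr (- (n * \<sigma>)))"
        by (simp only: powr_of_real norm_ge_zero)
      show ?thesis
        unfolding int(2)[OF x, of "of_real \<sigma>", unfolded G pi nx Re_complex_of_real, OF less_trans[OF zero_less_one \<sigma>]]
        by (simp add: K_def)
    qed
    finally show ?thesis by (simp only: of_real_eq_iff)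
  qed
  have pow: "(\<lambda>x. norm x powr (- (n * \<sigma>))) summable_on ?A"
    by (rule sep_set_powr(1)[OF L]) (use \<sigma> n in \<open>simp add: n_def\<close>)
  have intP: "integrable (count_space ?A \<Otimes>\<^sub>M mult_haar) (case_prod (F s))"
  proof (rule P.Fubini_integrable[OF meas])
    have "(\<lambda>x. norm (complex_of_real (K * norm x powr (- (n * \<sigma>))))) summable_on ?A"
      using summable_on_cmult_right[OF pow, of "\<bar>K\<bar>"] by (simp add: abs_mult norm_mult)
    from count_space_summable(1)[OF this]
    have "integrable (count_space ?A) (\<lambda>x. K * norm x powr (- (n * \<sigma>)))"
      by (simp only: complex_of_real_integrable_eq)
    then show "integrable (count_space ?A) (\<lambda>x. \<integral>T. norm (case_prod (F s) (x, T)) \<partial>mult_haar)"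
      by (subst Bochner_Integration.integrable_cong[OF refl]) (auto simp: normF)
    show "AE x in count_space ?A. integrable mult_haar (\<lambda>T. case_prod (F s) (x, T))"
      using int(1) s by (auto simp: AE_count_space)
  qed
  have eqf: "(\<integral>x. F s x T \<partial>count_space ?A) = f T" if T: "T > 0" for T
  proof -
    have g: "(\<lambda>x. exp (- pi * T powr (2 / n) * (norm x)\<^sup>2)) summable_on ?A"
      using T by (intro gauss_summable L) simp
    have F: "F s x T = exp (s * of_real (ln T)) * of_real (exp (- pi * T powr (2 / n) * (norm x)\<^sup>2))" for x
      by (simp add: F_def mult_ac)
    have "(\<lambda>x. norm (F s x T)) summable_on ?A"
      unfolding F norm_mult using summable_on_cmult_right[OF g] by simp
    then have "(\<integral>x. F s x T \<partial>count_space ?A) = (\<Sum>\<^sub>\<infinity>x\<in>?A. F s x T)"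
      by (rule count_space_summable(2))
    also have "\<dots> = exp (s * of_real (ln T)) * (\<Sum>\<^sub>\<infinity>x\<in>?A. of_real (exp (- pi * T powr (2 / n) * (norm x)\<^sup>2)))"
      unfolding F by (rule infsum_cmult_right')
    also have "(\<Sum>\<^sub>\<infinity>x\<in>?A. complex_of_real (exp (- pi * T powr (2 / n) * (norm x)\<^sup>2))) = of_real (theta L T - 1)"
      unfolding theta_minus_1[OF L T] n_def by (rule infsumI) (simp only: has_sum_of_real_iff has_sum_infsum[OF g[unfolded n_def]])
    finally show ?thesis by (simp add: f_def mult.commute)
  qed
  have "integrable mult_haar (\<lambda>T. \<integral>x. F s x T \<partial>count_space ?A)"
    by (rule P.integrable_snd[OF intP])
  then show "integrable mult_haar f"
    by (subst (asm) Bochner_Integration.integrable_cong[OF refl]) (auto simp: eqf)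
  have "integral\<^sup>L mult_haar f = (\<integral>T. (\<integral>x. F s x T \<partial>count_space ?A) \<partial>mult_haar)"
    by (intro Bochner_Integration.integral_cong) (auto simp: eqf)
  also have "\<dots> = (\<integral>x. (\<integral>T. F s x T \<partial>mult_haar) \<partial>count_space ?A)"
    by (rule P.Fubini_integral[OF intP])
  also have "\<dots> = (\<integral>x. of_real (n / 2) * of_real pi powr (- (of_real (n / 2) * s)) *
        Gamma (of_real (n / 2) * s) * of_real (norm x) powr (- 2 * (of_real (n / 2) * s)) \<partial>count_space ?A)"
    by (intro Bochner_Integration.integral_cong) (use int(2) s in auto)
  also have "\<dots> = of_real (n / 2) * of_real pi powr (- (of_real (n / 2) * s)) * Gamma (of_real (n / 2) * s) *
      (\<integral>x. of_real (norm x) powr (- 2 * (of_real (n / 2) * s)) \<partial>count_space ?A)"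
    by simp
  also have "(\<integral>x. of_real (norm x) powr (- 2 * (of_real (n / 2) * s)) \<partial>count_space ?A)
      = (\<Sum>\<^sub>\<infinity>x\<in>?A. of_real (norm x) powr (- 2 * (of_real (n / 2) * s)))"
  proof (rule count_space_summable(2))
    have "norm (complex_of_real (norm x) powr (- 2 * (of_real (n / 2) * s))) = norm x powr (- (n * \<sigma>))" for x :: 'a
      by (cases "x = 0") (simp_all add: norm_powr_real_powr \<sigma>_def)
    then show "(\<lambda>x. norm (complex_of_real (norm x) powr (- 2 * (of_real (n / 2) * s)))) summable_on ?A"
      using pow by simp
  qed
  finally show "integral\<^sup>L mult_haar f = of_real (n / 2) * epstein_hat L (of_real (n / 2) * s)"
    by (simp add: epstein_hat_def mult.assoc)
qed

text \<open>Since the theta series is at least 1, the integral of the modulus is itself the Mellin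
  transform at \<open>Re s\<close>, and the packing estimate bounds the Epstein series there. The
  right-hand side is free of \<open>L\<close>, so it serves as a dominating constant on a space of
  finite measure.\<close>

lemma mellin_theta_norm_le:
  fixes L :: "'a::euclidean_space set" and s :: complex
  assumes L: "sep_set L" and s: "Re s > 1"
  defines "n \<equiv> real DIM('a)"
  shows "(\<integral>T. norm (of_real (theta L T - 1) * exp (s * of_real (ln T))) \<partial>mult_haar)
     \<le> n / 2 * (pi powr (- (n / 2 * Re s)) * \<bar>Gamma (n / 2 * Re s)\<bar> *
         (5 ^ DIM('a) / (1 - 2 powr (n - n * Re s))))" (is "?I \<le> _")
proof -
  define \<sigma> where "\<sigma> = Re s"
  have \<sigma>: "\<sigma> > 1" using s by (simp add: \<sigma>_def)
  have n: "n > 0" by (simp add: n_def)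
  have p: "n * \<sigma> > real DIM('a)" using \<sigma> n by (simp add: n_def)
  have ge: "theta L T - 1 \<ge> 0" if "T > 0" for T
    unfolding theta_minus_1[OF L that] by (rule infsum_nonneg) simp
  have "complex_of_real ?I = (\<integral>T. of_real (theta L T - 1) * exp (of_real \<sigma> * of_real (ln T)) \<partial>mult_haar)"
    unfolding integral_complex_of_real[symmetric]
    using ge by (intro Bochner_Integration.integral_cong)
      (auto simp: norm_mult norm_exp_eq_Re \<sigma>_def of_real_exp simp del: of_real_diff)
  also have "\<dots> = of_real (n / 2) * epstein_hat L (of_real (n / 2) * of_real \<sigma>)"
    using mellin_theta[OF L, of "of_real \<sigma>"] \<sigma> by (simp add: n_def)
  finally have "?I = norm (of_real (n / 2) * epstein_hat L (of_real (n / 2) * of_real \<sigma>))"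
    using norm_of_real[of ?I] by (metis (no_types, lifting) Bochner_Integration.integral_nonneg abs_of_nonneg norm_ge_zero)
  also have "\<dots> = n / 2 * (pi powr (- (n / 2 * \<sigma>)) * \<bar>Gamma (n / 2 * \<sigma>)\<bar> *
      norm (\<Sum>\<^sub>\<infinity>x\<in>L - {0}. complex_of_real (norm x) powr (- 2 * (of_real (n / 2) * of_real \<sigma>))))"
  proof -
    have G: "Gamma (complex_of_real (n / 2) * of_real \<sigma>) = of_real (Gamma (n / 2 * \<sigma>))"
      by (simp only: Gamma_complex_of_real flip: of_real_mult)
    have NG: "norm (Gamma (complex_of_real (n / 2) * of_real \<sigma>)) = \<bar>Gamma (n / 2 * \<sigma>)\<bar>"
      by (simp only: G norm_of_real)
    have P: "norm (complex_of_real pi powr (- (of_real (n / 2) * of_real \<sigma>))) = pi powr (- (n / 2 * \<sigma>))"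
      by (subst norm_powr_real_powr) auto
    have "norm (complex_of_real (n / 2)) = n / 2" using n by (simp only: norm_of_real)
    then show ?thesis unfolding epstein_hat_def norm_mult NG P by (simp only: mult.assoc)
  qed
  also have "\<dots> \<le> n / 2 * (pi powr (- (n / 2 * \<sigma>)) * \<bar>Gamma (n / 2 * \<sigma>)\<bar> *
      (5 ^ DIM('a) / (1 - 2 powr (n - n * \<sigma>))))"
  proof -
    have eq: "norm (complex_of_real (norm x) powr (- 2 * (of_real (n / 2) * of_real \<sigma>))) = norm x powr (- (n * \<sigma>))" for x :: 'a
      by (cases "x = 0") (simp_all add: norm_powr_real_powr)
    have "norm (\<Sum>\<^sub>\<infinity>x\<in>L - {0}. complex_of_real (norm x) powr (- 2 * (of_real (n / 2) * of_real \<sigma>)))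
      \<le> (\<Sum>\<^sub>\<infinity>x\<in>L - {0}. norm (complex_of_real (norm x) powr (- 2 * (of_real (n / 2) * of_real \<sigma>))))"
      by (rule norm_infsum_bound) (unfold eq, rule sep_set_powr(1)[OF L p])
    also have "\<dots> \<le> 5 ^ DIM('a) / (1 - 2 powr (n - n * \<sigma>))"
      unfolding eq using sep_set_powr(2)[OF L p] by (simp add: n_def)
    finally show ?thesis using n by (intro mult_left_mono) auto
  qed
  finally show ?thesis by (simp add: \<sigma>_def)
qed

section \<open>Unimodular maps preserve Lebesgue measure\<close>

text \<open>The library proves that linear maps scale Lebesgue measure by the determinant only for index
  types of class \<open>wellorder\<close>; the copy \<open>'n ordered\<close> of the index type transports this to
  every finite index type.\<close>

typedef 'a ordered = "UNIV :: 'a set" morphisms unord ord ..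

definition enum_index :: "'a::finite \<Rightarrow> nat" where
  "enum_index = (SOME f. inj f)"

lemma inj_enum_index: "inj (enum_index :: 'a::finite \<Rightarrow> nat)"
proof -
  have "\<exists>f :: 'a \<Rightarrow> nat. inj f"
    using finite_imp_inj_to_nat_seg[of "UNIV :: 'a set"] by blast
  then show ?thesis unfolding enum_index_def by (rule someI_ex)
qed

instantiation ordered :: (finite) "{finite, wellorder}"
begin

definition less_eq_ordered :: "'a ordered \<Rightarrow> 'a ordered \<Rightarrow> bool" where
  "x \<le> y \<longleftrightarrow> enum_index (unord x) \<le> enum_index (unord y)"

definition less_ordered :: "'a ordered \<Rightarrow> 'a ordered \<Rightarrow> bool" where
  "x < y \<longleftrightarrow> enum_index (unord x) < enum_index (unord y)"

instance
proof
  have "UNIV = ord ` (UNIV :: 'a set)" by (metis surj_def unord_inverse)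
  then show "finite (UNIV :: 'a ordered set)" by (metis finite finite_imageI)
next
  fix x y :: "'a ordered"
  assume "x \<le> y" "y \<le> x"
  then show "x = y"
    by (metis inj_enum_index injD le_antisym less_eq_ordered_def unord_inject)
next
  fix P :: "'a ordered \<Rightarrow> bool" and a
  assume *: "\<And>x. (\<And>y. y < x \<Longrightarrow> P y) \<Longrightarrow> P x"
  show "P a"
  proof (induction a rule: measure_induct_rule[of "\<lambda>x. enum_index (unord x)"])
    case (less x)
    show ?case by (rule *, rule less) (simp add: less_ordered_def)
  qed
qed (auto simp: less_eq_ordered_def less_ordered_def)

end

lemma bij_unord: "bij unord" and bij_ord: "bij ord"
  by (auto intro!: bijI injI surjI[of unord ord] surjI[of ord unord]
      simp: unord_inject ord_inject unord_inverse ord_inverse)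

definition to_ord :: "real^'n \<Rightarrow> real^('n ordered)" where
  "to_ord x = (\<chi> i. x $ unord i)"

definition of_ord :: "real^('n ordered) \<Rightarrow> real^'n" where
  "of_ord x = (\<chi> i. x $ ord i)"

lemma to_of_ord [simp]: "to_ord (of_ord x) = x" "of_ord (to_ord y) = y"
  by (simp_all add: to_ord_def of_ord_def vec_eq_iff unord_inverse ord_inverse)

lemma linear_to_ord: "linear to_ord" and linear_of_ord: "linear of_ord"
  by (auto intro!: linearI simp: to_ord_def of_ord_def vec_eq_iff)

lemma prod_Basis_cart: "(\<Prod>b\<in>Basis. (x :: real^'n) \<bullet> b) = (\<Prod>i\<in>UNIV. x $ i)"
proof -
  have "bij_betw (\<lambda>i. axis i 1 :: real^'n) UNIV Basis"
    by (auto simp: bij_betw_def inj_on_def axis_eq_axis Basis_vec_def)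
  from prod.reindex_bij_betw[OF this, of "\<lambda>b. x \<bullet> b"] show ?thesis
    by (simp add: inner_axis)
qed

text \<open>Relabelling coordinates carries boxes to boxes with the same side lengths, and the
  measure of boxes determines \<open>lborel\<close>.\<close>

lemma lborel_distr_to_ord: "distr lborel borel to_ord = (lborel :: (real^('n::finite ordered)) measure)"
proof (rule lborel_eqI[symmetric])
  fix l u :: "real^('n ordered)"
  assume "\<And>b. b \<in> Basis \<Longrightarrow> l \<bullet> b \<le> u \<bullet> b"
  then have le: "l $ i \<le> u $ i" for i
    by (metis axis_in_Basis_iff cart_eq_inner_axis inner_commute real_inner_1_right Basis_real_def insertI1)
  have [measurable]: "to_ord \<in> borel_measurable borel"
    by (intro borel_measurable_continuous_onI linear_continuous_on) (simp add: linear_to_ord flip: linear_conv_bounded_linear)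
  have "to_ord -` box l u = box (of_ord l) (of_ord u)"
  proof (intro set_eqI)
    fix x :: "real^'n"
    have "(\<forall>i. l $ i < x $ unord i \<and> x $ unord i < u $ i) \<longleftrightarrow> (\<forall>i. l $ ord i < x $ i \<and> x $ i < u $ ord i)"
      by (metis UNIV_I ord_inverse unord_inverse)
    then show "x \<in> to_ord -` box l u \<longleftrightarrow> x \<in> box (of_ord l) (of_ord u)"
      by (simp add: mem_box_cart to_ord_def of_ord_def)
  qed
  then have "emeasure (distr lborel borel to_ord) (box l u) = emeasure lborel (box (of_ord l) (of_ord u))"
    by (simp add: emeasure_distr)
  also have "\<dots> = (\<Prod>b\<in>Basis. (of_ord u - of_ord l) \<bullet> b)"
    by (rule emeasure_lborel_box) (auto simp: Basis_vec_def inner_axis of_ord_def le)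
  also have "\<dots> = (\<Prod>i\<in>UNIV. (u - l) $ ord i)"
    by (simp add: prod_Basis_cart of_ord_def)
  also have "\<dots> = (\<Prod>b\<in>Basis. (u - l) \<bullet> b)"
    using prod.reindex_bij_betw[OF bij_ord, of "\<lambda>i. (u - l) $ i"] by (simp add: prod_Basis_cart)
  finally show "emeasure (distr lborel borel to_ord) (box l u) = (\<Prod>b\<in>Basis. (u - l) \<bullet> b)" .
qed simp

lemma linear_borel_measurable: "linear f \<Longrightarrow> (f :: 'a::euclidean_space \<Rightarrow> 'b::euclidean_space) \<in> borel_measurable borel"
  by (intro borel_measurable_continuous_onI linear_continuous_on) (simp add: linear_conv_bounded_linear)

lemma lborel_distr_of_ord: "distr lborel borel of_ord = (lborel :: (real^'n) measure)"
proof -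
  have "distr lborel borel of_ord = distr (distr lborel borel to_ord) borel (of_ord :: _ \<Rightarrow> real^'n)"
    by (simp add: lborel_distr_to_ord)
  also have "\<dots> = distr lborel borel (of_ord \<circ> to_ord)"
    by (intro distr_distr) (simp_all add: linear_borel_measurable linear_to_ord linear_of_ord)
  also have "\<dots> = lborel"
    by (simp add: o_def distr_id2)
  finally show ?thesis .
qed

text \<open>The preimage of a box is its image under the inverse map, whose determinant is again of
  absolute value 1.\<close>

lemma lborel_distr_unimodular_wellorder:
  fixes f :: "real^'n::{finite,wellorder} \<Rightarrow> real^'n::_"
  assumes f: "linear f" and det: "\<bar>det (matrix f)\<bar> = 1"
  shows "distr lborel borel f = lborel"
proof (rule lborel_eqI[symmetric])
  fix l u :: "(real, 'n) vec"
  assume le: "\<And>b. b \<in> Basis \<Longrightarrow> l \<bullet> b \<le> u \<bullet> b"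
  have bij: "bij f"
    using det_nz_iff_inj[OF f] det linear_injective_imp_surjective[OF f] by (auto simp: bij_def)
  define h where "h = inv f"
  have h: "linear h" using bij f by (simp add: h_def bij_def inj_linear_imp_inv_linear)
  have "matrix f ** matrix h = mat 1"
  proof -
    have "f \<circ> h = (\<lambda>x. x)" using bij by (simp add: fun_eq_iff h_def bij_is_surj surj_f_inv_f)
    then have "matrix f ** matrix h = matrix (\<lambda>x :: (real, 'n) vec. x)"
      using matrix_compose[OF h f] by simp
    also have "\<dots> = mat 1" by (auto simp: matrix_def mat_def axis_def vec_eq_iff)
    finally show ?thesis .
  qed
  then have "det (matrix f) * det (matrix h) = 1" by (metis det_I det_mul)
  then have deth: "\<bar>det (matrix h)\<bar> = 1" using det by (metis abs_1 abs_mult mult_1)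
  have [measurable]: "f \<in> borel_measurable borel" by (rule linear_borel_measurable[OF f])
  have eq: "f -` box l u = h ` box l u"
    unfolding h_def by (rule bij_vimage_eq_inv_image[OF bij])
  have lm: "box l u \<in> lmeasurable" by simp
  \<comment> \<open>The scaling formula is about \<open>lebesgue\<close>; as a preimage under a
    continuous map the set is Borel, so \<open>lborel\<close> gives it the same measure.\<close>
  have bor: "h ` box l u \<in> sets borel" 
    unfolding eq[symmetric] using measurable_sets[OF linear_borel_measurable[OF f], of "box l u"] by simp
  have "emeasure (distr lborel borel f) (box l u) = emeasure lebesgue (h ` box l u)"
    using bor by (simp add: emeasure_distr eq emeasure_completion)
  also have "\<dots> = ennreal (measure lebesgue (h ` box l u))"
    by (rule emeasure_eq_ennreal_measure[OF fmeasurableD2[OF measurable_linear_image[OF h lm]]])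
  also have "\<dots> = ennreal (measure lborel (box l u))"
    by (simp add: measure_linear_image[OF h lm] deth)
  also have "\<dots> = (\<Prod>b\<in>Basis. (u - l) \<bullet> b)"
    using le by (subst emeasure_eq_ennreal_measure[symmetric]) auto
  finally show "emeasure (distr lborel borel f) (box l u) = (\<Prod>b\<in>Basis. (u - l) \<bullet> b)" .
qed simp

lemma det_reindex_ordered:
  fixes A :: "real^'n^'n"
  shows "det (\<chi> i j. A $ unord i $ unord j) = det A"
  unfolding det_def vec_lambda_beta
  by (rule leibniz_reindex[OF _ bij_unord, symmetric, of "\<lambda>i j. A $ i $ j"]) simp

text \<open>Conjugation by the relabelling of coordinates; a simultaneous relabelling of rows and
  columns leaves the determinant unchanged.\<close>

theorem lborel_distr_unimodular:
  fixes f :: "real^'n \<Rightarrow> real^'n"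
  assumes f: "linear f" and det: "\<bar>det (matrix f)\<bar> = 1"
  shows "distr lborel borel f = lborel"
proof -
  define h where "h = to_ord \<circ> f \<circ> of_ord"
  have h: "linear h"
    unfolding h_def by (intro linear_compose f linear_to_ord linear_of_ord)
  have "matrix h = (\<chi> i j. matrix f $ unord i $ unord j)"
  proof -
    have "of_ord (axis j 1) = (axis (unord j) 1 :: real^'n)" for j
      by (auto simp: of_ord_def axis_def vec_eq_iff unord_inverse ord_inverse)
    then show ?thesis unfolding matrix_def h_def to_ord_def by simp
  qed
  then have "distr lborel borel h = lborel"
    using det by (intro lborel_distr_unimodular_wellorder h) (simp add: det_reindex_ordered)
  moreover have "f = of_ord \<circ> (h \<circ> to_ord)" by (simp add: h_def fun_eq_iff)
  moreover have "distr lborel borel (of_ord \<circ> (h \<circ> to_ord)) = distr (distr (distr lborel borel to_ord) borel h) borel of_ord"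
  proof -
    have m: "h \<in> borel_measurable borel" "to_ord \<in> borel_measurable lborel"
      "of_ord \<in> borel_measurable borel"
      using h by (simp_all add: linear_borel_measurable linear_to_ord linear_of_ord)
    show ?thesis
      unfolding distr_distr[OF m(1,2)] by (rule distr_distr[symmetric, OF m(3)]) (use m in measurable)
  qed
  ultimately show ?thesis
    by (simp add: lborel_distr_to_ord lborel_distr_of_ord)
qed

section \<open>The action of the integral special linear group\<close>

text \<open>\<open>J\<close> is the adjugate matrix, read off from Cramer's rule: its entries are
  determinants of M with one column replaced by a unit vector, hence integers. For determinant 1 it
  is the inverse within \<open>SL_int\<close>.\<close>

lemma integer_adjugate:
  fixes M :: "real^'n^'n"
  assumes int: "\<And>i j. M $ i $ j \<in> \<int>" and det: "det M \<noteq> 0"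
  obtains J :: "real^'n^'n" where "\<And>i j. J $ i $ j \<in> \<int>" "M ** J = mat (det M)" "J ** M = mat (det M)"
proof -
  define J where "J = (\<chi> k l. det (\<chi> i j. if j = k then axis l 1 $ i else M $ i $ j) :: real^'n^'n)"
  define Q where "Q = (\<chi> k l. J $ k $ l / det M)"
  have "M *v (\<chi> k. Q $ k $ l) = axis l 1" for l
    using cramer[OF det, of "\<chi> k. Q $ k $ l" "axis l 1"] by (simp add: J_def Q_def)
  then have "(M *v (\<chi> k. Q $ k $ l)) $ i = axis l 1 $ i" for i l by simp
  then have MQ: "M ** Q = mat 1"
    by (simp add: vec_eq_iff matrix_matrix_mult_def matrix_vector_mult_def mat_def axis_def)
  then have QM: "Q ** M = mat 1" by (simp add: matrix_left_right_inverse)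
  have J: "J $ k $ l = det M * Q $ k $ l" for k l using det by (simp add: Q_def)
  have "(M ** J) $ i $ j = det M * (M ** Q) $ i $ j" "(J ** M) $ i $ j = det M * (Q ** M) $ i $ j" for i j
    by (simp_all add: matrix_matrix_mult_def J sum_distrib_left mult_ac)
  then have MJ: "M ** J = mat (det M)" and JM: "J ** M = mat (det M)"
    by (simp_all add: vec_eq_iff MQ QM mat_def)
  have "J $ k $ l \<in> \<int>" for k l
    unfolding J_def by (auto intro!: det_in_Ints simp: int axis_def)
  then show thesis using MJ JM by (rule that)
qed

lemma SL_int_mult: "\<gamma> \<in> SL_int \<Longrightarrow> \<delta> \<in> SL_int \<Longrightarrow> \<gamma> ** \<delta> \<in> SL_int"
  unfolding SL_int_def SL_real_def
  by (auto simp: det_mul) (auto simp: matrix_matrix_mult_def intro!: Ints_sum Ints_mult)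

lemma SL_int_one: "mat 1 \<in> SL_int"
  unfolding SL_int_def SL_real_def by auto (auto simp: mat_def)

lemma SL_int_inverse:
  assumes "\<gamma> \<in> SL_int"
  obtains \<delta> where "\<delta> \<in> SL_int" "\<gamma> ** \<delta> = mat 1" "\<delta> ** \<gamma> = mat 1"
proof -
  have g: "\<And>i j. \<gamma> $ i $ j \<in> \<int>" "det \<gamma> = 1" using assms by (auto simp: SL_int_def SL_real_def)
  then obtain J where J: "\<And>i j. J $ i $ j \<in> \<int>" "\<gamma> ** J = mat 1" "J ** \<gamma> = mat 1"
    using integer_adjugate[of \<gamma>] by (metis zero_neq_one)
  have "det J = 1" using J(2) g(2) by (metis det_I det_mul mult_1)
  then show thesis using J by (intro that[of J]) (auto simp: SL_int_def SL_real_def)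
qed

lemma SL_int_subset: "SL_int \<subseteq> SL_real"
  by (auto simp: SL_int_def)

lemma SL_real_mult: "g \<in> SL_real \<Longrightarrow> h \<in> SL_real \<Longrightarrow> g ** h \<in> SL_real"
  by (simp add: SL_real_def det_mul)

lemma countable_SL_int: "countable (SL_int :: (real^'n^'n) set)"
proof -
  have "SL_int \<subseteq> range (\<lambda>f :: 'n \<Rightarrow> 'n \<Rightarrow> int. (\<chi> i j. of_int (f i j)) :: real^'n^'n)"
  proof
    fix A :: "real^'n^'n" assume "A \<in> SL_int"
    then have "\<And>i j. A $ i $ j = of_int \<lfloor>A $ i $ j\<rfloor>" by (auto simp: SL_int_def elim!: Ints_cases)
    then have A: "A = (\<chi> i j. of_int \<lfloor>A $ i $ j\<rfloor>)" by (simp only: vec_eq_iff vec_lambda_beta) blast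
    show "A \<in> range (\<lambda>f :: 'n \<Rightarrow> 'n \<Rightarrow> int. (\<chi> i j. of_int (f i j)) :: real^'n^'n)"
      by (rule image_eqI[where x = "\<lambda>i j. \<lfloor>A $ i $ j\<rfloor>"]) (rule A, rule UNIV_I)
  qed
  then show ?thesis by (rule countable_subset) simp
qed

lemma bounded_bilinear_matrix_mult: "bounded_bilinear ((**) :: real^'n^'n \<Rightarrow> real^'n^'n \<Rightarrow> real^'n^'n)"
  unfolding bilinear_conv_bounded_bilinear[symmetric] bilinear_def
proof (intro conjI allI linearI)
  fix x b1 b2 :: "real^'n^'n" and r
  show "x ** (b1 + b2) = x ** b1 + x ** b2" by (rule matrix_add_ldistrib)
  show "(b1 + b2) ** x = b1 ** x + b2 ** x"
    by (simp add: vec_eq_iff matrix_matrix_mult_def sum.distrib ring_distribs)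
  show "x ** (r *\<^sub>R b1) = r *\<^sub>R (x ** b1)" "(r *\<^sub>R b1) ** x = r *\<^sub>R (b1 ** x)"
    by (simp_all add: vec_eq_iff matrix_matrix_mult_def sum_distrib_left mult_ac)
qed

lemma bounded_bilinear_vector_matrix_mult: "bounded_bilinear ((v*) :: real^'n \<Rightarrow> real^'n^'n \<Rightarrow> real^'n)"
  unfolding bilinear_conv_bounded_bilinear[symmetric] bilinear_def
proof (intro conjI allI linearI)
  fix x y :: "real^'n" and A B :: "real^'n^'n" and r
  show "x v* (A + B) = x v* A + x v* B" "(x + y) v* A = x v* A + y v* A"
    by (simp_all add: vec_eq_iff vector_matrix_mult_def sum.distrib ring_distribs)
  show "x v* (r *\<^sub>R A) = r *\<^sub>R (x v* A)" "(r *\<^sub>R x) v* A = r *\<^sub>R (x v* A)"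
    by (simp_all add: vec_eq_iff vector_matrix_mult_def sum_distrib_left mult_ac)
qed

lemma continuous_on_det: "continuous_on S (det :: real^'n^'n \<Rightarrow> real)"
  unfolding det_def by (intro continuous_intros)

lemma closed_SL_real: "closed (SL_real :: (real^'n^'n) set)"
  using continuous_closed_preimage_constant[OF continuous_on_det closed_UNIV, of 1]
  by (simp add: SL_real_def)

section \<open>Existence of a Borel fundamental domain\<close>

lemma integer_vector_norm_ge_1:
  fixes d :: "real^'n"
  assumes "\<And>i. d $ i \<in> \<int>" "d \<noteq> 0"
  shows "norm d \<ge> 1"
proof -
  obtain i where "d $ i \<noteq> 0" using assms(2) by (auto simp: vec_eq_iff)
  then have "\<bar>d $ i\<bar> \<ge> 1" using assms(1) Ints_nonzero_abs_ge1 by blast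
  then show ?thesis using component_le_norm_cart[of d i] by linarith
qed

text \<open>If \<open>\<gamma>\<close> is not the identity, some row d of
  \<open>\<gamma> - mat 1\<close> is a nonzero integer vector, of norm at least 1. Then
  \<open>d v* h\<close> is a row of \<open>\<gamma> ** h - h\<close>, which is small when both
  matrices are near g, whereas \<open>d v* g\<close> is bounded below by a multiple of |d|.\<close>

lemma SL_int_locally_free:
  fixes g :: "real^'n^'n"
  assumes "g \<in> SL_real"
  obtains e where "e > 0"
    "\<And>\<gamma> h. \<gamma> \<in> SL_int \<Longrightarrow> h \<in> ball g e \<Longrightarrow> \<gamma> ** h \<in> ball g e \<Longrightarrow> \<gamma> = mat 1"
proof -
  interpret B: bounded_bilinear "(v*) :: real^'n \<Rightarrow> real^'n^'n \<Rightarrow> real^'n"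
    by (rule bounded_bilinear_vector_matrix_mult)
  obtain K where K: "K > 0" "\<And>v A. norm ((v :: real^'n) v* (A :: real^'n^'n)) \<le> norm v * norm A * K"
    using B.pos_bounded by metis
  have lin: "linear (\<lambda>v. v v* g)" by (rule bounded_linear.linear[OF B.bounded_linear_left])
  have "inj (\<lambda>v. v v* g)"
  proof -
    obtain h where "g ** h = mat 1"
      using assms invertible_det_nz[of g] by (auto simp: SL_real_def invertible_def)
    then have "(v v* g) v* h = v" for v
      by (simp add: vector_matrix_mul_assoc)
    then show ?thesis by (rule inj_on_inverseI[where g = "\<lambda>w. w v* h"])
  qed
  then obtain c where c: "c > 0" "\<And>v. c * norm v \<le> norm (v v* g)"
    using linear_inj_bounded_below_pos[OF lin] by (metis mult.commute)
  \<comment> \<open>The estimate below gives c |d| \<le> (2 + K) e |d|: the 2 e comes from two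
    points of the ball, the K e |d| from replacing h by g. With this e one has (K + 2) e = c / 2, a
    contradiction.\<close>
  define e where "e = c / (2 * (K + 2))"
  have "(K + 2) * e = c / 2" using K(1) by (simp add: e_def field_simps)
  then have e: "e > 0" "(K + 2) * e < c" using c(1) K(1) by (auto simp: e_def)
  show thesis
  proof (rule that[OF e(1)], rule ccontr)
    fix \<gamma> h :: "real^'n^'n"
    assume \<gamma>: "\<gamma> \<in> SL_int" and h: "h \<in> ball g e" "\<gamma> ** h \<in> ball g e" and ne: "\<gamma> \<noteq> mat 1"
    obtain i where i: "\<gamma> $ i \<noteq> (mat 1 :: real^'n^'n) $ i" using ne by (auto simp: vec_eq_iff)
    define d where "d = \<gamma> $ i - (mat 1 :: real^'n^'n) $ i"
    have d1: "norm d \<ge> 1"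
      using i \<gamma> by (intro integer_vector_norm_ge_1) (auto simp: d_def SL_int_def mat_def)
    have dh: "d v* h = (\<gamma> ** h - h) $ i"
      by (simp add: vec_eq_iff d_def vector_matrix_mult_def matrix_matrix_mult_def mat_def
          algebra_simps sum_subtractf if_distrib[of "\<lambda>u. _ * u"] cong: if_cong)
    have "c * norm d \<le> norm (d v* g)" by (rule c)
    also have "d v* g = d v* h - d v* (h - g)" by (simp add: B.diff_right)
    also have "norm \<dots> \<le> norm (d v* h) + norm (d v* (h - g))" by (rule norm_triangle_ineq4)
    also have "norm (d v* h) \<le> 2 * e"
    proof -
      have "norm (d v* h) \<le> norm (\<gamma> ** h - h)" unfolding dh by (rule Finite_Cartesian_Product.norm_nth_le)
      also have "\<dots> \<le> dist g (\<gamma> ** h) + dist g h" unfolding dist_norm[symmetric] by (rule dist_triangle3)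
      finally show ?thesis using h by simp
    qed
    also have "norm (d v* (h - g)) \<le> norm d * e * K"
    proof -
      have "norm (h - g) \<le> e" using h(1) by (simp add: dist_norm norm_minus_commute)
      then have "norm d * norm (h - g) * K \<le> norm d * e * K" using K(1) by (intro mult_right_mono mult_left_mono) auto
      then show ?thesis using K(2)[of d "h - g"] by linarith
    qed
    also have "2 * e + norm d * e * K \<le> 2 * e * norm d + norm d * e * K" using e d1 by simp
    finally have "c * norm d \<le> ((K + 2) * e) * norm d" by (simp add: algebra_simps)
    then show False using d1 e(2) by (simp add: mult_le_cancel_right)
  qed
qed

lemma continuous_on_matrix_mult_left: "continuous_on S (\<lambda>h. (\<gamma> :: real^'n^'n) ** (h :: real^'n^'n))"
  using bounded_bilinear.continuous_on[OF bounded_bilinear_matrix_mult continuous_on_const continuous_on_id, of S \<gamma>]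
  by simp

text \<open>By Lindelof, countably many balls \<open>U i\<close>, each meeting every orbit in at
  most one point, cover \<open>SL_real\<close>. From each orbit \<open>F\<close> keeps its point in
  the first \<open>U i\<close> that the orbit meets. The action is free there, which makes
  \<open>\<gamma>\<close> unique and not only the point.\<close>

lemma fundamental_domain_exists: "\<exists>F :: (real^'n^'n) set. fundamental_domain F"
proof -
  define Q where "Q g e \<longleftrightarrow> e > 0 \<and> (\<forall>\<gamma> h. \<gamma> \<in> SL_int \<longrightarrow> h \<in> ball g e \<longrightarrow> \<gamma> ** h \<in> ball g e \<longrightarrow> \<gamma> = mat 1)"
    for g :: "real^'n^'n" and e
  have "\<exists>e. Q g e" if "g \<in> SL_real" for g
    by (rule SL_int_locally_free[OF that]) (unfold Q_def, blast)
  then have "\<forall>g\<in>SL_real. \<exists>e. Q g e" by (rule ballI)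
  from bchoice[OF this] obtain e where Qe: "\<forall>g\<in>SL_real. Q g (e g)" ..
  have e: "e g > 0" if "g \<in> SL_real" for g
    using bspec[OF Qe that] by (simp add: Q_def)
  have e_free: "\<gamma> = mat 1"
    if "g \<in> SL_real" "\<gamma> \<in> SL_int" "h \<in> ball g (e g)" "\<gamma> ** h \<in> ball g (e g)" for g \<gamma> h
    using bspec[OF Qe that(1)] that(2-4) unfolding Q_def by (elim conjE allE impE)
  define \<F> where "\<F> = (\<lambda>g :: real^'n^'n. ball g (e g)) ` SL_real"
  obtain \<F>' where \<F>': "\<F>' \<subseteq> \<F>" "countable \<F>'" "\<Union>\<F>' = \<Union>\<F>"
    using Lindelof[of \<F>] by (auto simp: \<F>_def)
  have "mat 1 \<in> (SL_real :: (real^'n^'n) set)" using SL_int_one SL_int_subset by blast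
  then have "mat 1 \<in> \<Union>\<F>" using e unfolding \<F>_def by (intro UnionI[OF imageI]) auto
  then have "\<F>' \<noteq> {}" using \<F>'(3) by auto
  define U where "U = from_nat_into \<F>'"
  have rangeU: "range U = \<F>'" unfolding U_def by (rule range_from_nat_into) fact+
  have U: "\<exists>g\<in>SL_real. U i = ball g (e g)" for i
    using rangeU \<F>'(1) by (auto simp: \<F>_def)
  have openU: "open (U i)" for i using U[of i] by auto
  have cover: "\<exists>i. h \<in> U i" if "h \<in> SL_real" for h
  proof -
    have "h \<in> \<Union>\<F>" using that e unfolding \<F>_def by (intro UnionI[OF imageI]) auto
    then show ?thesis using \<F>'(3) rangeU by auto
  qed
  have free: "\<gamma> = mat 1" if "\<gamma> \<in> SL_int" "h \<in> U i" "\<gamma> ** h \<in> U i" for \<gamma> h i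
  proof -
    obtain g where "g \<in> SL_real" "U i = ball g (e g)" using U[of i] by auto
    then show ?thesis using e_free[of g \<gamma> h] that by simp
  qed
  \<comment> \<open>The part removed from \<open>U i\<close> consists of the points whose orbit
    meets an earlier \<open>U j\<close>. These points form an open set, which keeps \<open>F\<close>
    Borel.\<close>
  define F where "F = SL_real \<inter> (\<Union>i. U i \<inter> (\<Inter>j\<in>{..<i}. \<Inter>\<gamma>\<in>SL_int. - ((\<lambda>h. \<gamma> ** h) -` U j)))"
  have F: "h \<in> F \<longleftrightarrow> h \<in> SL_real \<and> (\<exists>i. h \<in> U i \<and> (\<forall>j<i. \<forall>\<gamma>\<in>SL_int. \<gamma> ** h \<notin> U j))" for h
    by (auto simp: F_def)
  have "F \<in> sets borel"
  proof -
    have "open ((\<lambda>h. \<gamma> ** h) -` U j)" for j and \<gamma> :: "real^'n^'n"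
      by (intro open_vimage openU continuous_on_matrix_mult_left)
    then have G: "(\<Inter>\<gamma>\<in>SL_int. - ((\<lambda>h. \<gamma> ** h) -` U j)) \<in> sets borel" for j
      by (intro borel_closed closed_INT) (auto simp: closed_def)
    have "U i \<inter> (\<Inter>j\<in>{..<i}. \<Inter>\<gamma>\<in>SL_int. - ((\<lambda>h. \<gamma> ** h) -` U j)) \<in> sets borel" for i
    \<comment> \<open>For i = 0 the intersection runs over no j at all and equals
      \<open>UNIV\<close>.\<close>
    proof (cases "i = 0")
      case True
      then show ?thesis using borel_open[OF openU] by simp
    next
      case False
      have "(\<Inter>j\<in>{..<i}. \<Inter>\<gamma>\<in>SL_int. - ((\<lambda>h. \<gamma> ** h) -` U j)) \<in> sets borel"
        by (rule sets.finite_INT) (use False G in auto)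
      then show ?thesis by (rule sets.Int[OF borel_open[OF openU]])
    qed
    then show ?thesis
      unfolding F_def by (intro sets.Int sets.countable_UN borel_closed closed_SL_real) auto
  qed
  moreover have "F \<subseteq> SL_real" by (simp add: F_def)
  moreover have "\<exists>!\<gamma>. \<gamma> \<in> SL_int \<and> \<gamma> ** g \<in> F" if g: "g \<in> SL_real" for g
  proof -
    define P where "P = (\<lambda>i. \<exists>\<gamma>\<in>SL_int. \<gamma> ** g \<in> U i)"
    obtain i where "g \<in> U i" using cover[OF g] ..
    then have "P i" using SL_int_one unfolding P_def by (intro bexI[of _ "mat 1"]) auto
    then have "\<exists>i. P i" ..
    define i0 where "i0 = (LEAST i. P i)"
    have "P i0" using \<open>\<exists>i. P i\<close> unfolding i0_def by (rule LeastI_ex)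
    then obtain \<gamma>0 where \<gamma>0: "\<gamma>0 \<in> SL_int" "\<gamma>0 ** g \<in> U i0" by (auto simp: P_def)
    have min: "i0 \<le> i" if "P i" for i unfolding i0_def using that by (rule Least_le)
    show ?thesis
    proof (rule ex1I[of _ \<gamma>0], intro conjI)
      have "\<delta> ** (\<gamma>0 ** g) \<notin> U j" if "j < i0" "\<delta> \<in> SL_int" for j \<delta>
        using min[of j] that SL_int_mult[OF that(2) \<gamma>0(1)] by (auto simp: P_def matrix_mul_assoc)
      then show "\<gamma>0 ** g \<in> F"
        using \<gamma>0 g SL_int_subset by (auto simp: F intro: SL_real_mult)
    next
      fix \<gamma> assume \<gamma>: "\<gamma> \<in> SL_int \<and> \<gamma> ** g \<in> F"
      then obtain i where i: "\<gamma> ** g \<in> U i" "\<And>j \<delta>. j < i \<Longrightarrow> \<delta> \<in> SL_int \<Longrightarrow> \<delta> ** (\<gamma> ** g) \<notin> U j"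
        by (auto simp: F)
      obtain \<delta> where \<delta>: "\<delta> \<in> SL_int" "\<delta> ** \<gamma> = mat 1" by (rule SL_int_inverse[of \<gamma>]) (use \<gamma> in auto)
      \<comment> \<open>\<open>\<gamma>0 ** \<delta>\<close> moves one point of the orbit in
        \<open>F\<close> to the other; once both are known to lie in the same \<open>U i0\<close>,
        it must be the identity.\<close>
      have eq: "(\<gamma>0 ** \<delta>) ** (\<gamma> ** g) = \<gamma>0 ** g"
      proof -
        have "(\<gamma>0 ** \<delta>) ** (\<gamma> ** g) = \<gamma>0 ** (\<delta> ** \<gamma>) ** g" by (simp only: matrix_mul_assoc)
        then show ?thesis by (simp add: \<delta>(2))
      qed
      have in_SL: "\<gamma>0 ** \<delta> \<in> SL_int" using \<gamma>0 \<delta> by (simp add: SL_int_mult)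
      have "i0 \<le> i" using i(1) \<gamma> by (intro min) (auto simp: P_def)
      moreover have "\<not> i0 < i" using i(2)[of i0, OF _ in_SL] \<gamma>0(2) eq by auto
      ultimately have "i = i0" by simp
      then have "\<gamma>0 ** \<delta> = mat 1" using free[OF in_SL, of "\<gamma> ** g" i0] i(1) \<gamma>0(2) eq by simp
      then have "\<gamma> = (\<gamma>0 ** \<delta>) ** \<gamma>" by simp
      also have "\<dots> = \<gamma>0 ** (\<delta> ** \<gamma>)" by (simp only: matrix_mul_assoc)
      finally show "\<gamma> = \<gamma>0" by (simp add: \<delta>(2))
    qed (use \<gamma>0 in auto)
  qed
  ultimately have "fundamental_domain F" unfolding fundamental_domain_def by (intro conjI ballI)
  then show ?thesis ..
qed


section \<open>Haar measure and translates of compact sets\<close>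

lemma sets_haar_iff:
  fixes H :: "(real^'n^'n) measure"
  assumes "haar_measure_SL H"
  shows "A \<in> sets H \<longleftrightarrow> A \<subseteq> SL_real \<and> A \<in> sets borel"
proof -
  have "sets H = sets (restrict_space borel SL_real)" using assms by (simp add: haar_measure_SL_def)
  then show ?thesis
    using sets_restrict_space_iff[of SL_real borel A] borel_closed[OF closed_SL_real] by simp
qed

text \<open>\<open>S\<close> is cut along the translates of \<open>K\<close>, and each piece is
  moved back into \<open>K\<close> by left invariance. The pieces \<open>B i\<close> obtained inside
  \<open>K\<close> are disjoint because an orbit meets \<open>F\<close> for a single group element
  only, so their total measure is at most that of \<open>K\<close>.\<close>

lemma haar_finite_translates:
  fixes H :: "(real^'n^'n) measure"
  assumes H: "haar_measure_SL H" and F: "fundamental_domain F"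
    and S: "S \<subseteq> F" "S \<in> sets H" and K: "compact K" "K \<subseteq> SL_real"
  shows "emeasure H (S \<inter> (\<Union>\<gamma>\<in>SL_int. (\<lambda>h. \<gamma> ** h) ` K)) < \<infinity>"
proof -
  have inv: "\<And>g A. g \<in> SL_real \<Longrightarrow> A \<in> sets H \<Longrightarrow> emeasure H ((\<lambda>h. g ** h) ` A) = emeasure H A"
    and fin: "\<And>K. compact K \<Longrightarrow> K \<subseteq> SL_real \<Longrightarrow> emeasure H K < \<infinity>"
    using H by (auto simp: haar_measure_SL_def)
  note inH = sets_haar_iff[OF H]
  \<comment> \<open>When \<open>SL_int\<close> is finite, \<open>from_nat_into\<close> repeats
    elements. Only indices in \<open>N\<close>, where the enumeration is injective, get a nonempty
    piece.\<close>
  define N where "N = to_nat_on (SL_int :: (real^'n^'n) set) ` SL_int"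
  define e where "e = from_nat_into (SL_int :: (real^'n^'n) set)"
  have e: "e i \<in> SL_int" for i
    unfolding e_def using SL_int_one by (intro from_nat_into) auto
  have e_surj: "\<exists>i\<in>N. e i = \<gamma>" if "\<gamma> \<in> SL_int" for \<gamma>
    using that from_nat_into_to_nat_on[OF countable_SL_int that] by (auto simp: N_def e_def)
  have e_inj: "i = j" if "i \<in> N" "j \<in> N" "e i = e j" for i j
    using that unfolding N_def e_def
    by (elim imageE) (simp add: from_nat_into_to_nat_on[OF countable_SL_int])
  define B where "B i = (if i \<in> N then {k \<in> K. e i ** k \<in> S} else {})" for i
  have Bsets: "B i \<in> sets H" for i
  proof -
    have "{k \<in> K. e i ** k \<in> S} = K \<inter> (\<lambda>k. e i ** k) -` S" by blast
    moreover have "(\<lambda>k. e i ** k) -` S \<in> sets borel"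
    proof -
      have "(\<lambda>k :: real^'n^'n. e i ** k) \<in> borel_measurable borel"
        by (intro borel_measurable_continuous_onI continuous_on_matrix_mult_left)
      from measurable_sets[OF this, of S] show ?thesis using S(2) by (simp add: inH)
    qed
    moreover have "K \<in> sets borel" by (rule borel_closed[OF compact_imp_closed[OF K(1)]])
    ultimately have "{k \<in> K. e i ** k \<in> S} \<in> sets borel" by simp
    then show ?thesis using K(2) by (auto simp: B_def inH)
  qed
  define A where "A i = (\<lambda>h. e i ** h) ` B i" for i
  have Asets: "A i \<in> sets H" for i
  proof (cases "i \<in> N")
    case True
    have "compact ((\<lambda>h. e i ** h) ` K)"
      by (rule compact_continuous_image[OF continuous_on_matrix_mult_left K(1)])
    then have "(\<lambda>h. e i ** h) ` K \<in> sets borel"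
      by (rule borel_closed[OF compact_imp_closed])
    then have "S \<inter> (\<lambda>h. e i ** h) ` K \<in> sets borel"
      using S(2) inH by blast
    moreover have "A i = S \<inter> (\<lambda>h. e i ** h) ` K" using True by (auto simp: A_def B_def)
    ultimately show ?thesis using S(2) by (auto simp: inH)
  qed (auto simp: A_def B_def)
  have "disjoint_family B"
    unfolding disjoint_family_on_def
  proof (intro ballI impI, rule ccontr)
    fix i j assume "i \<noteq> j" "B i \<inter> B j \<noteq> {}"
    then obtain k where k: "i \<in> N" "j \<in> N" "k \<in> K" "e i ** k \<in> F" "e j ** k \<in> F"
      using S(1) unfolding B_def by (auto split: if_splits)
    have "\<exists>!\<gamma>. \<gamma> \<in> SL_int \<and> \<gamma> ** k \<in> F"
      using F unfolding fundamental_domain_def by (elim conjE bspec) (rule subsetD[OF K(2) k(3)])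
    then obtain \<gamma> where "\<forall>\<delta>. \<delta> \<in> SL_int \<and> \<delta> ** k \<in> F \<longrightarrow> \<delta> = \<gamma>" by (rule ex1E)
    from this[rule_format, of "e i"] this[rule_format, of "e j"] have "e i = e j" using k(4,5) e by simp
    then show False using e_inj k \<open>i \<noteq> j\<close> by blast
  qed
  have "S \<inter> (\<Union>\<gamma>\<in>SL_int. (\<lambda>h. \<gamma> ** h) ` K) \<subseteq> (\<Union>i. A i)"
  proof
    fix x assume "x \<in> S \<inter> (\<Union>\<gamma>\<in>SL_int. (\<lambda>h. \<gamma> ** h) ` K)"
    then obtain \<gamma> k where "\<gamma> \<in> SL_int" "k \<in> K" "x = \<gamma> ** k" "x \<in> S" by auto
    moreover from this e_surj obtain i where "i \<in> N" "e i = \<gamma>" by blast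
    ultimately show "x \<in> (\<Union>i. A i)" by (auto simp: A_def B_def)
  qed
  then have "emeasure H (S \<inter> (\<Union>\<gamma>\<in>SL_int. (\<lambda>h. \<gamma> ** h) ` K)) \<le> emeasure H (\<Union>i. A i)"
    by (rule emeasure_mono) (use Asets in auto)
  also have "\<dots> \<le> (\<Sum>i. emeasure H (A i))"
    by (rule emeasure_subadditive_countably) (use Asets in auto)
  also have "\<dots> = (\<Sum>i. emeasure H (B i))"
    unfolding A_def using inv[OF subsetD[OF SL_int_subset e] Bsets] by simp
  also have "\<dots> = emeasure H (\<Union>i. B i)"
    by (rule suminf_emeasure) (use Bsets \<open>disjoint_family B\<close> in auto)
  also have "\<dots> \<le> emeasure H K"
  proof (rule emeasure_mono)
    show "(\<Union>i. B i) \<subseteq> K" by (auto simp: B_def split: if_splits)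
    show "K \<in> sets H" using K(2) borel_closed[OF compact_imp_closed[OF K(1)]] by (simp add: inH)
  qed
  also have "\<dots> < \<infinity>" by (rule fin[OF K])
  finally show ?thesis .
qed

section \<open>Short lattice vectors and compactness\<close>

lemma lborel_distr_vector_matrix_mult:
  fixes g :: "real^'n^'n"
  assumes "g \<in> SL_real"
  shows "distr lborel borel (\<lambda>v. v v* g) = lborel"
proof (rule lborel_distr_unimodular)
  show "linear (\<lambda>v. v v* g)"
    using bounded_bilinear.bounded_linear_left[OF bounded_bilinear_vector_matrix_mult]
    by (rule bounded_linear.linear)
  have "(\<lambda>v. v v* g) = (*v) (transpose g)" by (simp add: fun_eq_iff)
  then show "\<bar>det (matrix (\<lambda>v. v v* g))\<bar> = 1"
    using assms by (simp add: SL_real_def matrix_of_matrix_vector_mul)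
qed

text \<open>The disjoint balls of radius 1/2 all fit into a box that has thickness 1 in direction k
  and width 2 R + 1 in the other directions; this saves one power of R over the general packing
  bound.\<close>

lemma coplanar_separated_card_le_axis:
  fixes X :: "(real^'n) set"
  assumes X: "finite X" "X \<subseteq> cball 0 R" and R: "R \<ge> 0"
    and sep: "\<And>x y. x \<in> X \<Longrightarrow> y \<in> X \<Longrightarrow> x \<noteq> y \<Longrightarrow> dist x y \<ge> 1"
    and t: "\<And>x. x \<in> X \<Longrightarrow> x $ k = t"
  shows "real (card X) * measure lborel (ball (0 :: real^'n) (1/2)) \<le> (2 * R + 1) ^ (CARD('n) - 1)"
proof -
  have disj: "disjoint_family_on (\<lambda>x. ball x (1/2)) X"
    unfolding disjoint_family_on_def
  proof (intro ballI impI)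
    fix x y assume xy: "x \<in> X" "y \<in> X" "x \<noteq> y"
    show "ball x (1/2) \<inter> ball y (1/2) = {}"
      using sep[OF xy] disjoint_ballI[of "1/2" "1/2" x y] by simp
  qed
  define a b :: "real^'n" where "a = (\<chi> i. if i = k then t - 1/2 else - (R + 1/2))"
    and "b = (\<chi> i. if i = k then t + 1/2 else R + 1/2)"
  have "real (card X) * measure lborel (ball (0 :: real^'n) (1/2)) = (\<Sum>x\<in>X. measure lborel (ball x (1/2)))"
    by (simp add: content_ball)
  also have "\<dots> = measure lborel (\<Union>x\<in>X. ball x (1/2))"
    by (intro measure_finite_Union[symmetric] X(1) disj) (auto simp: emeasure_ball)
  also have "\<dots> \<le> measure lborel (cbox a b)"
  proof (rule measure_mono_fmeasurable)
    show "(\<Union>x\<in>X. ball x (1/2)) \<subseteq> cbox a b"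
    proof (intro subsetI, elim UN_E)
      fix x y assume x: "x \<in> X" and "y \<in> ball x (1/2)"
      then have y: "norm (y - x) < 1/2" by (simp add: dist_norm norm_minus_commute)
      have "norm x \<le> R" using x X(2) by auto
      have "\<bar>y $ i - x $ i\<bar> \<le> 1/2" "\<bar>x $ i\<bar> \<le> R" for i
        using component_le_norm_cart[of "y - x" i] component_le_norm_cart[of x i] y \<open>norm x \<le> R\<close> by auto
      then have *: "x $ i - 1/2 \<le> y $ i" "y $ i \<le> x $ i + 1/2" "- R \<le> x $ i" "x $ i \<le> R" for i
        by (smt (verit))+
      have "a $ i \<le> y $ i \<and> y $ i \<le> b $ i" for i
        using *[of i] t[OF x] by (cases "i = k") (auto simp: a_def b_def)
      then show "y \<in> cbox a b" by (simp add: mem_box_cart)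
    qed
    show "(\<Union>x\<in>X. ball x (1/2)) \<in> sets lborel" by (simp add: open_UN)
    show "cbox a b \<in> fmeasurable lborel" by simp
  qed
  also have "\<dots> = (\<Prod>i\<in>UNIV. b $ i - a $ i)"
  proof (rule content_cbox_cart)
    have "a $ i \<le> b $ i" for i using R by (simp add: a_def b_def)
    then show "cbox a b \<noteq> {}" by (simp add: interval_ne_empty_cart)
  qed
  also have "\<dots> = (b $ k - a $ k) * (\<Prod>i\<in>UNIV - {k}. b $ i - a $ i)"
    by (rule prod.remove) auto
  also have "(\<Prod>i\<in>UNIV - {k}. b $ i - a $ i) = (\<Prod>i\<in>UNIV - {k}. 2 * R + 1)"
    by (rule prod.cong) (auto simp: a_def b_def)
  also have "\<dots> = (2 * R + 1) ^ (CARD('n) - 1)" by simp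
  also have "b $ k - a $ k = 1" by (simp add: a_def b_def)
  finally show ?thesis by simp
qed

text \<open>An isometry that takes the unit normal to a coordinate axis reduces to the axis-parallel
  case.\<close>

lemma coplanar_separated_card_le:
  fixes X :: "(real^'n) set"
  assumes X: "finite X" "X \<subseteq> cball 0 R" and R: "R \<ge> 0"
    and sep: "\<And>x y. x \<in> X \<Longrightarrow> y \<in> X \<Longrightarrow> x \<noteq> y \<Longrightarrow> dist x y \<ge> 1"
    and u: "u \<noteq> 0" "\<And>x y. x \<in> X \<Longrightarrow> y \<in> X \<Longrightarrow> u \<bullet> (x - y) = 0"
  shows "real (card X) * measure lborel (ball (0 :: real^'n) (1/2)) \<le> (2 * R + 1) ^ (CARD('n) - 1)"
proof (cases "X = {}")
  case True
  then show ?thesis using R by simp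
next
  case False
  then obtain x0 where x0: "x0 \<in> X" by auto
  obtain k :: 'n where True by simp
  define w where "w = (1 / norm u) *\<^sub>R u"
  have w: "norm w = 1" using u(1) by (simp add: w_def)
  obtain f :: "real^'n \<Rightarrow> real^'n" where f: "orthogonal_transformation f" "f w = axis k 1"
    by (rule orthogonal_transformation_exists_1[OF w norm_axis_1])
  have lin: "linear f" and inj: "inj f" and nrm: "\<And>x. norm (f x) = norm x" and inn: "\<And>x y. f x \<bullet> f y = x \<bullet> y"
    using f(1) orthogonal_transformation_inj orthogonal_transformation_norm
    by (auto simp: orthogonal_transformation_def)
  have "real (card (f ` X)) * measure lborel (ball (0 :: real^'n) (1/2)) \<le> (2 * R + 1) ^ (CARD('n) - 1)"
  proof (rule coplanar_separated_card_le_axis)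
    show "finite (f ` X)" using X by simp
    show "f ` X \<subseteq> cball 0 R" using X(2) by (auto simp: nrm)
    show "dist x y \<ge> 1" if "x \<in> f ` X" "y \<in> f ` X" "x \<noteq> y" for x y
    proof -
      obtain x' y' where xy: "x' \<in> X" "x = f x'" "y' \<in> X" "y = f y'" using \<open>x \<in> f ` X\<close> \<open>y \<in> f ` X\<close> by blast
      then have "dist x y = dist x' y'" by (simp add: dist_norm nrm flip: linear_diff[OF lin])
      then show ?thesis using sep[of x' y'] xy \<open>x \<noteq> y\<close> by auto
    qed
    show "y $ k = w \<bullet> x0" if y: "y \<in> f ` X" for y
    proof -
      obtain x where x: "x \<in> X" "y = f x" using y by blast
      have "y $ k = f w \<bullet> f x" by (simp add: f(2) x(2) inner_axis')
      also have "\<dots> = w \<bullet> x0 + w \<bullet> (x - x0)" unfolding inn by (simp add: inner_diff_right)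
      also have "w \<bullet> (x - x0) = 0" using u(2)[OF x(1) x0] by (simp add: w_def)
      finally show ?thesis by simp
    qed
  qed (fact R)
  moreover have "card (f ` X) = card X" using inj by (intro card_image inj_on_subset[OF inj]) auto
  ultimately show ?thesis by simp
qed

definition int_vecs :: "(real^'n) set" where
  "int_vecs = {v. \<forall>i. v $ i \<in> \<int>}"

lemma countable_int_vecs: "countable (int_vecs :: (real^'n) set)"
proof -
  have "int_vecs \<subseteq> range (\<lambda>f :: 'n \<Rightarrow> int. (\<chi> i. of_int (f i)) :: real^'n)"
  proof
    fix v :: "real^'n" assume "v \<in> int_vecs"
    then have "\<And>i. v $ i = of_int \<lfloor>v $ i\<rfloor>" by (auto simp: int_vecs_def elim!: Ints_cases)
    then have v: "v = (\<chi> i. of_int \<lfloor>v $ i\<rfloor>)" by (simp only: vec_eq_iff vec_lambda_beta) blast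
    show "v \<in> range (\<lambda>f :: 'n \<Rightarrow> int. (\<chi> i. of_int (f i)) :: real^'n)"
      by (rule image_eqI[where x = "\<lambda>i. \<lfloor>v $ i\<rfloor>"]) (rule v, rule UNIV_I)
  qed
  then show ?thesis by (rule countable_subset) simp
qed

lemma row_lattice_eq_image: "row_lattice g = (\<lambda>v. v v* g) ` int_vecs"
  by (auto simp: row_lattice_def int_vecs_def)

lemma row_lattice_diff:
  fixes g :: "real^'n^'n"
  assumes "x \<in> row_lattice g" "y \<in> row_lattice g"
  shows "x - y \<in> row_lattice g"
proof -
  have lin: "linear (\<lambda>v. v v* g)"
    using bounded_bilinear.bounded_linear_left[OF bounded_bilinear_vector_matrix_mult]
    by (rule bounded_linear.linear)
  obtain v w where "v \<in> int_vecs" "w \<in> int_vecs" "x = v v* g" "y = w v* g"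
    using assms by (auto simp: row_lattice_eq_image)
  then have "x - y = (v - w) v* g" "v - w \<in> int_vecs"
    by (simp_all add: linear_diff[OF lin] int_vecs_def)
  then show ?thesis by (auto simp: row_lattice_eq_image)
qed

lemma inj_vector_matrix_mult:
  fixes g :: "real^'n^'n"
  assumes "det g \<noteq> 0"
  shows "inj (\<lambda>v. v v* g)"
proof -
  obtain h where "g ** h = mat 1"
    using assms invertible_det_nz[of g] by (auto simp: invertible_def)
  then have "(v v* g) v* h = v" for v
    by (simp add: vector_matrix_mul_assoc)
  then show ?thesis by (rule inj_on_inverseI[where g = "\<lambda>w. w v* h"])
qed

text \<open>Blichfeldt's argument: average the number of points of a translate of the lattice in \<open>A\<close>
  over the unit cube.\<close>

lemma blichfeldt:
  fixes g :: "real^'n^'n" and N :: nat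
  assumes g: "g \<in> SL_real" and A: "A \<in> sets borel"
    and N: "\<And>X x. finite X \<Longrightarrow> X \<subseteq> A \<Longrightarrow> (\<And>y. y \<in> X \<Longrightarrow> y - x \<in> row_lattice g) \<Longrightarrow> card X \<le> N"
  shows "emeasure lborel A \<le> of_nat N"
proof -
  let ?f = "\<lambda>v :: real^'n. v v* g"
  have lin: "linear ?f"
    using bounded_bilinear.bounded_linear_left[OF bounded_bilinear_vector_matrix_mult]
    by (rule bounded_linear.linear)
  have [measurable]: "?f \<in> borel_measurable borel" by (rule linear_borel_measurable[OF lin])
  \<comment> \<open>In the coordinates given by the rows of g the lattice becomes
    \<open>int_vecs\<close>, and volume is preserved since det g = 1.\<close>
  define B where "B = ?f -` A"
  have [measurable]: "B \<in> sets borel"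
    using measurable_sets[OF linear_borel_measurable[OF lin] A] by (simp add: B_def)
  \<comment> \<open>Subtracting the floor of every coordinate moves any v into this cube, so its
    integer translates cover the space.\<close>
  define Q :: "(real^'n) set" where "Q = {v. \<forall>i. 0 \<le> v $ i \<and> v $ i < 1}"
  have [measurable]: "Q \<in> sets borel" unfolding Q_def by measurable
  have "emeasure lborel Q \<le> emeasure lborel (cbox (\<chi> i. 0) (\<chi> i. 1) :: (real^'n) set)"
    by (rule emeasure_mono) (auto simp: Q_def mem_box_cart less_imp_le)
  also have "\<dots> = ennreal (measure lborel (cbox (\<chi> i. 0) (\<chi> i. 1) :: (real^'n) set))"
    using emeasure_lborel_cbox_finite[of "(\<chi> i. 0) :: real^'n" "\<chi> i. 1"]
    by (intro emeasure_eq_ennreal_measure) (simp add: less_top)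
  also have "measure lborel (cbox (\<chi> i. 0) (\<chi> i. 1) :: (real^'n) set) = 1"
    by (subst content_cbox_cart) (auto simp: interval_ne_empty_cart)
  finally have Q1: "emeasure lborel Q \<le> 1" by simp
  let ?Z = "count_space (int_vecs :: (real^'n) set)"
  have "emeasure lborel A = emeasure (distr lborel borel ?f) A"
    by (simp add: lborel_distr_vector_matrix_mult[OF g])
  also have "\<dots> = emeasure lborel B"
    using A by (simp add: emeasure_distr B_def)
  also have "\<dots> = (\<integral>\<^sup>+v. indicator B v \<partial>lborel)" by simp
  also have "\<dots> \<le> (\<integral>\<^sup>+v. (\<integral>\<^sup>+z. indicator B v * indicator Q (v - z) \<partial>?Z) \<partial>lborel)"
  proof (rule nn_integral_mono)
    fix v :: "real^'n"
    define z where "z = ((\<chi> i. of_int \<lfloor>v $ i\<rfloor>) :: real^'n)"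
    have z: "z \<in> int_vecs" by (simp add: z_def int_vecs_def)
    have "v - z \<in> Q"
      unfolding Q_def z_def by (simp, linarith)
    then have "indicator B v = (indicator B v * indicator Q (v - z) :: ennreal)" by simp
    also have "\<dots> \<le> (\<integral>\<^sup>+z. indicator B v * indicator Q (v - z) \<partial>?Z)"
      using z by (rule nn_integral_ge_point)
    finally show "indicator B v \<le> (\<integral>\<^sup>+z. indicator B v * indicator Q (v - z) \<partial>?Z)" .
  qed
  also have "\<dots> = (\<integral>\<^sup>+z. (\<integral>\<^sup>+v. indicator B v * indicator Q (v - z) \<partial>lborel) \<partial>?Z)"
    by (rule nn_integral_count_space_nn_integral[OF countable_int_vecs]) measurable
  also have "\<dots> = (\<integral>\<^sup>+z. (\<integral>\<^sup>+v. indicator B (z + v) * indicator Q v \<partial>lborel) \<partial>?Z)"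
  proof (rule nn_integral_cong)
    fix z :: "real^'n"
    have "(\<integral>\<^sup>+v. indicator B v * indicator Q (v - z) \<partial>lborel)
        = (\<integral>\<^sup>+v. indicator B v * indicator Q (v - z) \<partial>distr lborel borel ((+) z))"
      by (simp only: lborel_distr_plus)
    also have "\<dots> = (\<integral>\<^sup>+v. indicator B (z + v) * indicator Q v \<partial>lborel)"
      by (subst nn_integral_distr) simp_all
    finally show "(\<integral>\<^sup>+v. indicator B v * indicator Q (v - z) \<partial>lborel)
        = (\<integral>\<^sup>+v. indicator B (z + v) * indicator Q v \<partial>lborel)" .
  qed
  also have "\<dots> = (\<integral>\<^sup>+v. (\<integral>\<^sup>+z. indicator B (z + v) * indicator Q v \<partial>?Z) \<partial>lborel)"
    by (rule nn_integral_count_space_nn_integral[OF countable_int_vecs, symmetric]) measurable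
  also have "\<dots> \<le> (\<integral>\<^sup>+v. of_nat N * indicator Q v \<partial>lborel)"
  proof (rule nn_integral_mono)
    fix v :: "real^'n"
    \<comment> \<open>The integer translates of v that land in \<open>B\<close> map injectively to
      points of \<open>A\<close> lying in one coset of the lattice, so the hypothesis bounds their
      number by N.\<close>
    define W where "W = {z \<in> int_vecs. z + v \<in> B}"
    have cardW: "card Y \<le> N" if Y: "finite Y" "Y \<subseteq> W" for Y
    proof -
      have inj: "inj_on (\<lambda>z. ?f (z + v)) Y"
      proof (rule inj_onI)
        fix x y assume "?f (x + v) = ?f (y + v)"
        then have "x + v = y + v"
          by (rule injD[OF inj_vector_matrix_mult, rotated]) (use g in \<open>simp add: SL_real_def\<close>)
        then show "x = y" by simp
      qed
      have "card ((\<lambda>z. ?f (z + v)) ` Y) \<le> N"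
      proof (rule N[where x = "?f v"])
        show "(\<lambda>z. ?f (z + v)) ` Y \<subseteq> A" using Y(2) by (auto simp: W_def B_def)
        show "y - ?f v \<in> row_lattice g" if "y \<in> (\<lambda>z. ?f (z + v)) ` Y" for y
          using that Y(2) by (auto simp: row_lattice_eq_image W_def linear_add[OF lin])
      qed (use Y in simp)
      then show ?thesis by (simp add: card_image[OF inj])
    qed
    have finW: "finite W \<and> card W \<le> N"
      by (rule finite_if_finite_subsets_card_bdd) (use cardW in blast)
    have "(\<integral>\<^sup>+z. indicator B (z + v) \<partial>?Z) = (\<integral>\<^sup>+z. indicator W z \<partial>?Z)"
      by (rule nn_integral_cong) (auto simp: W_def split: split_indicator)
    also have "\<dots> = emeasure ?Z W"
      by (rule nn_integral_indicator) (auto simp: W_def)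
    also have "\<dots> = of_nat (card W)"
      using finW by (subst emeasure_count_space_finite) (auto simp: W_def)
    also have "\<dots> \<le> of_nat N" using finW by simp
    finally have "(\<integral>\<^sup>+z. indicator B (z + v) \<partial>?Z) \<le> of_nat N" .
    then show "(\<integral>\<^sup>+z. indicator B (z + v) * indicator Q v \<partial>?Z) \<le> of_nat N * indicator Q v"
      by (subst nn_integral_multc) (auto intro: mult_right_mono)
  qed
  also have "\<dots> = of_nat N * emeasure lborel Q" by (rule nn_integral_cmult_indicator) simp
  also have "\<dots> \<le> of_nat N * 1" using Q1 by (rule mult_left_mono) simp
  finally show ?thesis by simp
qed


text \<open>If all lattice vectors of norm at most \<open>R\<close> lay in a hyperplane, every translate of the
  lattice would meet the ball of radius \<open>R / 2\<close> in \<open>O(R\<^bsup>n-1\<^esup>)\<close> points, whereas its volume is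
  of order \<open>R\<^bsup>n\<^esup>\<close>.\<close>

lemma short_vectors_span:
  obtains R where "\<And>g :: real^'n^'n. g \<in> SL_real \<Longrightarrow> (\<And>x. x \<in> row_lattice g \<Longrightarrow> x \<noteq> 0 \<Longrightarrow> norm x \<ge> 1) \<Longrightarrow>
    span (row_lattice g \<inter> cball 0 R) = UNIV"
proof -
  let ?n = "CARD('n)"
  define V where "V = measure lborel (ball (0 :: real^'n) 1)"
  have V: "V > 0" by (simp add: V_def)
  have volb: "measure lborel (ball (0 :: real^'n) r) = V * r ^ ?n" if "r \<ge> 0" for r
    using that by (simp add: V_def content_ball)
  define c where "c = V * (1 / 2) ^ ?n"
  have c: "c > 0" using V by (simp add: c_def)
  \<comment> \<open>c is the volume of a ball of radius 1/2, so the ball of radius R/2 has volume c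
    R^n. In the hyperplane case its points would give c R^n \<le> (R + 1)^(n-1) / c \<le> (2
    R)^(n-1) / c, that is c R \<le> 2^(n-1) / c. The choice makes c R = c + 2^(n-1) / c + 1, and the
    summand 1 ensures R \<ge> 1, which is used for R + 1 \<le> 2 R.\<close>
  define R where "R = 1 + (2 ^ (?n - 1) / c + 1) / c"
  have R: "R \<ge> 1" using c by (simp add: R_def)
  show thesis
  proof (rule that[of R], rule ccontr)
    fix g :: "real^'n^'n"
    assume g: "g \<in> SL_real" and min: "\<And>x. x \<in> row_lattice g \<Longrightarrow> x \<noteq> 0 \<Longrightarrow> norm x \<ge> 1"
      and ne: "span (row_lattice g \<inter> cball 0 R) \<noteq> UNIV"
    have "dim (row_lattice g \<inter> cball 0 R) < DIM(real^'n)"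
      using ne dim_eq_full[of "row_lattice g \<inter> cball 0 R"] dim_subset_UNIV[of "row_lattice g \<inter> cball 0 R"]
      by simp
    from orthogonal_to_subspace_exists[OF this]
    obtain u where u: "u \<noteq> 0" "\<And>y. y \<in> span (row_lattice g \<inter> cball 0 R) \<Longrightarrow> orthogonal u y"
      by metis
    define N where "N = nat \<lfloor>(R + 1) ^ (?n - 1) / c\<rfloor>"
    have Npos: "(R + 1) ^ (?n - 1) / c \<ge> 0" using R c by simp
    have "emeasure lborel (ball (0 :: real^'n) (R / 2)) \<le> of_nat N"
    proof (rule blichfeldt[OF g])
      fix X and x :: "real^'n"
      assume X: "finite X" "X \<subseteq> ball 0 (R / 2)" "\<And>y. y \<in> X \<Longrightarrow> y - x \<in> row_lattice g"
      \<comment> \<open>Differences of two points in the ball of radius R/2 are short lattice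
        vectors, hence orthogonal to u: this is why the radius is halved.\<close>
      have L: "y - z \<in> row_lattice g \<inter> cball 0 R" if "y \<in> X" "z \<in> X" for y z
      proof -
        have "norm y < R / 2" "norm z < R / 2" using X(2) that by auto
        then have "norm (y - z) \<le> R" using norm_triangle_ineq4[of y z] by linarith
        then show ?thesis using row_lattice_diff[OF X(3)[OF that(1)] X(3)[OF that(2)]] by simp
      qed
      have "real (card X) * measure lborel (ball (0 :: real^'n) (1/2)) \<le> (2 * (R / 2) + 1) ^ (?n - 1)"
      proof (rule coplanar_separated_card_le[OF X(1) _ _ _ u(1)])
        show "X \<subseteq> cball 0 (R / 2)" using X(2) ball_subset_cball by blast
        show "dist y z \<ge> 1" if "y \<in> X" "z \<in> X" "y \<noteq> z" for y z
          using min[of "y - z"] L[OF that(1,2)] that(3) by (simp add: dist_norm)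
        show "u \<bullet> (y - z) = 0" if "y \<in> X" "z \<in> X" for y z
          using u(2)[OF span_base[OF L[OF that]]] by (simp add: orthogonal_def)
      qed (use R in simp)
      then have "real (card X) \<le> (R + 1) ^ (?n - 1) / c"
        using c volb[of "1/2"] by (simp add: c_def field_simps)
      then show "card X \<le> N" using Npos unfolding N_def by linarith
    qed simp
    also have "emeasure lborel (ball (0 :: real^'n) (R / 2)) = ennreal (measure lborel (ball (0 :: real^'n) (R / 2)))"
      using R by (intro emeasure_eq_ennreal_measure) (simp add: emeasure_ball)
    also have "\<dots> = ennreal (c * R ^ ?n)"
      using R volb[of "R / 2"] by (simp add: c_def power_divide)
    finally have "c * R ^ ?n \<le> real N"
      using c R by (simp add: ennreal_of_nat_eq_real_of_nat ennreal_le_iff)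
    also have "real N \<le> (R + 1) ^ (?n - 1) / c"
      using Npos unfolding N_def by linarith
    also have "\<dots> \<le> (2 * R) ^ (?n - 1) / c"
      using R c by (intro divide_right_mono power_mono) auto
    finally have "c * R ^ ?n \<le> (2 ^ (?n - 1) / c) * R ^ (?n - 1)"
      by (simp add: power_mult_distrib)
    moreover have "R ^ ?n = R * R ^ (?n - 1)"
      by (metis One_nat_def Suc_pred zero_less_card_finite power_Suc)
    ultimately have "(c * R) * R ^ (?n - 1) \<le> (2 ^ (?n - 1) / c) * R ^ (?n - 1)"
      by (simp only: mult.assoc)
    then have "c * R \<le> 2 ^ (?n - 1) / c" using R by (simp only: mult_le_cancel_right) auto
    moreover have "c * R = c + (2 ^ (?n - 1) / c + 1)" using c unfolding R_def distrib_left by simp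
    ultimately show False using c by linarith
  qed
qed

text \<open>A basis is extracted from the short vectors, and M expresses it through the rows of g.
  The short vectors may generate a proper sublattice, so M is only known to be nonsingular.\<close>

lemma short_basis:
  obtains R where "\<And>g :: real^'n^'n. g \<in> SL_real \<Longrightarrow> (\<And>x. x \<in> row_lattice g \<Longrightarrow> x \<noteq> 0 \<Longrightarrow> norm x \<ge> 1) \<Longrightarrow>
    \<exists>M. (\<forall>i j. M $ i $ j \<in> \<int>) \<and> det M \<noteq> 0 \<and> (\<forall>i. norm ((M ** g) $ i) \<le> R)"
proof -
  obtain R where R: "\<And>g :: real^'n^'n. g \<in> SL_real \<Longrightarrow> (\<And>x. x \<in> row_lattice g \<Longrightarrow> x \<noteq> 0 \<Longrightarrow> norm x \<ge> 1) \<Longrightarrow>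
    span (row_lattice g \<inter> cball 0 R) = UNIV"
    using short_vectors_span by metis
  show thesis
  proof (rule that[of R])
    fix g :: "real^'n^'n"
    assume g: "g \<in> SL_real" and min: "\<And>x. x \<in> row_lattice g \<Longrightarrow> x \<noteq> 0 \<Longrightarrow> norm x \<ge> 1"
    let ?S = "row_lattice g \<inter> cball 0 R"
    have sp: "span ?S = UNIV" by (rule R[OF g min])
    obtain B where B: "B \<subseteq> ?S" "independent B" "?S \<subseteq> span B" "card B = dim ?S"
      using basis_exists[of ?S] by blast
    have "card B = CARD('n)" using B(4) sp dim_eq_full[of ?S] by simp
    then obtain \<beta> :: "'n \<Rightarrow> real^'n" where \<beta>: "bij_betw \<beta> UNIV B"
      using finite_same_card_bij[of "UNIV :: 'n set" B] independent_imp_finite[OF B(2)] by auto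
    define A where "A = (\<chi> i. \<beta> i)"
    have detA: "det A \<noteq> 0" unfolding A_def by (rule basis_det_nonzero[OF \<beta> B(2)])
    have rowA: "A $ i \<in> ?S" for i
    proof -
      have "A $ i \<in> B" using \<beta> by (simp add: A_def bij_betw_def) blast
      then show ?thesis using B(1) by (rule rev_subsetD)
    qed
    obtain M where M: "A = M ** g" "\<And>i j. M $ i $ j \<in> \<int>"
      by (rule rows_in_row_latticeE[of A g]) (use rowA in auto)
    have "det M \<noteq> 0" using detA M(1) by (auto simp: det_mul)
    moreover have "norm ((M ** g) $ i) \<le> R" for i using rowA[of i] M(1) by simp
    ultimately show "\<exists>M. (\<forall>i j. M $ i $ j \<in> \<int>) \<and> det M \<noteq> 0 \<and> (\<forall>i. norm ((M ** g) $ i) \<le> R)"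
      using M(2) by blast
  qed
qed

section \<open>Mahler compactness\<close>

lemma compact_bounded_rows: "compact {A :: real^'n^'n. \<forall>i. norm (A $ i) \<le> R}"
unfolding compact_eq_bounded_closed
proof
  show "bounded {A :: real^'n^'n. \<forall>i. norm (A $ i) \<le> R}"
  proof (rule boundedI)
    fix A :: "real^'n^'n" assume "A \<in> {A. \<forall>i. norm (A $ i) \<le> R}"
    then have "(\<Sum>i\<in>UNIV. norm (A $ i)) \<le> (\<Sum>i\<in>(UNIV::'n set). R)" by (intro sum_mono) simp
    moreover have "norm A \<le> (\<Sum>i\<in>UNIV. norm (A $ i))" unfolding norm_vec_def by (rule L2_set_le_sum) simp
    ultimately show "norm A \<le> (\<Sum>i\<in>(UNIV::'n set). R)" by linarith
  qed
  show "closed {A :: real^'n^'n. \<forall>i. norm (A $ i) \<le> R}"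
    by (intro closed_Collect_all closed_Collect_le continuous_intros)
qed

text \<open>Integer matrices of the same determinant \<open>m \<noteq> 0\<close> that agree modulo \<open>m\<close> differ by a
  unimodular factor: if \<open>M' = M + m X\<close> and \<open>M J = m\<close>, then \<open>M' = M (1 + J X)\<close>.\<close>

lemma integer_matrix_cong_det:
  fixes M M' :: "real^'n^'n" and m :: int
  assumes M: "\<And>i j. M $ i $ j = of_int (a i j)" and M': "\<And>i j. M' $ i $ j = of_int (a' i j)"
    and det: "det M = of_int m" "det M' = of_int m" "m \<noteq> 0"
    and cong: "\<And>i j. a i j mod \<bar>m\<bar> = a' i j mod \<bar>m\<bar>"
  obtains \<gamma> where "\<gamma> \<in> SL_int" "M' = M ** \<gamma>"
proof -
  obtain J where J: "\<And>i j. J $ i $ j \<in> \<int>" "M ** J = mat (det M)"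
    using integer_adjugate[of M] M det by (metis Ints_of_int of_int_0_eq_iff)
  have "m dvd a' i j - a i j" for i j
    using cong[of i j] by (metis abs_dvd_iff mod_eq_dvd_iff)
  then have "\<exists>x. a' i j = a i j + m * x" for i j
    by (metis add.commute diff_add_cancel dvd_def)
  then obtain x where x: "\<And>i j. a' i j = a i j + m * x i j" by metis
  define X where "X = (\<chi> i j. of_int (x i j) :: real^'n^'n)"
  define \<gamma> where "\<gamma> = mat 1 + J ** X"
  have "M ** \<gamma> = M ** mat 1 + M ** (J ** X)" unfolding \<gamma>_def by (rule matrix_add_ldistrib)
  also have "M ** (J ** X) = mat (of_int m) ** X" by (simp only: matrix_mul_assoc J(2) det(1))
  also have "\<dots> = of_int m *\<^sub>R X"
    by (simp add: vec_eq_iff matrix_matrix_mult_def mat_def if_distrib[of "\<lambda>u. u * _"] cong: if_cong)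
  finally have eq: "M' = M ** \<gamma>"
    by (simp add: vec_eq_iff M M' x X_def)
  have "\<gamma> $ i $ j \<in> \<int>" for i j
    using J(1) by (auto simp: \<gamma>_def mat_def matrix_matrix_mult_def X_def intro!: Ints_add Ints_sum Ints_mult)
  moreover have "det \<gamma> = 1"
  proof -
    have "det M' = det M * det \<gamma>" unfolding eq by (rule det_mul)
    then show ?thesis using det by simp
  qed
  ultimately have "\<gamma> \<in> SL_int" by (simp add: SL_int_def SL_real_def)
  then show thesis using eq by (rule that)
qed


text \<open>If \<open>M ** g\<close> lies in the compact set \<open>C\<close> and
  \<open>M = N ** \<gamma>\<close> with N from a finite list, then \<open>\<gamma> ** g\<close> is
  the inverse of N times a point of \<open>C\<close>. So g is an \<open>SL_int\<close>-translate of
  a point in one of finitely many compact sets.\<close>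

lemma reduction_compact:
  obtains \<K> :: "(real^'n^'n) set set" where "finite \<K>"
    "\<forall>K\<in>\<K>. compact K \<and> K \<subseteq> SL_real"
    "\<forall>g\<in>SL_real. (\<forall>x. x \<in> row_lattice g \<longrightarrow> x \<noteq> 0 \<longrightarrow> norm x \<ge> 1) \<longrightarrow>
       g \<in> (\<Union>K\<in>\<K>. \<Union>\<gamma>\<in>SL_int. (\<lambda>h. \<gamma> ** h) ` K)"
proof -
  obtain R where R: "\<And>g :: real^'n^'n. g \<in> SL_real \<Longrightarrow> (\<And>x. x \<in> row_lattice g \<Longrightarrow> x \<noteq> 0 \<Longrightarrow> norm x \<ge> 1) \<Longrightarrow>
    \<exists>M. (\<forall>i j. M $ i $ j \<in> \<int>) \<and> det M \<noteq> 0 \<and> (\<forall>i. norm ((M ** g) $ i) \<le> R)"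
    using short_basis by metis
  define C where "C = {A :: real^'n^'n. \<forall>i. norm (A $ i) \<le> R}"
  have C: "compact C" unfolding C_def by (rule compact_bounded_rows)
  have "bounded (det ` C)"
    by (rule compact_imp_bounded[OF compact_continuous_image[OF continuous_on_det C]])
  \<comment> \<open>Since \<open>M ** g\<close> has the determinant of M, a bound for
    \<open>det\<close> on \<open>C\<close> bounds the index of the sublattice generated by the short
    vectors.\<close>
  then obtain D where D: "\<And>A. A \<in> C \<Longrightarrow> \<bar>det A\<bar> \<le> D"
    by (auto simp: bounded_iff)
  define \<M> where "\<M> = {M :: real^'n^'n. (\<forall>i j. M $ i $ j \<in> \<int>) \<and> det M \<noteq> 0 \<and> \<bar>det M\<bar> \<le> D}"
  \<comment> \<open>Records the determinant and the entries modulo it. Only finitely many values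
    occur on \<open>\<M>\<close>, and by \<open>integer_matrix_cong_det\<close> matrices with the
    same value differ by a right factor in \<open>SL_int\<close>.\<close>
  define f where "f = (\<lambda>M :: real^'n^'n. (\<lfloor>det M\<rfloor>, \<lambda>i j. \<lfloor>M $ i $ j\<rfloor> mod \<bar>\<lfloor>det M\<rfloor>\<bar>))"
  have fl: "det M = of_int \<lfloor>det M\<rfloor>" "M $ i $ j = of_int \<lfloor>M $ i $ j\<rfloor>" "\<lfloor>det M\<rfloor> \<noteq> 0" "\<bar>\<lfloor>det M\<rfloor>\<bar> \<le> \<lfloor>D\<rfloor>"
    if M: "M \<in> \<M>" for M i j
  proof -
    have ints: "\<And>i j. M $ i $ j \<in> \<int>" and d: "det M \<noteq> 0" "\<bar>det M\<bar> \<le> D" using M by (auto simp: \<M>_def)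
    show dM: "det M = of_int \<lfloor>det M\<rfloor>" using det_in_Ints[OF ints] by (auto elim: Ints_cases)
    show "M $ i $ j = of_int \<lfloor>M $ i $ j\<rfloor>" using ints[of i j] by (auto elim: Ints_cases)
    show "\<lfloor>det M\<rfloor> \<noteq> 0" using dM d(1) by (metis of_int_0)
    have "real_of_int \<bar>\<lfloor>det M\<rfloor>\<bar> \<le> D" using dM d(2) by simp
    then show "\<bar>\<lfloor>det M\<rfloor>\<bar> \<le> \<lfloor>D\<rfloor>" by (simp add: le_floor_iff)
  qed
  have "f ` \<M> \<subseteq> {- \<lfloor>D\<rfloor>..\<lfloor>D\<rfloor>} \<times> PiE UNIV (\<lambda>_. PiE UNIV (\<lambda>_. {0..\<lfloor>D\<rfloor>}))"
  proof
    fix y assume "y \<in> f ` \<M>"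
    then obtain M where M: "M \<in> \<M>" "y = f M" by blast
    have "0 \<le> \<lfloor>M $ i $ j\<rfloor> mod \<bar>\<lfloor>det M\<rfloor>\<bar>" "\<lfloor>M $ i $ j\<rfloor> mod \<bar>\<lfloor>det M\<rfloor>\<bar> \<le> \<lfloor>D\<rfloor>" for i j
      using fl(3,4)[OF M(1)] pos_mod_sign[of "\<bar>\<lfloor>det M\<rfloor>\<bar>" "\<lfloor>M $ i $ j\<rfloor>"]
        pos_mod_bound[of "\<bar>\<lfloor>det M\<rfloor>\<bar>" "\<lfloor>M $ i $ j\<rfloor>"] by linarith+
    moreover have "\<lfloor>det M\<rfloor> \<in> {- \<lfloor>D\<rfloor>..\<lfloor>D\<rfloor>}" using fl(4)[OF M(1)] by auto
    ultimately show "y \<in> {- \<lfloor>D\<rfloor>..\<lfloor>D\<rfloor>} \<times> PiE UNIV (\<lambda>_. PiE UNIV (\<lambda>_. {0..\<lfloor>D\<rfloor>}))"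
      unfolding M(2) f_def by (intro SigmaI PiE_I) auto
  qed
  then have "finite (f ` \<M>)"
    by (rule finite_subset) (intro finite_cartesian_product finite_PiE; simp)
  define \<N> where "\<N> = inv_into \<M> f ` (f ` \<M>)"
  have "finite \<N>" unfolding \<N>_def using \<open>finite (f ` \<M>)\<close> by (rule finite_imageI)
  have \<N>sub: "\<N> \<subseteq> \<M>" unfolding \<N>_def by (auto intro: inv_into_into)
  define I where "I N = (SOME Q. Q ** N = mat 1)" for N :: "real^'n^'n"
  have I: "I N ** N = mat 1" if "N \<in> \<M>" for N
  proof -
    have "invertible N" using that by (simp add: \<M>_def invertible_det_nz)
    then have "\<exists>Q. Q ** N = mat 1" by (auto simp: invertible_def)
    then show ?thesis unfolding I_def by (rule someI_ex)
  qed
  \<comment> \<open>Intersecting with the closed set \<open>SL_real\<close> keeps compactness and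
    discards the matrices of determinant other than 1.\<close>
  define \<K> where "\<K> = (\<lambda>N. SL_real \<inter> (\<lambda>A. I N ** A) ` C) ` \<N>"
  show thesis
  proof (rule that[of \<K>])
    show "finite \<K>" unfolding \<K>_def using \<open>finite \<N>\<close> by (rule finite_imageI)
    show "\<forall>K\<in>\<K>. compact K \<and> K \<subseteq> SL_real"
    proof
      fix K assume KK: "K \<in> \<K>"
      obtain N where K: "K = SL_real \<inter> (\<lambda>A. I N ** A) ` C" using KK unfolding \<K>_def by blast
      have "compact ((\<lambda>A. I N ** A) ` C)"
        by (rule compact_continuous_image[OF continuous_on_matrix_mult_left C])
      then show "compact K \<and> K \<subseteq> SL_real" unfolding K by (intro conjI closed_Int_compact closed_SL_real Int_lower1)
    qed
    show "\<forall>g\<in>SL_real. (\<forall>x. x \<in> row_lattice g \<longrightarrow> x \<noteq> 0 \<longrightarrow> norm x \<ge> 1) \<longrightarrow>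
       g \<in> (\<Union>K\<in>\<K>. \<Union>\<gamma>\<in>SL_int. (\<lambda>h. \<gamma> ** h) ` K)"
    proof (intro ballI impI)
      fix g :: "real^'n^'n"
      assume g: "g \<in> SL_real" and min: "\<forall>x. x \<in> row_lattice g \<longrightarrow> x \<noteq> 0 \<longrightarrow> norm x \<ge> 1"
      obtain M where M: "\<forall>i j. M $ i $ j \<in> \<int>" "det M \<noteq> 0" "\<forall>i. norm ((M ** g) $ i) \<le> R"
        using R[OF g min[rule_format]] by blast
      have MgC: "M ** g \<in> C" using M(3) by (simp add: C_def)
      have "det (M ** g) = det M" using g by (simp add: det_mul SL_real_def)
      then have MM: "M \<in> \<M>" using M D[OF MgC] by (simp add: \<M>_def)
      define N where "N = inv_into \<M> f (f M)"
      have N: "N \<in> \<N>" unfolding N_def \<N>_def using MM by blast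
      then have NM: "N \<in> \<M>" using \<N>sub by blast
      have "f N = f M" unfolding N_def using MM by (intro f_inv_into_f) blast
      then have fN: "\<lfloor>det N\<rfloor> = \<lfloor>det M\<rfloor>" "\<And>i j. \<lfloor>N $ i $ j\<rfloor> mod \<bar>\<lfloor>det M\<rfloor>\<bar> = \<lfloor>M $ i $ j\<rfloor> mod \<bar>\<lfloor>det M\<rfloor>\<bar>"
        by (auto simp: f_def fun_eq_iff)
      obtain \<gamma> where \<gamma>: "\<gamma> \<in> SL_int" "M = N ** \<gamma>"
      proof (rule integer_matrix_cong_det)
        show "N $ i $ j = of_int \<lfloor>N $ i $ j\<rfloor>" for i j by (rule fl(2)[OF NM])
        show "M $ i $ j = of_int \<lfloor>M $ i $ j\<rfloor>" for i j by (rule fl(2)[OF MM])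
        show "det N = of_int \<lfloor>det M\<rfloor>" using fl(1)[OF NM] fN(1) by simp
        show "det M = of_int \<lfloor>det M\<rfloor>" by (rule fl(1)[OF MM])
        show "\<lfloor>det M\<rfloor> \<noteq> 0" by (rule fl(3)[OF MM])
        show "\<lfloor>N $ i $ j\<rfloor> mod \<bar>\<lfloor>det M\<rfloor>\<bar> = \<lfloor>M $ i $ j\<rfloor> mod \<bar>\<lfloor>det M\<rfloor>\<bar>" for i j by (rule fN(2))
      qed
      obtain \<delta> where \<delta>: "\<delta> \<in> SL_int" "\<delta> ** \<gamma> = mat 1"
        by (rule SL_int_inverse[OF \<gamma>(1)])
      have "I N ** (M ** g) = (I N ** N) ** (\<gamma> ** g)" by (simp only: \<gamma>(2) matrix_mul_assoc)
      then have eq: "\<gamma> ** g = I N ** (M ** g)" by (simp add: I[OF NM])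
      have "\<gamma> ** g \<in> SL_real" using \<gamma>(1) SL_int_subset g by (intro SL_real_mult) blast+
      then have inK: "\<gamma> ** g \<in> SL_real \<inter> (\<lambda>A. I N ** A) ` C"
        using MgC unfolding eq by (intro IntI imageI)
      have "g = \<delta> ** (\<gamma> ** g)" by (simp add: matrix_mul_assoc \<delta>(2))
      then have "g \<in> (\<lambda>h. \<delta> ** h) ` (SL_real \<inter> (\<lambda>A. I N ** A) ` C)"
        using inK by (rule image_eqI)
      with \<delta>(1) have "g \<in> (\<Union>\<gamma>\<in>SL_int. (\<lambda>h. \<gamma> ** h) ` (SL_real \<inter> (\<lambda>A. I N ** A) ` C))"
        by (rule UN_I)
      moreover have "SL_real \<inter> (\<lambda>A. I N ** A) ` C \<in> \<K>" using N unfolding \<K>_def by (rule imageI)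
      ultimately show "g \<in> (\<Union>K\<in>\<K>. \<Union>\<gamma>\<in>SL_int. (\<lambda>h. \<gamma> ** h) ` K)"
        by (rule UN_I[rotated])
    qed
  qed
qed

text \<open>Finitely many families of translates of compact sets cover S by
  \<open>reduction_compact\<close>, and within a fundamental domain each family has finite
  measure.\<close>

lemma haar_finite_min_norm:
  fixes H :: "(real^'n^'n) measure"
  assumes H: "haar_measure_SL H" and F: "fundamental_domain F"
    and S: "S \<subseteq> F" "S \<in> sets H"
    and min: "\<And>g x. g \<in> S \<Longrightarrow> x \<in> row_lattice g \<Longrightarrow> x \<noteq> 0 \<Longrightarrow> norm x \<ge> 1"
  shows "emeasure H S < \<infinity>"
proof -
  obtain \<K> :: "(real^'n^'n) set set" where \<K>: "finite \<K>"
    "\<forall>K\<in>\<K>. compact K \<and> K \<subseteq> SL_real"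
    "\<forall>g\<in>SL_real. (\<forall>x. x \<in> row_lattice g \<longrightarrow> x \<noteq> 0 \<longrightarrow> norm x \<ge> 1) \<longrightarrow>
       g \<in> (\<Union>K\<in>\<K>. \<Union>\<gamma>\<in>SL_int. (\<lambda>h. \<gamma> ** h) ` K)"
    by (rule reduction_compact)
  have SSL: "S \<subseteq> SL_real" using S(1) F unfolding fundamental_domain_def by blast
  define P where "P K = S \<inter> (\<Union>\<gamma>\<in>SL_int. (\<lambda>h. \<gamma> ** h) ` K)" for K
  have Psets: "P K \<in> sets H" if "K \<in> \<K>" for K
  proof -
    have "(\<lambda>h. \<gamma> ** h) ` K \<in> sets borel" for \<gamma> :: "real^'n^'n"
      using bspec[OF \<K>(2) that]
      by (intro borel_closed[OF compact_imp_closed[OF compact_continuous_image[OF continuous_on_matrix_mult_left]]]) simp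
    then have "(\<Union>\<gamma>\<in>SL_int. (\<lambda>h. \<gamma> ** h) ` K) \<in> sets borel"
      by (intro sets.countable_UN'[OF countable_SL_int]) auto
    then show ?thesis
      using S(2) SSL by (auto simp: P_def sets_haar_iff[OF H])
  qed
  have "S \<subseteq> (\<Union>K\<in>\<K>. P K)"
  proof
    fix g assume g: "g \<in> S"
    have "g \<in> (\<Union>K\<in>\<K>. \<Union>\<gamma>\<in>SL_int. (\<lambda>h. \<gamma> ** h) ` K)"
      by (rule \<K>(3)[rule_format]) (use g SSL min in auto)
    then show "g \<in> (\<Union>K\<in>\<K>. P K)" using g unfolding P_def by blast
  qed
  then have "emeasure H S \<le> emeasure H (\<Union>K\<in>\<K>. P K)"
    by (rule emeasure_mono) (use Psets \<K>(1) in auto)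
  also have "\<dots> \<le> (\<Sum>K\<in>\<K>. emeasure H (P K))"
    by (rule emeasure_subadditive_finite) (use Psets \<K>(1) in auto)
  also have "\<dots> < \<infinity>"
  proof -
    have "emeasure H (P K) < \<infinity>" if "K \<in> \<K>" for K
      unfolding P_def using bspec[OF \<K>(2) that] by (intro haar_finite_translates[OF H F S]) auto
    then show ?thesis using \<K>(1) by (simp add: less_top)
  qed
  finally show ?thesis .
qed

section \<open>Push-forward measures and integration over the moduli spaces\<close>

lemma quotient_sets:
  "sets (sigma \<Omega> {A. A \<subseteq> \<Omega> \<and> f -` A \<inter> space M \<in> sets M}) = sigma_sets \<Omega> {A. A \<subseteq> \<Omega> \<and> f -` A \<inter> space M \<in> sets M}"
  by (rule sets_measure_of) auto

lemma space_push_measure [simp]: "space (push_measure M \<Omega> f) = \<Omega>"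
  by (simp add: push_measure_def space_measure_of_conv)

lemma measurable_push_measure:
  assumes "\<And>x. x \<in> space M \<Longrightarrow> f x \<in> \<Omega>"
  shows "f \<in> measurable M (sigma \<Omega> {A. A \<subseteq> \<Omega> \<and> f -` A \<inter> space M \<in> sets M})"
  by (rule measurable_sigma_sets[OF quotient_sets]) (use assms in auto)

text \<open>The preimage of a Borel set under u is one of the generators of the quotient
  sigma-algebra, because its pullback along f is measurable. Functions on the moduli spaces can thus
  be tested on matrices or on pairs.\<close>

lemma borel_measurable_push_measure:
  assumes f: "\<And>x. x \<in> space M \<Longrightarrow> f x \<in> \<Omega>" and u: "(\<lambda>x. u (f x)) \<in> borel_measurable M"
  shows "u \<in> borel_measurable (sigma \<Omega> {A. A \<subseteq> \<Omega> \<and> f -` A \<inter> space M \<in> sets M})"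
    "u \<in> borel_measurable (push_measure M \<Omega> f)"
proof -
  show 1: "u \<in> borel_measurable (sigma \<Omega> {A. A \<subseteq> \<Omega> \<and> f -` A \<inter> space M \<in> sets M})"
  proof (rule measurableI)
    fix B :: "'c set" assume "B \<in> sets borel"
    then have "(\<lambda>x. u (f x)) -` B \<inter> space M \<in> sets M" by (rule measurable_sets[OF u])
    moreover have "(\<lambda>x. u (f x)) -` B \<inter> space M = f -` (u -` B \<inter> \<Omega>) \<inter> space M" using f by auto
    ultimately show "u -` B \<inter> space (sigma \<Omega> {A. A \<subseteq> \<Omega> \<and> f -` A \<inter> space M \<in> sets M})
        \<in> sets (sigma \<Omega> {A. A \<subseteq> \<Omega> \<and> f -` A \<inter> space M \<in> sets M})"
      unfolding quotient_sets by (intro sigma_sets.Basic) (simp add: space_measure_of_conv)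
  qed simp
  then show "u \<in> borel_measurable (push_measure M \<Omega> f)"
    by (simp add: push_measure_def)
qed

lemma integral_push_measure:
  fixes u :: "'b \<Rightarrow> 'c::{banach, second_countable_topology}"
  assumes f: "\<And>x. x \<in> space M \<Longrightarrow> f x \<in> \<Omega>" and u: "(\<lambda>x. u (f x)) \<in> borel_measurable M"
  shows "integrable (push_measure M \<Omega> f) u \<longleftrightarrow> integrable M (\<lambda>x. u (f x))"
    "integral\<^sup>L (push_measure M \<Omega> f) u = (\<integral>x. u (f x) \<partial>M)"
  unfolding push_measure_def
  by (rule integrable_distr_eq integral_distr, rule measurable_push_measure[OF f], assumption,
      rule borel_measurable_push_measure[OF f u], assumption)+

lemma finite_measure_push_measure:
  assumes "finite_measure M" "\<And>x. x \<in> space M \<Longrightarrow> f x \<in> \<Omega>"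
  shows "finite_measure (push_measure M \<Omega> f)"
  unfolding push_measure_def
  by (rule finite_measure.finite_measure_distr[OF assms(1) measurable_push_measure[OF assms(2)]])

text \<open>If \<open>S\<close> is not measurable, then \<open>restrict_space M S\<close> is a null measure; this makes the
  measurability of the set of semi-stable lattices irrelevant.\<close>

lemma emeasure_restrict_space_space_le:
  "emeasure (restrict_space M S) (space (restrict_space M S)) \<le> emeasure M (S \<inter> space M)"
  unfolding space_restrict_space unfolding restrict_space_def emeasure_measure_of_conv by auto

section \<open>Superlevel sets of theta series\<close>

lemma infsum_greater_iff:
  fixes f :: "'a \<Rightarrow> real"
  assumes f: "f summable_on A" and nn: "\<And>x. x \<in> A \<Longrightarrow> f x \<ge> 0"
  shows "a < infsum f A \<longleftrightarrow> (\<exists>F. finite F \<and> F \<subseteq> A \<and> a < sum f F)"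
proof
  assume "a < infsum f A"
  moreover have "(sum f \<longlongrightarrow> infsum f A) (finite_subsets_at_top A)"
    using has_sum_infsum[OF f] by (simp add: has_sum_def)
  ultimately have "\<forall>\<^sub>F F in finite_subsets_at_top A. a < sum f F"
    by (rule order_tendstoD(1)[rotated])
  then show "\<exists>F. finite F \<and> F \<subseteq> A \<and> a < sum f F"
    by (auto simp: eventually_finite_subsets_at_top)
next
  assume "\<exists>F. finite F \<and> F \<subseteq> A \<and> a < sum f F"
  then obtain F where "finite F" "F \<subseteq> A" "a < sum f F" by blast
  moreover from this have "sum f F \<le> infsum f A"
    by (intro finite_sum_le_infsum f) (use nn in auto)
  ultimately show "a < infsum f A" by linarith
qed

text \<open>The theta series is the supremum of its finite partial sums. Strict superlevel sets
  therefore become unions over finite sets of vectors, which is the form used for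
  measurability.\<close>

lemma theta_greater_iff:
  fixes L :: "'a::euclidean_space set"
  assumes L: "sep_set L" and T: "T > 0"
  shows "a < theta L T \<longleftrightarrow>
    (\<exists>F. finite F \<and> F \<subseteq> L \<and> a < (\<Sum>x\<in>F. exp (- pi * T powr (2 / real DIM('a)) * (norm x)\<^sup>2)))"
proof -
  have "(\<lambda>x. exp (- pi * T powr (2 / real DIM('a)) * (norm x)\<^sup>2)) summable_on insert 0 (L - {0})"
    using gauss_summable[OF L, of "T powr (2 / real DIM('a))"] T
    by (subst summable_on_insert_iff) auto
  moreover have "insert 0 (L - {0}) = L" using L by (auto simp: sep_set_def)
  ultimately show ?thesis
    unfolding theta_def by (intro infsum_greater_iff) auto
qed

lemma theta_mono:
  fixes L :: "'a::euclidean_space set"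
  assumes L: "sep_set L" and T: "0 < T" "T \<le> q" and a: "a < theta L q"
  shows "a < theta L T"
proof -
  let ?g = "\<lambda>T x :: 'a. exp (- pi * T powr (2 / real DIM('a)) * (norm x)\<^sup>2)"
  obtain F where F: "finite F" "F \<subseteq> L" "a < (\<Sum>x\<in>F. ?g q x)"
    using a theta_greater_iff[OF L, of q a] T by auto
  have "(\<Sum>x\<in>F. ?g q x) \<le> (\<Sum>x\<in>F. ?g T x)"
  proof (rule sum_mono)
    fix x :: 'a
    have "T powr (2 / real DIM('a)) \<le> q powr (2 / real DIM('a))" using T by (intro powr_mono2) auto
    then show "?g q x \<le> ?g T x" by (simp add: mult_right_mono)
  qed
  then show ?thesis using F theta_greater_iff[OF L T(1), of a] by (meson less_le_trans)
qed

text \<open>A finite partial sum exceeding a is continuous in T, so it still exceeds a at some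
  slightly larger rational q.\<close>

lemma theta_greater_rational:
  fixes L :: "'a::euclidean_space set"
  assumes L: "sep_set L" and T: "0 < T" and a: "a < theta L T"
  obtains q where "q \<in> \<rat>" "T < q" "a < theta L q"
proof -
  let ?g = "\<lambda>T x :: 'a. exp (- pi * T powr (2 / real DIM('a)) * (norm x)\<^sup>2)"
  obtain F where F: "finite F" "F \<subseteq> L" "a < (\<Sum>x\<in>F. ?g T x)"
    using a theta_greater_iff[OF L T, of a] by auto
  have "((\<lambda>t. \<Sum>x\<in>F. ?g t x) \<longlongrightarrow> (\<Sum>x\<in>F. ?g T x)) (at T)"
    using T by (intro tendsto_intros) auto
  then have "\<forall>\<^sub>F t in at T. a < (\<Sum>x\<in>F. ?g t x)"
    using F(3) by (rule order_tendstoD(1))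
  then obtain d where d: "d > 0" "\<And>t. t \<noteq> T \<Longrightarrow> dist t T < d \<Longrightarrow> a < (\<Sum>x\<in>F. ?g t x)"
    by (auto simp: eventually_at)
  obtain q where q: "q \<in> \<rat>" "T < q" "q < T + d" using Rats_dense_in_real[of T "T + d"] d(1) by auto
  have "a < (\<Sum>x\<in>F. ?g q x)" using q by (intro d(2)) (auto simp: dist_real_def)
  then have "a < theta L q" using theta_greater_iff[OF L, of q a] F T q(2) by auto
  then show thesis using q by (intro that[of q])
qed

text \<open>Lattice vectors are parametrized by \<open>int_vecs\<close>, an index set independent of
  g. The superlevel set is then a countable union, over finite sets of integer vectors, of sets
  given by functions continuous in g. \<open>M\<close> enters only through the measurability of
  Borel functions, so that restrictions of the Haar measure to subsets qualify.\<close>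

lemma theta_measurable_row_lattice:
  fixes M :: "(real^'n^'n) measure"
  assumes meas: "\<And>u :: real^'n^'n \<Rightarrow> real. u \<in> borel_measurable borel \<Longrightarrow> u \<in> borel_measurable M"
    and sep: "\<And>g. g \<in> space M \<Longrightarrow> sep_set (row_lattice g)" and det: "\<And>g. g \<in> space M \<Longrightarrow> det g \<noteq> 0"
    and T: "T > 0"
  shows "(\<lambda>g. theta (row_lattice g) T) \<in> borel_measurable M"
proof (rule borel_measurable_iff_greater[THEN iffD2], rule allI)
  fix a
  let ?g = "\<lambda>x :: real^'n. exp (- pi * T powr (2 / real CARD('n)) * (norm x)\<^sup>2)"
  have eq: "a < theta (row_lattice g) T \<longleftrightarrow> (\<exists>F. finite F \<and> F \<subseteq> int_vecs \<and> a < (\<Sum>v\<in>F. ?g (v v* g)))"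
    if g: "g \<in> space M" for g
  proof -
    note inj = inj_vector_matrix_mult[OF det[OF g]]
    have "a < theta (row_lattice g) T \<longleftrightarrow> (\<exists>F. finite F \<and> F \<subseteq> (\<lambda>v. v v* g) ` int_vecs \<and> a < (\<Sum>x\<in>F. ?g x))"
      using theta_greater_iff[OF sep[OF g] T, of a] by (simp add: row_lattice_eq_image)
    also have "\<dots> \<longleftrightarrow> (\<exists>F. finite F \<and> F \<subseteq> int_vecs \<and> a < (\<Sum>x\<in>(\<lambda>v. v v* g) ` F. ?g x))"
      by (rule ex_finite_subset_image)
    also have "\<dots> \<longleftrightarrow> (\<exists>F. finite F \<and> F \<subseteq> int_vecs \<and> a < (\<Sum>v\<in>F. ?g (v v* g)))"
      by (simp only: sum.reindex[OF inj_on_subset[OF inj subset_UNIV]] o_def)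
    finally show ?thesis .
  qed
  have "{g \<in> space M. a < theta (row_lattice g) T}
      = {g \<in> space M. \<exists>F. finite F \<and> F \<subseteq> int_vecs \<and> a < (\<Sum>v\<in>F. ?g (v v* g))}"
    by (intro Collect_cong conj_cong refl eq)
  also have "\<dots> = (\<Union>F\<in>{F. finite F \<and> F \<subseteq> int_vecs}. {g \<in> space M. a < (\<Sum>v\<in>F. ?g (v v* g))})"
    by blast
  also have "\<dots> \<in> sets M"
  proof (rule sets.countable_UN'')
    show "countable {F :: (real^'n) set. finite F \<and> F \<subseteq> int_vecs}"
      using countable_Collect_finite_subset[OF countable_int_vecs] by simp
    show "{g \<in> space M. a < (\<Sum>v\<in>F. ?g (v v* g))} \<in> sets M" for F
    proof -
      have cont: "continuous_on UNIV (\<lambda>g. v v* (g :: real^'n^'n))" for v :: "real^'n"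
        by (rule bounded_bilinear.continuous_on[OF bounded_bilinear_vector_matrix_mult
              continuous_on_const continuous_on_id])
      have "continuous_on UNIV (\<lambda>g :: real^'n^'n. \<Sum>v\<in>F. ?g (v v* g))"
        by (intro continuous_on_sum continuous_on_exp continuous_on_mult continuous_on_const
            continuous_on_power continuous_on_norm cont)
      then have "(\<lambda>g. \<Sum>v\<in>F. ?g (v v* g)) \<in> borel_measurable M"
        by (intro meas borel_measurable_continuous_onI)
      then show ?thesis by (simp only: borel_measurable_iff_greater)
    qed
  qed
  finally show "{g \<in> space M. a < theta (row_lattice g) T} \<in> sets M" .
qed


section \<open>Isometry classes, representatives and scaling\<close>

lemma isometry_class:
  "full_lattice L \<Longrightarrow> isometry_rel `` {L} = (\<lambda>f. f ` L) ` {f. orthogonal_transformation f}"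
  unfolding isometry_rel_def by blast

lemma rep_isometry_class:
  assumes "full_lattice L"
  obtains f where "orthogonal_transformation f" "rep (isometry_rel `` {L}) = f ` L"
proof -
  have "L \<in> isometry_rel `` {L}"
    unfolding isometry_class[OF assms]
    by (rule image_eqI[where x = "\<lambda>x. x"]) simp_all
  then have "rep (isometry_rel `` {L}) \<in> isometry_rel `` {L}" unfolding rep_def by (rule someI)
  then show thesis using that unfolding isometry_class[OF assms] by blast
qed

text \<open>Orthogonal maps commute with homotheties.\<close>

lemma scale_isometry_class:
  fixes L :: "(real^'n) set"
  assumes L: "full_lattice L" and T: "T > 0"
  shows "scale_class T (isometry_rel `` {L}) = isometry_rel `` {(\<lambda>x. root CARD('n) T *\<^sub>R x) ` L}"
proof -
  let ?t = "root CARD('n) T"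
  have "full_lattice ((*\<^sub>R) ?t ` L)"
    by (rule full_lattice_similarity(1)[OF L similarity_scaleR]) (use T in simp)
  then have "isometry_rel `` {(*\<^sub>R) ?t ` L} = (\<lambda>f. f ` (*\<^sub>R) ?t ` L) ` {f. orthogonal_transformation f}"
    by (rule isometry_class)
  also have "\<dots> = (\<lambda>f. (*\<^sub>R) ?t ` f ` L) ` {f. orthogonal_transformation f}"
    by (rule image_cong) (simp_all add: image_image orthogonal_transformation_scaleR)
  also have "\<dots> = scale_class T (isometry_rel `` {L})"
    unfolding scale_class_def isometry_class[OF L]
    by (simp add: image_image)
  finally show ?thesis by simp
qed

lemma sep_set_semistable:
  fixes L :: "(real^'n) set"
  assumes L: "full_lattice L" "semistable L" "covol L = 1"
  shows "sep_set L"
proof -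
  obtain g where g: "det g \<noteq> 0" "L = row_lattice g" using L(1) by (rule full_latticeE)
  have "countable L" unfolding g(2) row_lattice_eq_image by (rule countable_image[OF countable_int_vecs])
  moreover have "0 \<in> L" using row_lattice_diff[OF row_lattice_rows row_lattice_rows, of g] by (simp add: g(2)) (metis diff_self)
  moreover have "dist x y \<ge> 1" if "x \<in> L" "y \<in> L" "x \<noteq> y" for x y
    using semistable_min_norm[OF L, of "x - y"] row_lattice_diff[of x g y] that
    by (simp add: g(2) dist_norm)
  ultimately show ?thesis by (simp add: sep_set_def)
qed

lemma moduli_vol_1E:
  assumes "C \<in> moduli_vol 1"
  obtains L where "full_lattice L" "semistable L" "covol L = 1" "C = isometry_rel `` {L}"
proof -
  obtain L where "C = isometry_rel `` {L}" "L \<in> {L. full_lattice L \<and> semistable L \<and> covol L = 1}"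
    using assms unfolding moduli_vol_def by (rule quotientE)
  then show thesis using that[of L] by simp
qed

lemma sep_set_rep:
  fixes C :: "(real^'n) set set"
  assumes "C \<in> moduli_vol 1"
  shows "sep_set (rep C)"
proof -
  obtain L where L: "full_lattice L" "semistable L" "covol L = 1" "C = isometry_rel `` {L}"
    using assms by (rule moduli_vol_1E)
  obtain f where f: "orthogonal_transformation f" "rep C = f ` L"
    unfolding L(4) using L(1) by (rule rep_isometry_class)
  note f' = similarity_orthogonal[OF f(1)]
  show ?thesis
    unfolding f(2)
  proof (rule sep_set_semistable)
    show "full_lattice (f ` L)" by (rule full_lattice_similarity[OF L(1) f'])
    show "covol (f ` L) = 1" using full_lattice_similarity(2)[OF L(1) f'] L(3) by simp
    show "semistable (f ` L)"
      using L(1) by (intro semistable_similarity[OF _ L(2) f']) (simp add: full_lattice_def)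
  qed
qed

lemma theta_orthogonal:
  fixes f :: "'a::euclidean_space \<Rightarrow> 'a"
  assumes f: "orthogonal_transformation f"
  shows "theta (f ` L) T = theta L T"
proof -
  have "inj_on f L" using orthogonal_transformation_inj[OF f] by (rule inj_on_subset) simp
  then show ?thesis
    by (simp add: theta_def infsum_reindex o_def orthogonal_transformation_norm[OF f])
qed

lemma theta_ge_1:
  fixes L :: "'a::euclidean_space set"
  assumes L: "sep_set L" and T: "T > 0"
  shows "theta L T \<ge> 1"
proof -
  have "0 \<le> theta L T - 1" unfolding theta_minus_1[OF L T] by (rule infsum_nonneg) simp
  then show ?thesis by simp
qed

text \<open>The theta constant of T^(1/n) L is \<open>theta L T\<close>, and its degree is -log T.
  The representatives of C and of the scaled class are chosen independently, but both differ from L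
  and its multiple by isometries, which preserve theta series and covolume.\<close>

lemma scale_class_moduli:
  fixes C :: "(real^'n) set set"
  assumes C: "C \<in> moduli_vol 1" and T: "T > 0"
  shows "scale_class T C \<in> moduli"
    and "zeta_integrand s (rep (scale_class T C)) = of_real (theta (rep C) T - 1) * exp (s * of_real (ln T))"
proof -
  let ?t = "root CARD('n) T"
  have t: "?t > 0" using T by simp
  obtain L where L: "full_lattice L" "semistable L" "covol L = 1" "C = isometry_rel `` {L}"
    using C by (rule moduli_vol_1E)
  note st = similarity_scaleR[OF t]
  have tL: "full_lattice ((*\<^sub>R) ?t ` L)" by (rule full_lattice_similarity(1)[OF L(1) st])
  have tLs: "semistable ((*\<^sub>R) ?t ` L)"
    using L(1) by (intro semistable_similarity[OF _ L(2) st]) (simp add: full_lattice_def)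
  have tLv: "covol ((*\<^sub>R) ?t ` L) = T"
    using full_lattice_similarity(2)[OF L(1) st] L(3) T by simp
  have sc: "scale_class T C = isometry_rel `` {(*\<^sub>R) ?t ` L}"
    unfolding L(4) by (rule scale_isometry_class[OF L(1) T])
  show "scale_class T C \<in> moduli"
    unfolding sc moduli_def by (rule quotientI) (use tL tLs in simp)
  obtain f where f: "orthogonal_transformation f" "rep (scale_class T C) = f ` (*\<^sub>R) ?t ` L"
    unfolding sc using tL by (rule rep_isometry_class)
  obtain f' where f': "orthogonal_transformation f'" "rep C = f' ` L"
    unfolding L(4) using L(1) by (rule rep_isometry_class)
  have covol: "covol (rep (scale_class T C)) = T"
    unfolding f(2) using full_lattice_similarity(2)[OF tL similarity_orthogonal[OF f(1)]] tLv by simp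
  have "(\<Sum>\<^sub>\<infinity>x\<in>rep (scale_class T C). exp (- pi * (norm x)\<^sup>2)) = theta L T"
  proof -
    have inj: "inj_on (\<lambda>x. f (?t *\<^sub>R x)) L"
    proof (rule inj_onI)
      fix x y assume "f (?t *\<^sub>R x) = f (?t *\<^sub>R y)"
      then have "?t *\<^sub>R x = ?t *\<^sub>R y" by (rule injD[OF orthogonal_transformation_inj[OF f(1)]])
      then show "x = y" using t by simp
    qed
    have "?t\<^sup>2 = T powr (2 / real CARD('n))"
    proof -
      have "?t = T powr (1 / real CARD('n))" using T by (intro root_powr_inverse) auto
      then show ?thesis by (simp add: powr_powr power2_eq_square flip: powr_add)
    qed
    then have "(norm (f (?t *\<^sub>R x)))\<^sup>2 = T powr (2 / real CARD('n)) * (norm x)\<^sup>2" for x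
      using t by (simp add: orthogonal_transformation_norm[OF f(1)] power_mult_distrib)
    moreover have "rep (scale_class T C) = (\<lambda>x. f (?t *\<^sub>R x)) ` L" by (simp add: f(2) image_image)
    ultimately show ?thesis
      by (simp add: infsum_reindex[OF inj] o_def theta_def mult.assoc)
  qed
  also have "theta L T = theta (rep C) T" unfolding f'(2) by (rule theta_orthogonal[OF f'(1), symmetric])
  finally have h0: "h0 (rep (scale_class T C)) = ln (theta (rep C) T)" by (simp add: h0_def)
  have "exp (h0 (rep (scale_class T C))) = theta (rep C) T"
    unfolding h0 using theta_ge_1[OF sep_set_rep[OF C] T] by (intro exp_ln) linarith
  then show "zeta_integrand s (rep (scale_class T C)) = of_real (theta (rep C) T - 1) * exp (s * of_real (ln T))"
    by (simp add: zeta_integrand_def arakelov_deg_def covol)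
qed

lemma SL_real_row_lattice:
  assumes "g \<in> SL_real"
  shows "full_lattice (row_lattice g)" "covol (row_lattice g) = 1"
  using full_lattice_row_lattice[of g] assms by (simp_all add: SL_real_def)


text \<open>Theta series decrease in T, and a strict inequality persists for a slightly larger
  rational q. Hence the superlevel set is the countable union over positive rational q of rectangles
  with second factor the interval from 0 to q.\<close>

lemma theta_measurable_pair:
  fixes M1 :: "(real^'n) set set measure"
  assumes sep: "\<And>C. C \<in> space M1 \<Longrightarrow> sep_set (rep C)"
    and meas: "\<And>T. T > 0 \<Longrightarrow> (\<lambda>C. theta (rep C) T) \<in> borel_measurable M1"
  shows "(\<lambda>(C, T). theta (rep C) T) \<in> borel_measurable (M1 \<Otimes>\<^sub>M mult_haar)"
proof (rule borel_measurable_iff_greater[THEN iffD2], rule allI)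
  fix a
  let ?P = "M1 \<Otimes>\<^sub>M mult_haar"
  define A where "A q = {C \<in> space M1. a < theta (rep C) q} \<times> {0<..<q}" for q
  have "{p \<in> space ?P. a < (case p of (C, T) \<Rightarrow> theta (rep C) T)} = (\<Union>q\<in>\<rat> \<inter> {0<..}. A q)"
  proof (intro equalityI subsetI)
    fix p assume "p \<in> {p \<in> space ?P. a < (case p of (C, T) \<Rightarrow> theta (rep C) T)}"
    then obtain C T where p: "p = (C, T)" "C \<in> space M1" "T > 0" "a < theta (rep C) T"
      by (auto simp: space_pair_measure)
    obtain q where q: "q \<in> \<rat>" "T < q" "a < theta (rep C) q"
      using sep[OF p(2)] p(3,4) by (rule theta_greater_rational)
    have "p \<in> A q" using p q by (simp add: A_def)
    moreover have "q \<in> \<rat> \<inter> {0<..}" using p(3) q by simp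
    ultimately show "p \<in> (\<Union>q\<in>\<rat> \<inter> {0<..}. A q)" by (rule UN_I[rotated])
  next
    fix p assume "p \<in> (\<Union>q\<in>\<rat> \<inter> {0<..}. A q)"
    then obtain q C T where p: "p = (C, T)" "C \<in> space M1" "a < theta (rep C) q" "0 < T" "T < q"
      by (auto simp: A_def)
    have "a < theta (rep C) T"
      by (rule theta_mono[OF sep[OF p(2)] p(4) less_imp_le[OF p(5)] p(3)])
    then show "p \<in> {p \<in> space ?P. a < (case p of (C, T) \<Rightarrow> theta (rep C) T)}"
      using p by (simp add: space_pair_measure)
  qed
  also have "\<dots> \<in> sets ?P"
  proof (rule sets.countable_UN'')
    show "countable (\<rat> \<inter> {0<..} :: real set)" by (simp add: countable_rat)
    fix q :: real assume q: "q \<in> \<rat> \<inter> {0<..}"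
    have "{C \<in> space M1. a < theta (rep C) q} \<in> sets M1"
      using meas[of q] q unfolding borel_measurable_iff_greater by simp
    moreover have "{0<..<q} \<in> sets mult_haar"
      by (simp add: mult_haar_def sets_restrict_space_iff) auto
    ultimately show "A q \<in> sets ?P" unfolding A_def by (rule pair_measureI)
  qed
  finally show "{p \<in> space ?P. a < (case p of (C, T) \<Rightarrow> theta (rep C) T)} \<in> sets ?P" .
qed

lemma exp_measurable_mult_haar:
  "(\<lambda>T. exp (s * complex_of_real (ln T))) \<in> borel_measurable mult_haar"
  by (rule measurable_mult_haarI) measurable

text \<open>The Mellin transform identifies the inner integral over T with n/2 times the Epstein
  zeta function; uniform bounds and finite total mass give absolute integrability. The measurability
  of the Epstein zeta function in C is a by-product of Fubini, since it appears as an inner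
  integral.\<close>

lemma
  fixes M1 :: "(real^'n) set set measure" and s :: complex
  assumes fin: "finite_measure M1" and space: "space M1 \<subseteq> moduli_vol 1"
    and meas: "\<And>T. T > 0 \<Longrightarrow> (\<lambda>C. theta (rep C) T) \<in> borel_measurable M1"
    and s: "Re s > 1"
  defines "k \<equiv> (\<lambda>(C, T). complex_of_real (theta (rep C) T - 1) * exp (s * of_real (ln T)))"
  shows theta_mellin_pair_measurable: "k \<in> borel_measurable (M1 \<Otimes>\<^sub>M mult_haar)"
    and theta_mellin_pair_integrable: "integrable (M1 \<Otimes>\<^sub>M mult_haar) k"
    and epstein_integrable: "integrable M1 (\<lambda>C. epstein_hat (rep C) (of_nat CARD('n) / 2 * s))"
    and theta_mellin_pair_integral: "integral\<^sup>L (M1 \<Otimes>\<^sub>M mult_haar) k =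
      of_nat CARD('n) / 2 * (\<integral>C. epstein_hat (rep C) (of_nat CARD('n) / 2 * s) \<partial>M1)"
proof -
  let ?n = "real CARD('n)"
  interpret M1: finite_measure M1 by (rule fin)
  interpret M2: sigma_finite_measure mult_haar by (rule sigma_finite_mult_haar)
  interpret P: pair_sigma_finite M1 mult_haar ..
  have sep: "sep_set (rep C)" if "C \<in> space M1" for C
    using that space by (intro sep_set_rep) blast
  have [measurable]: "(\<lambda>p. theta (rep (fst p)) (snd p)) \<in> borel_measurable (M1 \<Otimes>\<^sub>M mult_haar)"
    using theta_measurable_pair[OF sep meas] by (simp add: case_prod_unfold)
  have [measurable]: "(\<lambda>p. exp (s * complex_of_real (ln (snd p)))) \<in> borel_measurable (M1 \<Otimes>\<^sub>M mult_haar)"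
    by (rule measurable_compose[OF measurable_snd exp_measurable_mult_haar])
  show k: "k \<in> borel_measurable (M1 \<Otimes>\<^sub>M mult_haar)"
    unfolding k_def case_prod_unfold by measurable
  \<comment> \<open>The bound of \<open>mellin_theta_norm_le\<close>: it involves only the dimension
    and \<open>Re s\<close>, so one constant dominates for all C.\<close>
  define B where "B = ?n / 2 * (pi powr (- (?n / 2 * Re s)) * \<bar>Gamma (?n / 2 * Re s)\<bar> *
         (5 ^ CARD('n) / (1 - 2 powr (?n - ?n * Re s))))"
  have kC: "(\<lambda>T. k (C, T)) = (\<lambda>T. of_real (theta (rep C) T - 1) * exp (s * of_real (ln T)))" for C
    by (simp add: k_def)
  have int: "integrable mult_haar (\<lambda>T. k (C, T))" if "C \<in> space M1" for C
    unfolding kC by (rule mellin_theta_integrable[OF sep[OF that] s])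
  have val: "(\<integral>T. k (C, T) \<partial>mult_haar) = of_nat CARD('n) / 2 * epstein_hat (rep C) (of_nat CARD('n) / 2 * s)"
    if "C \<in> space M1" for C
    using mellin_theta[OF sep[OF that] s] unfolding kC by simp
  have bound: "(\<integral>T. norm (k (C, T)) \<partial>mult_haar) \<le> B" if "C \<in> space M1" for C
    using mellin_theta_norm_le[OF sep[OF that] s] by (simp add: k_def B_def)
  show kint: "integrable (M1 \<Otimes>\<^sub>M mult_haar) k"
  proof (rule P.Fubini_integrable[OF k])
    show "AE C in M1. integrable mult_haar (\<lambda>T. k (C, T))" by (rule AE_I2) (rule int)
    show "integrable M1 (\<lambda>C. \<integral>T. norm (k (C, T)) \<partial>mult_haar)"
    proof (rule M1.integrable_const_bound)
      show "AE C in M1. norm (\<integral>T. norm (k (C, T)) \<partial>mult_haar) \<le> B"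
      proof (rule AE_I2)
        fix C assume "C \<in> space M1"
        have "0 \<le> (\<integral>T. norm (k (C, T)) \<partial>mult_haar)" by (rule Bochner_Integration.integral_nonneg) simp
        then show "norm (\<integral>T. norm (k (C, T)) \<partial>mult_haar) \<le> B" using bound[OF \<open>C \<in> space M1\<close>] by simp
      qed
      have "(\<lambda>p. norm (k p)) \<in> borel_measurable (M1 \<Otimes>\<^sub>M mult_haar)"
        by (rule measurable_compose[OF k]) simp
      then show "(\<lambda>C. \<integral>T. norm (k (C, T)) \<partial>mult_haar) \<in> borel_measurable M1"
        by (intro M2.borel_measurable_lebesgue_integral) simp
    qed
  qed
  have "integrable M1 (\<lambda>C. \<integral>T. k (C, T) \<partial>mult_haar)" by (rule P.integrable_fst'[OF kint])
  then have "integrable M1 (\<lambda>C. of_nat CARD('n) / 2 * epstein_hat (rep C) (of_nat CARD('n) / 2 * s))"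
    by (subst (asm) Bochner_Integration.integrable_cong[OF refl val]) simp_all
  then have "integrable M1 (\<lambda>C. 2 / of_nat CARD('n) *
      (of_nat CARD('n) / 2 * epstein_hat (rep C) (of_nat CARD('n) / 2 * s)))"
    by (rule integrable_mult_right)
  then show "integrable M1 (\<lambda>C. epstein_hat (rep C) (of_nat CARD('n) / 2 * s))"
    by simp
  have "integral\<^sup>L (M1 \<Otimes>\<^sub>M mult_haar) k = (\<integral>C. (\<integral>T. k (C, T) \<partial>mult_haar) \<partial>M1)"
    by (rule P.integral_fst'[OF kint, symmetric])
  also have "\<dots> = (\<integral>C. of_nat CARD('n) / 2 * epstein_hat (rep C) (of_nat CARD('n) / 2 * s) \<partial>M1)"
    by (rule Bochner_Integration.integral_cong[OF refl val])
  also have "\<dots> = of_nat CARD('n) / 2 * (\<integral>C. epstein_hat (rep C) (of_nat CARD('n) / 2 * s) \<partial>M1)"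
    by (rule integral_mult_right_zero)
  finally show "integral\<^sup>L (M1 \<Otimes>\<^sub>M mult_haar) k =
      of_nat CARD('n) / 2 * (\<integral>C. epstein_hat (rep C) (of_nat CARD('n) / 2 * s) \<partial>M1)" .
qed

text \<open>\<open>mu1\<close> is the image of the Haar measure restricted to matrices in a
  fundamental domain with semi-stable row lattice. Their nonzero lattice vectors have norm at least
  1, which gives finite mass; theta series are measurable because they are so as functions of the
  matrix.\<close>

lemma
  fixes H :: "(real^'n^'n) measure"
  assumes H: "haar_measure_SL H"
  shows finite_measure_mu1: "finite_measure (mu1 H)"
    and theta_measurable_mu1: "\<And>T. T > 0 \<Longrightarrow> (\<lambda>C. theta (rep C) T) \<in> borel_measurable (mu1 H)"
    and space_mu1: "space (mu1 H) = moduli_vol 1"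
proof -
  define F where "F = (SOME F :: (real^'n^'n) set. fundamental_domain F)"
  have F: "fundamental_domain F" unfolding F_def using fundamental_domain_exists by (rule someI_ex)
  have FSL: "F \<subseteq> SL_real" using F unfolding fundamental_domain_def by (elim conjE)
  define S where "S = {g \<in> F. semistable (row_lattice g)}"
  define N where "N = restrict_space H S"
  define c where "c = (\<lambda>g :: real^'n^'n. isometry_rel `` {row_lattice g})"
  have mu1: "mu1 H = push_measure N (moduli_vol 1) c"
    by (simp add: mu1_def N_def S_def F_def c_def)
  have setsH: "sets H = sets (restrict_space borel SL_real)" using H by (simp add: haar_measure_SL_def)
  have "space H = SL_real"
    using sets_eq_imp_space_eq[OF setsH] by (simp add: space_restrict_space)
  then have spaceN: "space N = S" using FSL by (auto simp: N_def space_restrict_space S_def)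
  have SSL: "g \<in> SL_real" if "g \<in> S" for g using that FSL by (auto simp: S_def)
  have good: "full_lattice (row_lattice g)" "semistable (row_lattice g)" "covol (row_lattice g) = 1" if "g \<in> S" for g
    using SL_real_row_lattice[OF SSL[OF that]] that by (simp_all add: S_def)
  have c: "c g \<in> moduli_vol 1" if "g \<in> space N" for g
    unfolding c_def moduli_vol_def by (rule quotientI) (use good that spaceN in simp)
  show "space (mu1 H) = moduli_vol 1" by (simp add: mu1)
  have "emeasure H S < \<infinity>"
  \<comment> \<open>A set outside the sigma-algebra has \<open>emeasure\<close> 0 by
    convention.\<close>
  proof (cases "S \<in> sets H")
    case True
    show ?thesis
    proof (rule haar_finite_min_norm[OF H F _ True])
      show "S \<subseteq> F" by (auto simp: S_def)
      show "norm x \<ge> 1" if "g \<in> S" "x \<in> row_lattice g" "x \<noteq> 0" for g x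
        by (rule semistable_min_norm[OF good[OF that(1)] that(2,3)])
    qed
  qed (simp add: emeasure_notin_sets)
  then have "emeasure N (space N) < \<infinity>"
    using emeasure_restrict_space_space_le[of H S] spaceN \<open>space H = SL_real\<close> SSL
    by (simp add: N_def Int_absorb2 subset_eq)
  then have "finite_measure N" by (intro finite_measureI) simp
  then show "finite_measure (mu1 H)"
    unfolding mu1 using c by (rule finite_measure_push_measure)
  fix T :: real assume T: "T > 0"
  have "(\<lambda>g. theta (row_lattice g) T) \<in> borel_measurable N"
  proof (rule theta_measurable_row_lattice[OF _ _ _ T])
    show "u \<in> borel_measurable N" if "u \<in> borel_measurable borel" for u :: "real^'n^'n \<Rightarrow> real"
    proof -
      have "u \<in> borel_measurable (restrict_space borel SL_real)"
        using that by (rule measurable_restrict_space1)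
      then have "u \<in> borel_measurable H" by (simp only: measurable_cong_sets[OF setsH refl])
      then show ?thesis unfolding N_def by (rule measurable_restrict_space1)
    qed
    show "sep_set (row_lattice g)" if "g \<in> space N" for g
      using good[of g] that spaceN by (intro sep_set_semistable) simp_all
    show "det g \<noteq> 0" if "g \<in> space N" for g
      using SSL[of g] that spaceN by (simp add: SL_real_def)
  qed
  moreover have "theta (row_lattice g) T = theta (rep (c g)) T" if "g \<in> space N" for g
  proof -
    have full: "full_lattice (row_lattice g)" using good(1) that spaceN by simp
    obtain f where f: "orthogonal_transformation f" "rep (c g) = f ` row_lattice g"
      unfolding c_def using full by (rule rep_isometry_class)
    show ?thesis unfolding f(2) by (rule theta_orthogonal[OF f(1), symmetric])
  qed
  ultimately have "(\<lambda>g. theta (rep (c g)) T) \<in> borel_measurable N"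
    by (simp cong: measurable_cong)
  with c show "(\<lambda>C. theta (rep C) T) \<in> borel_measurable (mu1 H)"
    unfolding mu1 by (rule borel_measurable_push_measure(2)[where f = c])
qed

text \<open>The two integrability statements give the equation its content: the Bochner integral of
  a non-integrable function is 0 by convention, so the equation alone would not assert
  convergence.\<close>

theorem mainTheorem3:
  fixes H :: "(real^'n^'n) measure" and s :: complex
  assumes "haar_measure_SL H"
    and "Re s > real CARD('n)"
  shows "integrable (mu H) (\<lambda>C. zeta_integrand s (rep C)) \<and>
    integrable (mu1 H) (\<lambda>C. epstein_hat (rep C) (of_nat CARD('n) / 2 * s)) \<and>
    xi_Q H s =
      of_nat CARD('n) / 2 * (\<integral>C. epstein_hat (rep C) (of_nat CARD('n) / 2 * s) \<partial>mu1 H)"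
proof -
  define k where "k = (\<lambda>(C :: (real^'n) set set, T). complex_of_real (theta (rep C) T - 1) * exp (s * of_real (ln T)))"
  have n: "real CARD('n) \<ge> 1" using zero_less_card_finite[where ?'a = 'n] by linarith
  then have s: "Re s > 1" using assms(2) by linarith
  note M1 = finite_measure_mu1[OF assms(1)] eq_refl[OF space_mu1[OF assms(1)]] theta_measurable_mu1[OF assms(1)]
  have k: "k \<in> borel_measurable (mu1 H \<Otimes>\<^sub>M mult_haar)" "integrable (mu1 H \<Otimes>\<^sub>M mult_haar) k"
    and ks: "integrable (mu1 H) (\<lambda>C. epstein_hat (rep C) (of_nat CARD('n) / 2 * s))"
      "integral\<^sup>L (mu1 H \<Otimes>\<^sub>M mult_haar) k =
         of_nat CARD('n) / 2 * (\<integral>C. epstein_hat (rep C) (of_nat CARD('n) / 2 * s) \<partial>mu1 H)"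
    unfolding k_def
    by (rule theta_mellin_pair_measurable[OF M1 s] theta_mellin_pair_integrable[OF M1 s]
        epstein_integrable[OF M1 s] theta_mellin_pair_integral[OF M1 s], assumption?)+
  let ?P = "mu1 H \<Otimes>\<^sub>M mult_haar" and ?c = "\<lambda>(C, T). scale_class T C"
  have space: "fst p \<in> moduli_vol 1" "snd p > 0" if "p \<in> space ?P" for p
    using that by (auto simp: space_pair_measure space_mu1[OF assms(1)])
  have c: "?c p \<in> moduli" if "p \<in> space ?P" for p
    using scale_class_moduli(1)[OF space[OF that]] by (simp add: case_prod_unfold)
  have zeta: "zeta_integrand s (rep (?c p)) = k p" if "p \<in> space ?P" for p
    using scale_class_moduli(2)[OF space[OF that]] by (simp add: case_prod_unfold k_def)
  have meas: "(\<lambda>p. zeta_integrand s (rep (?c p))) \<in> borel_measurable ?P"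
    using k(1) by (subst measurable_cong[OF zeta])
  have push: "integrable (mu H) (\<lambda>C. zeta_integrand s (rep C)) \<longleftrightarrow>
      integrable ?P (\<lambda>p. zeta_integrand s (rep (?c p)))"
    "xi_Q H s = (\<integral>p. zeta_integrand s (rep (?c p)) \<partial>?P)"
    unfolding xi_Q_def mu_def
    by (rule integral_push_measure[where u = "\<lambda>C. zeta_integrand s (rep C)" and f = ?c],
        rule c, assumption, rule meas)+
  have "integrable (mu H) (\<lambda>C. zeta_integrand s (rep C))"
    unfolding push(1) using k(2) by (subst Bochner_Integration.integrable_cong[OF refl zeta])
  moreover have "xi_Q H s = integral\<^sup>L ?P k"
    unfolding push(2) by (rule Bochner_Integration.integral_cong[OF refl zeta])
  ultimately show ?thesis using ks by simp
qed

end
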